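(* Let $(\Sigma,\sigma)$ be a topologically mixing countable state Markov shift with the BIP property. Let $\mathcal{F}=\{\log f_n\}_{n=1}^\infty$ be an almost-additive Bowen sequence on $\Sigma$ with $\sum_{a\in S}\sup f_1|_{C_a}<\infty$. Then there is a Gibbs measure $\mu$ for $\mathcal{F}$ and it is mixing. Moreover, if $h(\mu)<\infty$, then $\mu$ is the unique equilibrium measure for $\mathcal{F}$.
   Context: Let $S$ be a countable alphabet and $(t_{ij})_{S\times S}$ a matrix of zeros and ones with no row and no column made entirely of zeros. The (one-sided) countable Markov shift is $\Sigma=\{x=(x_0,x_1,\dots)\in S^{\mathbb{N}_0}: t_{x_ix_{i+1}}=1\text{ for all } i\ge 0\}$ with the shift map $(\sigma x)_n=x_{n+1}$, with the topology generated by cylinders $C_{i_0\dots i_{n-1}}=\{x\in\Sigma: x_j=i_j,\ 0\le j\le n-1\}$ (for admissible words $i_0\dots i_{n-1}$). It is topologically mixing if for all $a,b\in S$ there is $N_{ab}\in\mathbb{N}$ with $C_a\cap\sigma^{-n}C_b\ne\emptyset$ for all $n>N_{ab}$. It satisfies the big images and preimages (BIP) property if there is a finite set $\{b_1,\dots,b_n\}\subset S$ such that for every $a\in S$ there exist $i,j$ with $t_{b_ia}t_{ab_j}=1$. $\mathcal{M}$ is the set of $\sigma$-invariant Borel probability measures on $\Sigma$ and $h(\mu)$ is the measure-theoretic entropy of $\mu$ with respect to $\sigma$. Let $f_n:\Sigma\to(0,\infty)$, $n\in\mathbb{N}$, be continuous. The sequence $\mathcal{F}=\{\log f_n\}_{n=1}^\infty$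 is almost-additive if there is a constant $C\ge 0$ such that for all $n,m\in\mathbb{N}$, $x\in\Sigma$: $f_n(x)f_m(\sigma^nx)e^{-C}\le f_{n+m}(x)\le f_n(x)f_m(\sigma^nx)e^{C}$. It is a Bowen sequence if there is $M>0$ with $\sup_n A_n\le M$, where $A_n=\sup\{f_n(x)/f_n(y): x,y\in\Sigma,\ x_i=y_i\text{ for }0\le i\le n-1\}$. The almost-additive Gurevich pressure is $P(\mathcal{F})=\lim_{n\to\infty}\frac1n\log\sum_{\sigma^nx=x}f_n(x)\chi_{C_a}(x)$, $a\in S$, where $\chi_{C_a}$ is the characteristic function of $C_a$; for an almost-additive Bowen sequence on a topologically mixing shift this limit exists in $(-\infty,\infty]$ and does not depend on $a$. A measure $\mu\in\mathcal{M}$ is Gibbs for $\mathcal{F}$ if there exist constants $K>0$ and $P\in\mathbb{R}$ such that for every $n\in\mathbb{N}$ and every $x\in C_{i_0\dots i_{n-1}}$, $\frac1K\le\frac{\mu(C_{i_0\dots i_{n-1}})}{\exp(-nP)f_n(x)}\le K$. A measure $\mu\in\mathcal{M}$ is an equilibrium measure for $\mathcal{F}$ if $P(\mathcal{F})=h(\mu)+\lim_{n\to\infty}\frac1n\int\log f_n\,d\mu$. *)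

theory Defs
  imports "HOL-Probability.Probability"
begin

section \<open>Extended-real auxiliaries\<close>

definition log_ext :: "ennreal \<Rightarrow> ereal" where
  "log_ext r = (if r = 0 then -\<infinity> else if r = \<infinity> then \<infinity> else ereal (ln (enn2real r)))"

text \<open>
  Unlike the Bochner integral, which is \<open>0\<close> for non-integrable functions, this
  integral takes the values \<open>\<infinity>\<close> and \<open>-\<infinity>\<close>.
  Coercion of a real to \<^typ>\<open>ennreal\<close> truncates negative numbers to \<open>0\<close>, so the two terms are the
  integrals of the positive and of the negative part.
\<close>
definition integral_ext :: "'a measure \<Rightarrow> ('a \<Rightarrow> real) \<Rightarrow> ereal" where
  "integral_ext M g =
     enn2ereal (\<integral>\<^sup>+ x. ennreal (g x) \<partial>M) - enn2ereal (\<integral>\<^sup>+ x. ennreal (- g x) \<partial>M)"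


section \<open>Measure-preserving transformations: mixing and entropy\<close>

definition measure_preserving_map :: "'a measure \<Rightarrow> ('a \<Rightarrow> 'a) \<Rightarrow> bool" where
  "measure_preserving_map M T \<longleftrightarrow> T \<in> measurable M M \<and> distr M M T = M"

definition mixing_map :: "'a measure \<Rightarrow> ('a \<Rightarrow> 'a) \<Rightarrow> bool" where
  "mixing_map M T \<longleftrightarrow> measure_preserving_map M T \<and>
     (\<forall>A\<in>sets M. \<forall>B\<in>sets M.
        (\<lambda>n. measure M (A \<inter> ((T ^^ n) -` B \<inter> space M))) \<longlonglongrightarrow> measure M A * measure M B)"

text \<open>
  Below, \<open>0 ln 0 = 0\<close> since \<open>ln 0 = 0\<close> in HOL. The limit in \<open>partition_entropy_rate\<close> exists (by
  subadditivity) whenever \<open>T\<close> preserves the probability measure \<open>M\<close>. Empty members of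
  the preimage partitions are discarded by \<open>common_refinement\<close>.
\<close>

definition partition_entropy :: "'a measure \<Rightarrow> 'a set set \<Rightarrow> real" where
  "partition_entropy M Q = - (\<Sum>A\<in>Q. measure M A * ln (measure M A))"

definition iterated_refinement :: "'a measure \<Rightarrow> ('a \<Rightarrow> 'a) \<Rightarrow> 'a set set \<Rightarrow> nat \<Rightarrow> 'a set set" where
  "iterated_refinement M T Q n =
     common_refinement ((\<lambda>i. (\<lambda>A. (T ^^ i) -` A \<inter> space M) ` Q) ` {..<n})"

definition partition_entropy_rate :: "'a measure \<Rightarrow> ('a \<Rightarrow> 'a) \<Rightarrow> 'a set set \<Rightarrow> real" where
  "partition_entropy_rate M T Q =
     lim (\<lambda>n. partition_entropy M (iterated_refinement M T Q n) / real n)"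

definition measure_entropy :: "'a measure \<Rightarrow> ('a \<Rightarrow> 'a) \<Rightarrow> ereal" where
  "measure_entropy M T =
     (SUP Q\<in>{Q. finite Q \<and> partition_on (space M) Q \<and> Q \<subseteq> sets M}.
        ereal (partition_entropy_rate M T Q))"


section \<open>Countable Markov shifts\<close>

text \<open>The alphabet is the whole (automatically nonempty) type \<open>'s :: countable\<close>.\<close>

definition transition_matrix :: "('s::countable \<Rightarrow> 's \<Rightarrow> nat) \<Rightarrow> bool" where
  "transition_matrix t \<longleftrightarrow>
     (\<forall>i j. t i j \<in> {0, 1}) \<and> (\<forall>i. \<exists>j. t i j \<noteq> 0) \<and> (\<forall>j. \<exists>i. t i j \<noteq> 0)"

definition markov_shift :: "('s::countable \<Rightarrow> 's \<Rightarrow> nat) \<Rightarrow> (nat \<Rightarrow> 's) set" where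
  "markov_shift t = {x. \<forall>i. t (x i) (x (Suc i)) = 1}"

definition shift_map :: "(nat \<Rightarrow> 's) \<Rightarrow> nat \<Rightarrow> 's" where
  "shift_map x = (\<lambda>n. x (Suc n))"

definition admissible :: "('s::countable \<Rightarrow> 's \<Rightarrow> nat) \<Rightarrow> 's list \<Rightarrow> bool" where
  "admissible t w \<longleftrightarrow> w \<noteq> [] \<and> (\<forall>i. Suc i < length w \<longrightarrow> t (w ! i) (w ! Suc i) = 1)"

definition cylinder :: "('s::countable \<Rightarrow> 's \<Rightarrow> nat) \<Rightarrow> 's list \<Rightarrow> (nat \<Rightarrow> 's) set" where
  "cylinder t w = {x \<in> markov_shift t. \<forall>j<length w. x j = w ! j}"

definition markov_topology :: "('s::countable \<Rightarrow> 's \<Rightarrow> nat) \<Rightarrow> (nat \<Rightarrow> 's) topology" where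
  "markov_topology t = topology_generated_by {cylinder t w | w. admissible t w}"

definition markov_borel :: "('s::countable \<Rightarrow> 's \<Rightarrow> nat) \<Rightarrow> (nat \<Rightarrow> 's) measure" where
  "markov_borel t = sigma (markov_shift t) {U. openin (markov_topology t) U}"

definition topologically_mixing :: "('s::countable \<Rightarrow> 's \<Rightarrow> nat) \<Rightarrow> bool" where
  "topologically_mixing t \<longleftrightarrow>
     (\<forall>a b. \<exists>N. \<forall>n>N. cylinder t [a] \<inter> (shift_map ^^ n) -` cylinder t [b] \<noteq> {})"

definition BIP :: "('s::countable \<Rightarrow> 's \<Rightarrow> nat) \<Rightarrow> bool" where
  "BIP t \<longleftrightarrow> (\<exists>B. finite B \<and> (\<forall>a. \<exists>b\<in>B. \<exists>b'\<in>B. t b a * t a b' = 1))"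

definition invariant_measures :: "('s::countable \<Rightarrow> 's \<Rightarrow> nat) \<Rightarrow> (nat \<Rightarrow> 's) measure set" where
  "invariant_measures t =
     {\<mu>. prob_space \<mu> \<and> sets \<mu> = sets (markov_borel t) \<and> measure_preserving_map \<mu> shift_map}"


section \<open>Sequences of potentials\<close>

text \<open>
  The sequence \<open>(log f\<^sub>n)\<^sub>n\<^sub>\<ge>\<^sub>1\<close> is represented by \<open>f\<close>. Only the values of \<open>f n\<close> for \<open>n \<ge> 1\<close> on
  \<^term>\<open>markov_shift t\<close> matter.
\<close>

definition positive_continuous_seq ::
  "('s::countable \<Rightarrow> 's \<Rightarrow> nat) \<Rightarrow> (nat \<Rightarrow> (nat \<Rightarrow> 's) \<Rightarrow> real) \<Rightarrow> bool" where
  "positive_continuous_seq t f \<longleftrightarrow>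
     (\<forall>n\<ge>1. (\<forall>x\<in>markov_shift t. 0 < f n x) \<and>
             continuous_map (markov_topology t) euclideanreal (f n))"

definition almost_additive ::
  "('s::countable \<Rightarrow> 's \<Rightarrow> nat) \<Rightarrow> (nat \<Rightarrow> (nat \<Rightarrow> 's) \<Rightarrow> real) \<Rightarrow> bool" where
  "almost_additive t f \<longleftrightarrow>
     (\<exists>C\<ge>0. \<forall>n\<ge>1. \<forall>m\<ge>1. \<forall>x\<in>markov_shift t.
        f n x * f m ((shift_map ^^ n) x) * exp (- C) \<le> f (n + m) x \<and>
        f (n + m) x \<le> f n x * f m ((shift_map ^^ n) x) * exp C)"

definition bowen_variation ::
  "('s::countable \<Rightarrow> 's \<Rightarrow> nat) \<Rightarrow> (nat \<Rightarrow> (nat \<Rightarrow> 's) \<Rightarrow> real) \<Rightarrow> nat \<Rightarrow> ereal" where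
  "bowen_variation t f n =
     Sup {ereal (f n x / f n y) | x y.
            x \<in> markov_shift t \<and> y \<in> markov_shift t \<and> (\<forall>i<n. x i = y i)}"

definition bowen_seq ::
  "('s::countable \<Rightarrow> 's \<Rightarrow> nat) \<Rightarrow> (nat \<Rightarrow> (nat \<Rightarrow> 's) \<Rightarrow> real) \<Rightarrow> bool" where
  "bowen_seq t f \<longleftrightarrow> (\<exists>M>0. (SUP n\<in>{1..}. bowen_variation t f n) \<le> ereal M)"

definition partition_function ::
  "('s::countable \<Rightarrow> 's \<Rightarrow> nat) \<Rightarrow> (nat \<Rightarrow> (nat \<Rightarrow> 's) \<Rightarrow> real) \<Rightarrow> 's \<Rightarrow> nat \<Rightarrow> ennreal" where
  "partition_function t f a n =
     (\<Sum>\<^sub>\<infinity>x\<in>{x \<in> markov_shift t. (shift_map ^^ n) x = x}. ennreal (f n x * indicator (cylinder t [a]) x))"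

text \<open>
  The common value of the limits over all symbols \<open>a\<close>; it exists for an almost-additive Bowen
  sequence on a topologically mixing shift.
\<close>
definition gurevich_pressure ::
  "('s::countable \<Rightarrow> 's \<Rightarrow> nat) \<Rightarrow> (nat \<Rightarrow> (nat \<Rightarrow> 's) \<Rightarrow> real) \<Rightarrow> ereal" where
  "gurevich_pressure t f =
     (THE P. \<forall>a. (\<lambda>n. log_ext (partition_function t f a n) / ereal (real n)) \<longlonglongrightarrow> P)"

definition gibbs_measure ::
  "('s::countable \<Rightarrow> 's \<Rightarrow> nat) \<Rightarrow> (nat \<Rightarrow> (nat \<Rightarrow> 's) \<Rightarrow> real) \<Rightarrow> (nat \<Rightarrow> 's) measure \<Rightarrow> bool" where
  "gibbs_measure t f \<mu> \<longleftrightarrow> \<mu> \<in> invariant_measures t \<and>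
     (\<exists>K>0. \<exists>P::real. \<forall>w. admissible t w \<longrightarrow> (\<forall>x\<in>cylinder t w.
        1 / K \<le> measure \<mu> (cylinder t w) / (exp (- real (length w) * P) * f (length w) x) \<and>
        measure \<mu> (cylinder t w) / (exp (- real (length w) * P) * f (length w) x) \<le> K))"

text \<open>
  When \<open>f\<^sub>1\<close> is bounded, \<open>L < \<infinity>\<close>. The remaining undetermined case, entropy \<open>\<infinity>\<close> and \<open>L = -\<infinity>\<close>, has
  sum \<open>\<infinity>\<close> by the convention of \<^typ>\<open>ereal\<close>, so such a measure is never an equilibrium
  measure for a sequence of finite pressure.
\<close>
definition equilibrium_measure ::
  "('s::countable \<Rightarrow> 's \<Rightarrow> nat) \<Rightarrow> (nat \<Rightarrow> (nat \<Rightarrow> 's) \<Rightarrow> real) \<Rightarrow> (nat \<Rightarrow> 's) measure \<Rightarrow> bool" where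
  "equilibrium_measure t f \<mu> \<longleftrightarrow> \<mu> \<in> invariant_measures t \<and>
     (\<exists>L. (\<lambda>n. integral_ext \<mu> (\<lambda>x. ln (f n x)) / ereal (real n)) \<longlonglongrightarrow> L \<and>
          gurevich_pressure t f = measure_entropy \<mu> shift_map + L)"

end

theory Submission
  imports Defs
begin

text \<open>
  Bounded distortion replaces \<open>f\<^sub>n\<close> by a weight \<open>g\<close> on words with
  \<open>g (u v) \<le> D g u g v\<close>; mixing and BIP give connecting words \<open>c\<close> of one fixed length, taken from
  a finite set, with \<open>g (u c v) \<ge> \<kappa> g u g v\<close>. Hence the sums \<open>Z\<^sub>n\<close> of \<open>g\<close> over words of length \<open>n\<close>
  are comparable to \<open>exp (n P)\<close>, and averages over the positions of a long word, with a common
  summable bound, have a limit point: an invariant measure comparable to \<open>g w exp (- n P)\<close> on the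
  cylinder of \<open>w\<close>.

  A connecting gap of fixed length makes the measure of \<open>C\<^sub>u \<inter> \<sigma>\<^bsup>-(n+N)\<^esup> B\<close> at least a constant times
  \<open>\<mu> C\<^sub>u \<mu> B\<close> for all words \<open>u\<close> of length \<open>n\<close>
  and all Borel sets \<open>B\<close>. This Doeblin minorization contracts every
  absolutely continuous measure towards \<open>\<mu>\<close> in total variation, uniformly in \<open>B\<close>; so \<open>\<mu>\<close> is mixing and is
  the only absolutely continuous invariant probability measure.

  For an equilibrium measure \<open>\<nu>\<close>, the entropy is at most \<open>1/n\<close> times the entropy of words of length \<open>n\<close>, so the
  relative entropies of \<open>\<nu>\<close> with respect to \<open>\<mu>\<close> on words of length \<open>n\<close> are bounded uniformly in \<open>n\<close>. This
  forces absolute continuity and hence \<open>\<nu> = \<mu>\<close>. All entropy inequalities used here are instances of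
  Gibbs' inequality for well-chosen reference weights.
\<close>

section \<open>Sums over words\<close>

text \<open>An almost additive sequence need not consist of Birkhoff sums, so no transfer operator
  is at hand whose eigenmeasure would be the Gibbs measure; everything is derived from sums over
  words. Over an infinite alphabet a limit of word distributions can lose mass, and summability of
  \<open>f 1\<close> over the letters provides the domination that keeps it. Entropy is a supremum
  over finite partitions, whereas the natural partition into first letters may be infinite. The two
  give the same entropy once the information of the first letter is integrable, and finite entropy
  of \<mu> is used to obtain exactly this. For a competitor \<nu> integrability comes from the
  equilibrium identity: the pressure is finite and entropy is nonnegative, so both terms are finite.
  Absolute continuity then requires the error in comparing word entropies with the integrals of
  \<open>ln (f n)\<close> to stay bounded, not merely sublinear; almost additivity gives
  this.\<close>

definition word_sum :: "nat \<Rightarrow> ('s::countable list \<Rightarrow> ennreal) \<Rightarrow> ennreal" where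
  "word_sum n \<phi> = (\<integral>\<^sup>+w. \<phi> w \<partial>count_space {w. length w = n})"

text \<open>The Tonelli lemmas for counting measures speak about \<open>UNIV\<close>, so the
  restriction on the length is moved into the integrand.\<close>

lemma word_sum_UNIV:
  "word_sum n \<phi> = (\<integral>\<^sup>+w. \<phi> w * indicator {w. length w = n} w \<partial>count_space UNIV)"
  unfolding word_sum_def by (subst nn_integral_count_space_indicator) auto

lemma word_sum_cong: "(\<And>w. length w = n \<Longrightarrow> \<phi> w = \<psi> w) \<Longrightarrow> word_sum n \<phi> = word_sum n \<psi>"
  unfolding word_sum_def by (intro nn_integral_cong) auto

lemma word_sum_mono: "(\<And>w. length w = n \<Longrightarrow> \<phi> w \<le> \<psi> w) \<Longrightarrow> word_sum n \<phi> \<le> word_sum n \<psi>"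
  unfolding word_sum_def by (intro nn_integral_mono) auto

lemma word_sum_cmult: "word_sum n (\<lambda>w. c * \<phi> w) = c * word_sum n \<phi>"
  unfolding word_sum_def by (intro nn_integral_cmult) auto

lemma word_sum_multc: "word_sum n (\<lambda>w. \<phi> w * c) = word_sum n \<phi> * c"
  unfolding word_sum_def by (intro nn_integral_multc) auto

lemma word_sum_sum: "word_sum m (\<lambda>w. \<Sum>j\<in>J. \<phi> j w) = (\<Sum>j\<in>J. word_sum m (\<phi> j))"
  unfolding word_sum_def by (intro nn_integral_sum) auto

lemma word_sum_divide: "word_sum m (\<lambda>w. \<phi> w / c) = word_sum m \<phi> / c"
  unfolding word_sum_def by (intro nn_integral_divide) auto

lemma word_sum_ge: "length w = n \<Longrightarrow> \<phi> w \<le> word_sum n \<phi>"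
  unfolding word_sum_def by (intro nn_integral_ge_point) simp

lemma word_sum_0 [simp]: "word_sum 0 \<phi> = \<phi> []"
  unfolding word_sum_def by (simp add: nn_integral_count_space_finite)

lemma word_sum_swap:
  "word_sum n (\<lambda>u. word_sum m (\<lambda>v. \<phi> u v)) = word_sum m (\<lambda>v. word_sum n (\<lambda>u. \<phi> u v))"
proof -
  have "(\<integral>\<^sup>+u. (\<integral>\<^sup>+v. \<phi> u v * indicator {v. length v = m} v \<partial>count_space UNIV) * indicator {u. length u = n} u \<partial>count_space UNIV)
     = (\<integral>\<^sup>+u. (\<integral>\<^sup>+v. \<phi> u v * indicator {v. length v = m} v * indicator {u. length u = n} u \<partial>count_space UNIV) \<partial>count_space UNIV)"
    by (subst nn_integral_multc) auto
  also have "\<dots> = (\<integral>\<^sup>+v. (\<integral>\<^sup>+u. \<phi> u v * indicator {v. length v = m} v * indicator {u. length u = n} u \<partial>count_space UNIV) \<partial>count_space UNIV)"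
    using nn_integral_fst_count_space[of "\<lambda>(u,v). \<phi> u v * indicator {v. length v = m} v * indicator {u. length u = n} u"]
      nn_integral_snd_count_space[of "\<lambda>(u,v). \<phi> u v * indicator {v. length v = m} v * indicator {u. length u = n} u"]
    by simp
  also have "\<dots> = (\<integral>\<^sup>+v. (\<integral>\<^sup>+u. \<phi> u v * indicator {u. length u = n} u \<partial>count_space UNIV) * indicator {v. length v = m} v \<partial>count_space UNIV)"
    by (subst nn_integral_multc [symmetric]) (auto intro!: nn_integral_cong simp: mult_ac)
  finally show ?thesis unfolding word_sum_UNIV .
qed

text \<open>A word of length \<open>n + m\<close> splits in exactly one way into a prefix of length
  \<open>n\<close> and a rest, so Tonelli applies to the pairs.\<close>

lemma word_sum_append:
  "word_sum (n + m) \<phi> = word_sum n (\<lambda>u. word_sum m (\<lambda>v. \<phi> (u @ v)))"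
proof -
  have bij: "bij_betw (\<lambda>(u, v). u @ v) ({u. length u = n} \<times> {v. length v = m}) {w :: 's list. length w = n + m}"
    by (rule bij_betw_byWitness[where f' = "\<lambda>w. (take n w, drop n w)"]) auto
  have "word_sum (n + m) \<phi> = (\<integral>\<^sup>+z. \<phi> (case z of (u, v) \<Rightarrow> u @ v) \<partial>count_space ({u. length u = n} \<times> {v. length v = m}))"
    unfolding word_sum_def by (rule nn_integral_bij_count_space[OF bij, symmetric])
  also have "\<dots> = (\<integral>\<^sup>+z. \<phi> (case z of (u, v) \<Rightarrow> u @ v) * indicator ({u. length u = n} \<times> {v. length v = m}) z \<partial>count_space UNIV)"
    by (subst nn_integral_count_space_indicator) auto
  also have "\<dots> = (\<integral>\<^sup>+u. (\<integral>\<^sup>+v. \<phi> (u @ v) * indicator ({u. length u = n} \<times> {v. length v = m}) (u, v) \<partial>count_space UNIV) \<partial>count_space UNIV)"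
    by (subst nn_integral_fst_count_space [symmetric]) simp
  also have "\<dots> = (\<integral>\<^sup>+u. (\<integral>\<^sup>+v. \<phi> (u @ v) * indicator {v. length v = m} v \<partial>count_space UNIV) * indicator {u. length u = n} u \<partial>count_space UNIV)"
    by (subst nn_integral_multc [symmetric])
       (auto intro!: nn_integral_cong simp: indicator_times mult_ac)
  finally show ?thesis unfolding word_sum_UNIV .
qed

lemma word_sum_1: "word_sum (Suc 0) \<phi> = (\<integral>\<^sup>+a. \<phi> [a] \<partial>count_space UNIV)"
proof -
  have bij: "bij_betw (\<lambda>a. [a]) UNIV {w :: 's list. length w = Suc 0}"
    by (rule bij_betw_byWitness[where f' = hd]) (auto simp: length_Suc_conv)
  show ?thesis
    unfolding word_sum_def by (rule nn_integral_bij_count_space[OF bij, symmetric])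
qed

lemma word_sum_Suc: "word_sum (Suc n) \<phi> = (\<integral>\<^sup>+a. word_sum n (\<lambda>w. \<phi> (a # w)) \<partial>count_space UNIV)"
  using word_sum_append[of "Suc 0" n \<phi>] by (simp add: word_sum_1)

section \<open>Compactness and subadditive sequences\<close>

text \<open>A diagonal argument in disguise: the product of the intervals is compact, and over a
  countable index type the function space is metrizable, so compactness yields convergent
  subsequences.\<close>

lemma convergent_bounded_coords:
  fixes p :: "nat \<Rightarrow> 'a::countable \<Rightarrow> real"
  assumes "\<And>n w. 0 \<le> p n w" "\<And>n w. p n w \<le> b w"
  shows "\<exists>r q. strict_mono r \<and> (\<forall>w. (\<lambda>n. p (r n) w) \<longlonglongrightarrow> q w)"
proof -
  have c: "compact (PiE UNIV (\<lambda>w. {0..b w}))"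
  proof -
    have "compactin (product_topology (\<lambda>_. euclideanreal) (UNIV :: 'a set)) (PiE UNIV (\<lambda>w. {0..b w}))"
      by (subst compactin_PiE) auto
    then show ?thesis by (simp add: euclidean_product_topology)
  qed
  have "\<forall>n. p n \<in> PiE UNIV (\<lambda>w. {0..b w})" using assms by auto
  then obtain l r where "strict_mono r" "(p \<circ> r) \<longlonglongrightarrow> l"
    using compact_imp_seq_compact[OF c] unfolding seq_compact_def by blast
  have "(\<lambda>n. (p \<circ> r) n w) \<longlonglongrightarrow> l w" for w
    by (rule continuous_on_tendsto_compose[OF continuous_on_product_coordinates \<open>(p \<circ> r) \<longlonglongrightarrow> l\<close>]) auto
  with \<open>strict_mono r\<close> show ?thesis by (auto simp: o_def)
qed

text \<open>Fekete's lemma, with the limit equal to the infimum. Index 0 is excluded throughout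
  because \<open>a 0\<close> is unconstrained; the linear lower bound makes the infimum
  finite.\<close>

lemma fekete_limit:
  fixes a :: "nat \<Rightarrow> real"
  assumes sub: "\<And>n m. 0 < n \<Longrightarrow> 0 < m \<Longrightarrow> a (n + m) \<le> a n + a m"
    and lb: "\<And>n. 0 < n \<Longrightarrow> b * real n \<le> a n"
  shows "\<exists>l. (\<lambda>n. a n / real n) \<longlonglongrightarrow> l \<and> (\<forall>n>0. l \<le> a n / real n)"
proof -
  define l where "l = (INF n\<in>{0<..}. a n / real n)"
  have bdd: "bdd_below ((\<lambda>n. a n / real n) ` {0<..})"
    using lb by (intro bdd_belowI2[where m=b]) (auto simp: field_simps)
  have le: "l \<le> a n / real n" if "0 < n" for n
    unfolding l_def using that bdd by (intro cINF_lower) auto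
  have mult: "a (Suc q * k) \<le> real (Suc q) * a k" if "0 < k" for q k
  proof (induction q)
    case (Suc q)
    have "a (Suc (Suc q) * k) = a (k + Suc q * k)" by simp
    also have "\<dots> \<le> a k + a (Suc q * k)" using that by (intro sub) auto
    finally show ?case using Suc by (simp add: algebra_simps)
  qed simp
  have "(\<lambda>n. a n / real n) \<longlonglongrightarrow> l"
  proof (rule LIMSEQ_I)
    fix e :: real assume e: "0 < e"
    have "l < l + e/2" using e by simp
    then have "\<exists>k\<in>{0<..}. a k / real k < l + e/2"
      using cINF_less_iff[of "{0<..}" "\<lambda>n. a n / real n" "l + e/2"] bdd unfolding l_def by auto
    then obtain k where k: "0 < k" "a k / real k < l + e/2" by auto
    define B where "B = Max (insert 0 (a ` {1..<2*k})) + \<bar>a k\<bar>"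
    have B: "a r \<le> B - \<bar>a k\<bar>" if "0 < r" "r < 2*k" for r
    proof -
      have "a r \<le> Max (insert 0 (a ` {1..<2*k}))" using that by (intro Max_ge) auto
      then show ?thesis unfolding B_def by simp
    qed
    have B0: "0 \<le> B" unfolding B_def by (intro add_nonneg_nonneg Max_ge) auto
    have step: "a n \<le> real n * (a k / real k) + (B + 2 * \<bar>a k\<bar>)" if n: "2 * k \<le> n" for n
    proof -
      \<comment> \<open>The plain remainder \<open>n mod k\<close> may be 0, where subadditivity
        says nothing. Giving one block back keeps the remainder in \<open>{k..<2*k}\<close>, and the
        multiple of \<open>k\<close> stays positive.\<close>
      define q where "q = n div k - 2"
      define r where "r = n mod k + k"
      have "2 \<le> n div k" using n k(1) by (simp add: less_eq_div_iff_mult_less_eq)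
      then have dq: "n div k = q + 2" unfolding q_def by simp
      have nn: "n = Suc q * k + r" 
        using div_mult_mod_eq[of n k] unfolding r_def dq by (simp add: algebra_simps)
      have r: "0 < r" "r < 2 * k" "k \<le> r" using k(1) unfolding r_def
        by (auto simp: mult_2 mod_less_divisor)
      have "a n \<le> a (Suc q * k) + a r" unfolding nn using k r by (intro sub) auto
      also have "\<dots> \<le> real (Suc q) * a k + (B - \<bar>a k\<bar>)" using mult[OF k(1)] B[OF r(1,2)] by (intro add_mono) auto
      also have "real (Suc q) * a k = real n * (a k / real k) - real r / real k * a k"
        unfolding nn using k(1) by (simp add: field_simps)
      finally have "a n \<le> real n * (a k / real k) - real r / real k * a k + (B - \<bar>a k\<bar>)" .
      moreover have "- (real r / real k * a k) \<le> 2 * \<bar>a k\<bar>"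
      proof -
        have "- (real r / real k * a k) \<le> (real r / real k) * \<bar>a k\<bar>"
          by (metis abs_ge_minus_self abs_mult abs_of_nonneg divide_nonneg_nonneg of_nat_0_le_iff)
        also have "\<dots> \<le> 2 * \<bar>a k\<bar>" using r k(1) by (intro mult_right_mono) (auto simp: field_simps)
        finally show ?thesis .
      qed
      ultimately show ?thesis by simp
    qed
    obtain n0 where n0: "(B + 2 * \<bar>a k\<bar>) / (e/2) < real n0" using reals_Archimedean2 by blast
    show "\<exists>no. \<forall>n\<ge>no. norm (a n / real n - l) < e"
    proof (intro exI allI impI)
      fix n assume n: "max n0 (2 * k) \<le> n"
      then have np: "0 < n" using k by simp
      have "(B + 2 * \<bar>a k\<bar>) / (e/2) < real n" using n0 n by simp
      then have "(B + 2 * \<bar>a k\<bar>) / real n < e/2" using e np by (simp add: field_simps)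
      moreover have "a n / real n \<le> a k / real k + (B + 2 * \<bar>a k\<bar>) / real n"
        using step[of n] n np by (simp add: field_simps)
      ultimately have "a n / real n - l < e" using k by linarith
      with le[OF np] show "norm (a n / real n - l) < e" by simp
    qed
  qed
  with le show ?thesis by blast
qed

text \<open>Both \<open>a + c\<close> and \<open>c - a\<close> are subadditive. Fekete's lemma
  bounds each of them from below by its own rate; the two rates are opposite, so the deviation from
  linear growth never exceeds \<open>c\<close>.\<close>

lemma almost_additive_limit:
  fixes a :: "nat \<Rightarrow> real"
  assumes aa: "\<And>n m. 0 < n \<Longrightarrow> 0 < m \<Longrightarrow> \<bar>a (n + m) - a n - a m\<bar> \<le> c"
  shows "\<exists>l. (\<lambda>n. a n / real n) \<longlonglongrightarrow> l \<and> (\<forall>n>0. \<bar>a n - real n * l\<bar> \<le> c)"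
proof -
  have c0: "0 \<le> c" using aa[of 1 1] by linarith
  have lin: "\<bar>a n - real n * a 1\<bar> \<le> real n * c" if "0 < n" for n
    using that
  proof (induction n rule: nat_induct_non_zero)
    case (Suc n)
    then show ?case using aa[of n 1] by (simp add: algebra_simps)
  qed (use c0 in simp)
  have c_lim: "(\<lambda>n. c / real n) \<longlonglongrightarrow> 0" by (rule lim_const_over_n)
  have "\<exists>l. (\<lambda>n. (a n + c) / real n) \<longlonglongrightarrow> l \<and> (\<forall>n>0. l \<le> (a n + c) / real n)"
  proof (rule fekete_limit[where b = "a 1 - c"])
    show "a (n + m) + c \<le> (a n + c) + (a m + c)" if "0 < n" "0 < m" for n m
      using aa[OF that] by linarith
    show "(a 1 - c) * real n \<le> a n + c" if "0 < n" for n
      using lin[OF that] c0 by (simp add: algebra_simps)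
  qed
  then obtain l where l: "(\<lambda>n. (a n + c) / real n) \<longlonglongrightarrow> l" "\<And>n. 0 < n \<Longrightarrow> l \<le> (a n + c) / real n" by blast
  have "\<exists>l. (\<lambda>n. (c - a n) / real n) \<longlonglongrightarrow> l \<and> (\<forall>n>0. l \<le> (c - a n) / real n)"
  proof (rule fekete_limit[where b = "- a 1 - c"])
    show "c - a (n + m) \<le> (c - a n) + (c - a m)" if "0 < n" "0 < m" for n m
      using aa[OF that] by linarith
    show "(- a 1 - c) * real n \<le> c - a n" if "0 < n" for n
      using lin[OF that] c0 by (simp add: algebra_simps)
  qed
  then obtain k where k: "(\<lambda>n. (c - a n) / real n) \<longlonglongrightarrow> k" "\<And>n. 0 < n \<Longrightarrow> k \<le> (c - a n) / real n" by blast
  have 1: "(\<lambda>n. a n / real n) \<longlonglongrightarrow> l"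
    using tendsto_diff[OF l(1) c_lim] by (simp add: add_divide_distrib)
  have "(\<lambda>n. a n / real n) \<longlonglongrightarrow> - k"
    using tendsto_diff[OF c_lim k(1)] by (simp add: diff_divide_distrib)
  with 1 have kl: "k = - l" using LIMSEQ_unique by force
  have "\<bar>a n - real n * l\<bar> \<le> c" if "0 < n" for n
    using l(2)[OF that] k(2)[OF that] that unfolding kl by (auto simp: field_simps abs_le_iff)
  with 1 show ?thesis by blast
qed

section \<open>Quasi-multiplicative weights\<close>

text \<open>All that the construction of the weights uses of the dynamics. Inadmissible words will
  have \<open>g w = 0\<close>, so \<open>g_connect\<close> can be asked of all pairs; the connecting
  word depends on the pair, its length does not.\<close>

locale quasi_multiplicative =
  fixes g :: "'s::countable list \<Rightarrow> real" and D \<kappa> :: real and N :: nat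
  assumes g_nonneg: "0 \<le> g w" and g_Nil: "g [] = 1"
    and g_append_le: "g (u @ v) \<le> D * g u * g v"
    and g_connect: "\<exists>c. length c = N \<and> \<kappa> * g u * g v \<le> g (u @ c @ v)"
    and \<kappa>_pos: "0 < \<kappa>" and N_pos: "0 < N"
    and g_letters: "(\<integral>\<^sup>+a. ennreal (g [a]) \<partial>count_space UNIV) < \<infinity>"
begin

lemma D_ge_1: "1 \<le> D"
  using g_append_le[of "[]" "[]"] by (simp add: g_Nil)

section \<open>Partition sums over words and their exponential growth rate\<close>

definition S :: "nat \<Rightarrow> ennreal" where "S n = word_sum n (\<lambda>w. ennreal (g w))"

definition Z :: "nat \<Rightarrow> real" where "Z n = enn2real (S n)"

lemma sum_append_le:
  "word_sum j (\<lambda>u. word_sum m (\<lambda>v. ennreal (g (u @ w @ v)))) \<le> ennreal (D^2 * g w) * S j * S m"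
proof -
  have "ennreal (g (u @ w @ v)) \<le> ennreal (g u) * (ennreal (D^2 * g w) * ennreal (g v))" for u v
  proof -
    have "g (u @ w @ v) \<le> D * g u * g (w @ v)" by (rule g_append_le)
    also have "\<dots> \<le> D * g u * (D * g w * g v)"
      using D_ge_1 by (intro mult_left_mono g_append_le mult_nonneg_nonneg g_nonneg) auto
    finally have "g (u @ w @ v) \<le> g u * ((D^2 * g w) * g v)" by (simp add: power2_eq_square mult_ac)
    then show ?thesis using D_ge_1 by (simp add: ennreal_mult[symmetric] g_nonneg ennreal_leI)
  qed
  then have "word_sum j (\<lambda>u. word_sum m (\<lambda>v. ennreal (g (u @ w @ v))))
      \<le> word_sum j (\<lambda>u. word_sum m (\<lambda>v. ennreal (g u) * (ennreal (D^2 * g w) * ennreal (g v))))"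
    by (intro word_sum_mono)
  also have "\<dots> = ennreal (D^2 * g w) * S j * S m"
    by (simp add: word_sum_cmult word_sum_multc S_def mult_ac)
  finally show ?thesis .
qed

lemma S_append_le: "S (n + m) \<le> ennreal (D^2) * S n * S m"
  using sum_append_le[of n m "[]"] by (simp add: S_def word_sum_append g_Nil)

text \<open>The one connecting word for \<open>v\<close> is a single term of the sum over all words
  of length \<open>N\<close>, which is then merged with \<open>v\<close> into a word of length
  \<open>N + m\<close>.\<close>

lemma sum_right_ge: "ennreal (\<kappa> * g w) * S m \<le> word_sum (N + m) (\<lambda>v. ennreal (g (w @ v)))"
proof -
  have "ennreal (\<kappa> * g w) * ennreal (g v) \<le> word_sum N (\<lambda>c. ennreal (g (w @ c @ v)))" for v
  proof -
    obtain c where c: "length c = N" "\<kappa> * g w * g v \<le> g (w @ c @ v)" using g_connect by blast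
    have "ennreal (\<kappa> * g w) * ennreal (g v) \<le> ennreal (g (w @ c @ v))"
      using c(2) \<kappa>_pos by (simp add: ennreal_mult[symmetric] g_nonneg ennreal_leI)
    also have "\<dots> \<le> word_sum N (\<lambda>c. ennreal (g (w @ c @ v)))" by (rule word_sum_ge[OF c(1)])
    finally show ?thesis .
  qed
  then have "word_sum m (\<lambda>v. ennreal (\<kappa> * g w) * ennreal (g v))
      \<le> word_sum m (\<lambda>v. word_sum N (\<lambda>c. ennreal (g (w @ c @ v))))" by (intro word_sum_mono)
  then show ?thesis
    by (subst (asm) word_sum_swap) (simp add: word_sum_append word_sum_cmult S_def)
qed

lemma sum_left_ge: "ennreal (\<kappa> * g w) * S j \<le> word_sum (j + N) (\<lambda>u. ennreal (g (u @ w)))"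
proof -
  have "ennreal (\<kappa> * g w) * ennreal (g u) \<le> word_sum N (\<lambda>c. ennreal (g (u @ c @ w)))" for u
  proof -
    obtain c where c: "length c = N" "\<kappa> * g u * g w \<le> g (u @ c @ w)" using g_connect by blast
    have "ennreal (\<kappa> * g w) * ennreal (g u) \<le> ennreal (g (u @ c @ w))"
      using c(2) \<kappa>_pos by (simp add: ennreal_mult[symmetric] g_nonneg ennreal_leI mult_ac)
    also have "\<dots> \<le> word_sum N (\<lambda>c. ennreal (g (u @ c @ w)))" by (rule word_sum_ge[OF c(1)])
    finally show ?thesis .
  qed
  then have "word_sum j (\<lambda>u. ennreal (\<kappa> * g w) * ennreal (g u))
      \<le> word_sum j (\<lambda>u. word_sum N (\<lambda>c. ennreal (g (u @ c @ w))))" by (intro word_sum_mono)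
  then show ?thesis
    by (simp add: word_sum_append word_sum_cmult S_def)
qed

lemma sum_append_ge:
  "ennreal (\<kappa>^2 * g w) * S j * S m
    \<le> word_sum (j + N) (\<lambda>u. word_sum (N + m) (\<lambda>v. ennreal (g (u @ w @ v))))"
proof -
  have "ennreal (\<kappa>^2 * g w) * S j * S m = (ennreal \<kappa> * S m) * (ennreal (\<kappa> * g w) * S j)"
    using \<kappa>_pos by (simp add: ennreal_mult g_nonneg power2_eq_square mult_ac)
  also have "\<dots> \<le> (ennreal \<kappa> * S m) * word_sum (j + N) (\<lambda>u. ennreal (g (u @ w)))"
    by (intro mult_left_mono sum_left_ge) auto
  also have "\<dots> = word_sum (j + N) (\<lambda>u. ennreal (\<kappa> * g (u @ w)) * S m)"
    using \<kappa>_pos by (subst word_sum_cmult [symmetric]) (auto simp: ennreal_mult g_nonneg mult_ac intro!: word_sum_cong)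
  also have "\<dots> \<le> word_sum (j + N) (\<lambda>u. word_sum (N + m) (\<lambda>v. ennreal (g ((u @ w) @ v))))"
    by (intro word_sum_mono sum_right_ge)
  finally show ?thesis by simp
qed

lemma S_connect: "ennreal \<kappa> * S n * S m \<le> S (n + N + m)"
proof -
  have "ennreal \<kappa> * S n * S m = word_sum n (\<lambda>u. ennreal (\<kappa> * g u) * S m)"
    using \<kappa>_pos by (simp add: ennreal_mult g_nonneg word_sum_multc word_sum_cmult S_def)
  also have "\<dots> \<le> word_sum n (\<lambda>u. word_sum (N + m) (\<lambda>v. ennreal (g (u @ v))))"
    by (intro word_sum_mono sum_right_ge)
  also have "\<dots> = S (n + N + m)" unfolding S_def by (simp only: add.assoc word_sum_append)
  finally show ?thesis .
qed

lemma S_0 [simp]: "S 0 = 1" by (simp add: S_def g_Nil)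

lemma S_finite: "S n < \<infinity>"
proof (induction n)
  case (Suc n)
  have "S (Suc 0) < \<infinity>" using g_letters by (simp add: S_def word_sum_1)
  then have "ennreal (D^2) * S (Suc 0) * S n < \<infinity>" using Suc by (auto simp: ennreal_mult_less_top)
  then show ?case using S_append_le[of "Suc 0" n] by (auto simp: less_le_trans le_less_trans)
qed simp

lemma S_Z: "S n = ennreal (Z n)"
  unfolding Z_def using S_finite[of n] by (simp add: less_top)

lemma Z_nonneg: "0 \<le> Z n" unfolding Z_def by simp

lemma Z_0 [simp]: "Z 0 = 1" by (simp add: Z_def)

lemma Z_append_le: "Z (n + m) \<le> D^2 * Z n * Z m"
  using S_append_le[of n m] by (simp add: S_Z Z_nonneg ennreal_mult[symmetric])

lemma Z_connect: "\<kappa> * Z n * Z m \<le> Z (n + N + m)"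
  using S_connect[of n m] \<kappa>_pos by (simp add: S_Z Z_nonneg ennreal_mult[symmetric])

text \<open>Connecting makes \<open>Z\<close> positive at all multiples of \<open>N\<close>, while a
  zero at \<open>n\<close> would pass to every larger length by submultiplicativity.\<close>

lemma Z_pos: "0 < Z n"
proof (rule ccontr)
  assume "\<not> 0 < Z n"
  then have 0: "Z n = 0" using Z_nonneg[of n] by simp
  have "0 < Z (j * N)" for j
  proof (induction j)
    case (Suc j)
    then have "0 < \<kappa> * Z (j * N) * Z 0" using \<kappa>_pos by simp
    also have "\<dots> \<le> Z (j * N + N + 0)" by (rule Z_connect)
    finally show ?case by (simp add: add.commute)
  qed simp
  from this[of n] have "0 < Z (n * N)" .
  also have "n * N = n + (n * N - n)" using N_pos by simp
  also have "Z (n + (n * N - n)) \<le> D^2 * Z n * Z (n * N - n)" by (rule Z_append_le)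
  finally show False using 0 by simp
qed

text \<open>One constant for both directions: \<open>D^2\<close> bounds \<open>Z (n + m)\<close>
  from above, and \<open>D^2 * Z N / \<kappa>\<close> pays for inserting a connecting block and
  removing it again.\<close>

definition E :: real where "E = max (D^2) (D^2 * Z N / \<kappa>)"

lemma E_pos: "1 \<le> E" "0 < E"
  using D_ge_1 by (auto simp: E_def le_max_iff_disj less_max_iff_disj)

lemma Z_le: "Z (n + m) \<le> E * Z n * Z m"
  using Z_append_le[of n m] Z_pos[of n] Z_pos[of m]
  by (smt (verit, best) E_def max.cobounded1 mult_right_mono)

text \<open>The connected sum has length \<open>n + N + m\<close>; splitting off the additional
  \<open>N\<close> letters costs only a constant.\<close>

lemma Z_ge: "Z n * Z m \<le> E * Z (n + m)"
proof -
  have "\<kappa> * (Z n * Z m) \<le> Z (n + N + m)" using Z_connect[of n m] by (simp add: mult_ac)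
  also have "\<dots> = Z ((n + m) + N)" by (simp add: add_ac)
  also have "\<dots> \<le> D^2 * Z (n + m) * Z N" by (rule Z_append_le)
  finally have "Z n * Z m \<le> D^2 * Z N / \<kappa> * Z (n + m)" using \<kappa>_pos by (simp add: field_simps)
  also have "\<dots> \<le> E * Z (n + m)" by (intro mult_right_mono) (auto simp: E_def Z_nonneg)
  finally show ?thesis .
qed

lemma pressure_exists: "\<exists>P. \<forall>n. \<bar>ln (Z n) - real n * P\<bar> \<le> ln E"
proof -
  have "\<bar>ln (Z (n + m)) - ln (Z n) - ln (Z m)\<bar> \<le> ln E" for n m
  proof -
    have "ln (Z (n + m)) \<le> ln (E * Z n * Z m)" using Z_le Z_pos E_pos by simp
    also have "\<dots> = ln E + ln (Z n) + ln (Z m)" using Z_pos[of n] Z_pos[of m] E_pos by (simp add: ln_mult)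
    finally have 1: "ln (Z (n + m)) \<le> ln E + ln (Z n) + ln (Z m)" .
    have "ln (Z n * Z m) \<le> ln (E * Z (n + m))" using Z_ge Z_pos E_pos by simp
    then have "ln (Z n) + ln (Z m) \<le> ln E + ln (Z (n + m))"
      using Z_pos[of n] Z_pos[of m] Z_pos[of "n + m"] E_pos by (simp add: ln_mult)
    with 1 show ?thesis by linarith
  qed
  from almost_additive_limit[of "\<lambda>n. ln (Z n)", OF this]
  obtain P where P: "\<And>n. 0 < n \<Longrightarrow> \<bar>ln (Z n) - real n * P\<bar> \<le> ln E" by blast
  have "\<bar>ln (Z n) - real n * P\<bar> \<le> ln E" for n
    using P[of n] E_pos by (cases "n = 0") auto
  then show ?thesis by blast
qed

text \<open>Any such \<open>P\<close> is the limit of \<open>ln (Z n) / n\<close>, hence unique; it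
  turns out to be the Gurevich pressure.\<close>

definition P :: real where "P = (SOME P. \<forall>n. \<bar>ln (Z n) - real n * P\<bar> \<le> ln E)"

lemma ln_Z_P: "\<bar>ln (Z n) - real n * P\<bar> \<le> ln E"
  using someI_ex[OF pressure_exists] unfolding P_def by blast

lemma Z_le_exp: "Z n \<le> E * exp (real n * P)" and Z_ge_exp: "exp (real n * P) \<le> E * Z n"
proof -
  have "Z n = exp (ln (Z n))" using Z_pos by simp
  also have "\<dots> \<le> exp (ln E + real n * P)" using ln_Z_P[of n] by (simp add: abs_le_iff)
  finally show "Z n \<le> E * exp (real n * P)" using E_pos by (simp add: exp_add)
  have "exp (real n * P) \<le> exp (ln E + ln (Z n))" using ln_Z_P[of n] by (simp add: abs_le_iff)
  then show "exp (real n * P) \<le> E * Z n" using E_pos Z_pos by (simp add: exp_add)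
qed

text \<open>
  A word is placed at position \<open>j + N\<close> of words of length \<open>2 N + 2 n\<close>. The margin of \<open>N\<close> letters on both
  sides leaves room for connecting words; averaging over \<open>j < n\<close> makes the limit shift invariant.
  The subtractions do not truncate when \<open>j \<le> n\<close> and \<open>length w \<le> n\<close>.
\<close>

definition window :: "nat \<Rightarrow> 's list \<Rightarrow> nat \<Rightarrow> ennreal" where
  "window n w j = word_sum (j + N) (\<lambda>u. word_sum (N + (2 * n - j) - length w) (\<lambda>v. ennreal (g (u @ w @ v))))"

definition avg :: "nat \<Rightarrow> 's list \<Rightarrow> ennreal" where
  "avg n w = (\<Sum>j<n. window n w j) / ennreal (real n * Z (2 * N + 2 * n))"

text \<open>Independent of \<open>n\<close>, hence usable as a dominating function:
  \<open>D^2\<close> is the price of cutting \<open>w\<close> out of a longer word,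
  \<open>E^2\<close> that of merging the sums for the left part, for the length of \<open>w\<close>
  and for the right part.\<close>

definition avg_bound :: "'s list \<Rightarrow> real" where
  "avg_bound w = D^2 * E^2 * g w / Z (length w)"

lemma avg_bound_nonneg: "0 \<le> avg_bound w"
  by (simp add: avg_bound_def g_nonneg Z_nonneg)

lemma window_le:
  assumes "j \<le> n" "length w \<le> n"
  shows "window n w j \<le> ennreal (avg_bound w * Z (2 * N + 2 * n))"
proof -
  define k where "k = length w"
  define m where "m = N + (2 * n - j) - k"
  have tot: "(j + N) + k + m = 2 * N + 2 * n" using assms unfolding m_def k_def by simp
  have "window n w j \<le> ennreal (D^2 * g w) * S (j + N) * S m"
    unfolding window_def m_def k_def by (rule sum_append_le)
  also have "\<dots> = ennreal (D^2 * g w * (Z (j + N) * Z m))"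
    using Z_nonneg g_nonneg by (simp add: S_Z ennreal_mult mult_ac)
  also have "\<dots> \<le> ennreal (avg_bound w * Z (2 * N + 2 * n))"
  proof (rule ennreal_leI)
    have "Z (j + N) * Z m * Z k = (Z (j + N) * Z k) * Z m" by simp
    also have "\<dots> \<le> (E * Z (j + N + k)) * Z m" by (intro mult_right_mono Z_ge Z_nonneg)
    also have "\<dots> = E * (Z (j + N + k) * Z m)" by simp
    also have "\<dots> \<le> E * (E * Z (j + N + k + m))" using E_pos by (intro mult_left_mono Z_ge) auto
    finally have "Z (j + N) * Z m * Z k \<le> E^2 * Z (2 * N + 2 * n)"
      unfolding tot by (simp add: power2_eq_square)
    then have "Z (j + N) * Z m \<le> E^2 * Z (2 * N + 2 * n) / Z k" using Z_pos[of k] by (simp add: field_simps)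
    then have "D^2 * g w * (Z (j + N) * Z m) \<le> D^2 * g w * (E^2 * Z (2 * N + 2 * n) / Z k)"
      by (intro mult_left_mono) (auto simp: g_nonneg)
    then show "D^2 * g w * (Z (j + N) * Z m) \<le> avg_bound w * Z (2 * N + 2 * n)"
      by (simp add: avg_bound_def k_def mult_ac)
  qed
  finally show ?thesis .
qed

lemma window_ge:
  assumes "j \<le> n" "length w \<le> n"
  shows "ennreal (\<kappa>^2 / (E^4 * Z N ^ 2) * (g w / Z (length w)) * Z (2 * N + 2 * n)) \<le> window n w j"
proof -
  define k where "k = length w"
  define m where "m = 2 * n - j - k"
  have tot: "N + j + k + m + N = 2 * N + 2 * n" using assms unfolding m_def k_def by simp
  \<comment> \<open>Four splittings of the total length give \<open>E^4\<close>. The two outer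
    blocks of length \<open>N\<close> are the slots filled by connecting words, which accounts for
    \<open>Z N ^ 2\<close>.\<close>
  have "Z (N + j + k + m + N) \<le> E * Z (N + j + k + m) * Z N" by (rule Z_le)
  also have "\<dots> \<le> E * (E * Z (N + j + k) * Z m) * Z N"
    using E_pos by (intro mult_right_mono mult_left_mono Z_le Z_nonneg) auto
  also have "\<dots> \<le> E * (E * (E * Z (N + j) * Z k) * Z m) * Z N"
    using E_pos by (intro mult_right_mono mult_left_mono Z_le Z_nonneg) auto
  also have "\<dots> \<le> E * (E * (E * (E * Z N * Z j) * Z k) * Z m) * Z N"
    using E_pos by (intro mult_right_mono mult_left_mono Z_le Z_nonneg) auto
  finally have "Z (2 * N + 2 * n) \<le> (E^4 * Z N ^ 2 * Z k) * (Z j * Z m)"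
    unfolding tot by (simp add: power2_eq_square power4_eq_xxxx mult_ac)
  then have "Z (2 * N + 2 * n) / (E^4 * Z N ^ 2 * Z k) \<le> Z j * Z m"
    using E_pos Z_pos[of N] Z_pos[of k] by (subst pos_divide_le_eq) (auto simp: mult_ac intro!: mult_pos_pos)
  then have "\<kappa>^2 * g w * (Z (2 * N + 2 * n) / (E^4 * Z N ^ 2 * Z k)) \<le> \<kappa>^2 * g w * (Z j * Z m)"
    by (intro mult_left_mono) (auto simp: g_nonneg)
  then have "ennreal (\<kappa>^2 / (E^4 * Z N ^ 2) * (g w / Z k) * Z (2 * N + 2 * n)) \<le> ennreal (\<kappa>^2 * g w * (Z j * Z m))"
    by (intro ennreal_leI) (simp add: mult_ac)
  also have "\<dots> = ennreal (\<kappa>^2 * g w) * S j * S m"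
    using Z_nonneg g_nonneg by (simp add: S_Z ennreal_mult mult_ac)
  also have "\<dots> \<le> word_sum (j + N) (\<lambda>u. word_sum (N + m) (\<lambda>v. ennreal (g (u @ w @ v))))"
    by (rule sum_append_ge)
  also have "N + m = N + (2 * n - j) - length w" using assms unfolding m_def k_def by simp
  finally show ?thesis unfolding window_def k_def .
qed

text \<open>The extra letter is taken from the filler on the right, so consistency in this direction
  is exact.\<close>

lemma window_right: "j < n \<Longrightarrow> length w < n \<Longrightarrow> word_sum (Suc 0) (\<lambda>c. window n (w @ c) j) = window n w j"
proof -
  assume *: "j < n" "length w < n"
  define m where "m = N + (2 * n - j) - length w - 1"
  have m: "N + (2 * n - j) - length w = Suc 0 + m" using * unfolding m_def by simp
  have "word_sum (Suc 0) (\<lambda>c. window n (w @ c) j) =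
      word_sum (Suc 0) (\<lambda>c. word_sum (j + N) (\<lambda>u. word_sum m (\<lambda>v. ennreal (g (u @ w @ c @ v)))))"
    unfolding window_def m_def by (intro word_sum_cong) simp
  also have "\<dots> = word_sum (j + N) (\<lambda>u. word_sum (Suc 0) (\<lambda>c. word_sum m (\<lambda>v. ennreal (g (u @ w @ c @ v)))))"
    by (rule word_sum_swap)
  also have "\<dots> = window n w j"
    unfolding window_def m word_sum_append ..
  finally show ?thesis .
qed

text \<open>Summing over a letter in front lengthens the left filler by one, so \<open>w\<close>
  moves from position \<open>j\<close> to \<open>Suc j\<close>: this is the shift acting on
  positions.\<close>

lemma window_left: "j < n \<Longrightarrow> length w < n \<Longrightarrow> word_sum (Suc 0) (\<lambda>c. window n (c @ w) j) = window n w (Suc j)"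
proof -
  assume *: "j < n" "length w < n"
  define m where "m = N + (2 * n - j) - length w - 1"
  have m: "N + (2 * n - Suc j) - length w = m" using * unfolding m_def by simp
  have "word_sum (Suc 0) (\<lambda>c. window n (c @ w) j) =
      word_sum (Suc 0) (\<lambda>c. word_sum (j + N) (\<lambda>u. word_sum m (\<lambda>v. ennreal (g (u @ c @ w @ v)))))"
    unfolding window_def m_def by (intro word_sum_cong) simp
  also have "\<dots> = word_sum (j + N) (\<lambda>u. word_sum (Suc 0) (\<lambda>c. word_sum m (\<lambda>v. ennreal (g ((u @ c) @ w @ v)))))"
    by (subst word_sum_swap) simp
  also have "\<dots> = word_sum (j + N + Suc 0) (\<lambda>u. word_sum m (\<lambda>v. ennreal (g (u @ w @ v))))"
    by (subst word_sum_append) (rule refl)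
  also have "\<dots> = window n w (Suc j)"
    unfolding window_def m by simp
  finally show ?thesis .
qed

lemma avg_le:
  assumes "0 < n" "length w \<le> n" shows "avg n w \<le> ennreal (avg_bound w)"
proof -
  have "(\<Sum>j<n. window n w j) \<le> (\<Sum>j<n. ennreal (avg_bound w * Z (2 * N + 2 * n)))"
    using assms by (intro sum_mono window_le) auto
  also have "\<dots> = ennreal (avg_bound w) * ennreal (real n * Z (2 * N + 2 * n))"
    by (simp add: ennreal_mult avg_bound_nonneg Z_nonneg ennreal_of_nat_eq_real_of_nat mult_ac)
  finally show ?thesis unfolding avg_def using assms(1) Z_pos[of "2 * N + 2 * n"]
    by (intro divide_le_posI_ennreal) (auto simp: mult_ac)
qed

lemma avg_ge:
  assumes "0 < n" "length w \<le> n"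
  shows "ennreal (\<kappa>^2 / (E^4 * Z N ^ 2) * (g w / Z (length w))) \<le> avg n w"
proof -
  define z where "z = Z (2 * N + 2 * n)"
  define c where "c = \<kappa>^2 / (E^4 * Z N ^ 2) * (g w / Z (length w))"
  have c0: "0 \<le> c" by (simp add: c_def g_nonneg Z_nonneg)
  have z0: "0 < z" by (simp add: z_def Z_pos)
  have "ennreal c * ennreal (real n * z) = (\<Sum>j<n. ennreal (c * z))"
    using c0 z0 by (simp add: ennreal_mult[symmetric] ennreal_of_nat_eq_real_of_nat mult_ac)
  also have "\<dots> \<le> (\<Sum>j<n. window n w j)"
    using assms unfolding c_def z_def by (intro sum_mono window_ge) auto
  finally have "ennreal c * ennreal (real n * z) / ennreal (real n * z) \<le> avg n w"
    unfolding avg_def z_def by (rule divide_right_mono_ennreal)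
  also have "ennreal c * ennreal (real n * z) / ennreal (real n * z) = ennreal c"
    using assms(1) z0 c0 by (subst ennreal_mult[symmetric]) (auto simp: divide_ennreal)
  finally show ?thesis unfolding c_def .
qed

lemma avg_right:
  assumes "length w < n" shows "(\<integral>\<^sup>+a. avg n (w @ [a]) \<partial>count_space UNIV) = avg n w"
proof -
  have "(\<integral>\<^sup>+a. avg n (w @ [a]) \<partial>count_space UNIV) = word_sum (Suc 0) (\<lambda>c. avg n (w @ c))"
    by (simp add: word_sum_1)
  also have "\<dots> = avg n w"
    unfolding avg_def word_sum_divide word_sum_sum
    using assms by (simp add: window_right)
  finally show ?thesis .
qed

text \<open>The sums of the windows at \<open>j\<close> and at \<open>Suc j\<close> over
  \<open>j < n\<close> differ in two end terms only. These are put on opposite sides because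
  subtraction in \<open>ennreal\<close> truncates.\<close>

lemma avg_left:
  assumes "length w < n"
  shows "(\<integral>\<^sup>+a. avg n (a # w) \<partial>count_space UNIV) + window n w 0 / ennreal (real n * Z (2 * N + 2 * n))
    = avg n w + window n w n / ennreal (real n * Z (2 * N + 2 * n))"
proof -
  have "(\<integral>\<^sup>+a. avg n (a # w) \<partial>count_space UNIV) = word_sum (Suc 0) (\<lambda>c. avg n (c @ w))"
    by (simp add: word_sum_1)
  also have "\<dots> = (\<Sum>j<n. window n w (Suc j)) / ennreal (real n * Z (2 * N + 2 * n))"
    unfolding avg_def word_sum_divide word_sum_sum
    using assms by (simp add: window_left)
  moreover have "(\<Sum>j<n. window n w (Suc j)) + window n w 0 = (\<Sum>j<n. window n w j) + window n w n"
    by (metis add.commute lessThan_Suc_atMost sum.lessThan_Suc sum.lessThan_Suc_shift)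
  ultimately show ?thesis
    unfolding avg_def by (simp add: add_divide_distrib_ennreal[symmetric])
qed

lemma avg_Nil: "0 < n \<Longrightarrow> avg n [] = 1"
proof -
  assume n: "0 < n"
  have "window n [] j = ennreal (Z (2 * N + 2 * n))" if "j < n" for j
  proof -
    have "j + N + (N + (2 * n - j)) = 2 * N + 2 * n" using that by simp
    then show ?thesis using word_sum_append[of "j + N" "N + (2 * n - j)" "\<lambda>w. ennreal (g w)"]
      by (simp add: window_def S_Z[symmetric] S_def)
  qed
  then have "(\<Sum>j<n. window n [] j) = ennreal (real n * Z (2 * N + 2 * n))"
    by (simp add: ennreal_mult Z_nonneg ennreal_of_nat_eq_real_of_nat)
  then show ?thesis unfolding avg_def using n Z_pos[of "2 * N + 2 * n"]
    by (simp add: ennreal_divide_self)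
qed

text \<open>Consistency to the right holds before the limit; invariance to the left holds up to two
  end terms of order \<open>1/n\<close>. Since \<open>avg_bound\<close> is summable over an added
  letter, sums over that letter pass to the limit and no mass escapes.\<close>

lemma invariant_weights_exist:
  "\<exists>p K. 0 < K \<and> p [] = 1 \<and> (\<forall>w. 0 \<le> p w)
     \<and> (\<forall>w. (\<integral>\<^sup>+a. ennreal (p (w @ [a])) \<partial>count_space UNIV) = ennreal (p w))
     \<and> (\<forall>w. (\<integral>\<^sup>+a. ennreal (p (a # w)) \<partial>count_space UNIV) = ennreal (p w))
     \<and> (\<forall>w. p w \<le> K * (g w * exp (- real (length w) * P)))
     \<and> (\<forall>w. g w * exp (- real (length w) * P) \<le> K * p w)"
proof -
  \<comment> \<open>Zero at the finitely many \<open>n\<close> for which \<open>w\<close> does not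
    fit, so that the bounds hold for all \<open>n\<close>.\<close>
  define b :: "nat \<Rightarrow> 's list \<Rightarrow> real" where "b n w = (if 0 < n \<and> length w \<le> n then enn2real (avg n w) else 0)" for n w
  have avg_fin: "avg n w < \<infinity>" if "0 < n" "length w \<le> n" for n w
    using avg_le[OF that] by (auto simp: le_less_trans)
  have b_avg: "ennreal (b n w) = avg n w" if "0 < n" "length w \<le> n" for n w
    using that avg_fin[OF that] by (simp add: b_def less_top)
  have b_nonneg: "0 \<le> b n w" for n w by (simp add: b_def)
  have b_le: "b n w \<le> avg_bound w" for n w
    using avg_le[of n w] avg_bound_nonneg[of w] by (auto simp: b_def intro: enn2real_leI)
  obtain r p where r: "strict_mono r" and p: "\<And>w. (\<lambda>n. b (r n) w) \<longlonglongrightarrow> p w"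
    using convergent_bounded_coords[of b avg_bound] b_nonneg b_le by blast
  have rn: "n \<le> r n" for n using r by (rule seq_suble)
  have p_nonneg: "0 \<le> p w" for w using p b_nonneg by (intro LIMSEQ_le_const[OF p]) auto
  have p_le: "p w \<le> avg_bound w" for w using p b_le by (intro LIMSEQ_le_const2[OF p]) auto
  have ep: "(\<lambda>n. ennreal (b (r n) w)) \<longlonglongrightarrow> ennreal (p w)" for w
    using p by (intro tendsto_ennrealI)
  have big: "\<forall>\<^sub>F n in sequentially. k < r n" for k
    using rn by (auto simp: eventually_sequentially intro!: exI[of _ "Suc k"] dest: Suc_le_lessD less_le_trans)
  have p_Nil: "p [] = 1"
  proof (rule LIMSEQ_unique[OF p])
    show "(\<lambda>n. b (r n) []) \<longlonglongrightarrow> 1"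
      by (rule tendsto_eventually, rule eventually_mono[OF big[of 0]]) (simp add: b_def avg_Nil)
  qed
  have dc: "(\<lambda>n. \<integral>\<^sup>+a. ennreal (b (r n) (h a)) \<partial>count_space UNIV) \<longlonglongrightarrow> (\<integral>\<^sup>+a. ennreal (p (h a)) \<partial>count_space UNIV)"
    if "(\<integral>\<^sup>+a. ennreal (avg_bound (h a)) \<partial>count_space UNIV) < \<infinity>" for h :: "'s \<Rightarrow> 's list"
    using that by (intro nn_integral_dominated_convergence[where w="\<lambda>a. ennreal (avg_bound (h a))"])
      (auto intro!: AE_I2 ennreal_leI b_le ep)
  have bound_fin: "(\<integral>\<^sup>+a. ennreal (avg_bound (h a)) \<partial>count_space UNIV) < \<infinity>"
    if h: "\<And>a. length (h a) = Suc (length w)" "\<And>a. g (h a) \<le> D * g w * g [a]" for h :: "'s \<Rightarrow> 's list" and w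
  proof -
    let ?C = "D^2 * E^2 / Z (Suc (length w)) * (D * g w)"
    have C0: "0 \<le> ?C" using D_ge_1 by (intro mult_nonneg_nonneg divide_nonneg_nonneg) (auto simp: g_nonneg Z_nonneg)
    have "avg_bound (h a) \<le> ?C * g [a]" for a
    proof -
      have "avg_bound (h a) = D^2 * E^2 / Z (Suc (length w)) * g (h a)" by (simp add: avg_bound_def h)
      also have "\<dots> \<le> D^2 * E^2 / Z (Suc (length w)) * (D * g w * g [a])"
        by (intro mult_left_mono h divide_nonneg_nonneg) (auto simp: Z_nonneg)
      finally show ?thesis by (simp add: mult_ac)
    qed
    then have "(\<integral>\<^sup>+a. ennreal (avg_bound (h a)) \<partial>count_space UNIV) \<le> (\<integral>\<^sup>+a. ennreal ?C * ennreal (g [a]) \<partial>count_space UNIV)"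
      using C0 by (intro nn_integral_mono) (auto simp: ennreal_mult[symmetric] g_nonneg intro!: ennreal_leI)
    also have "\<dots> = ennreal ?C * (\<integral>\<^sup>+a. ennreal (g [a]) \<partial>count_space UNIV)" by (rule nn_integral_cmult) auto
    also have "\<dots> < \<infinity>" using g_letters by (simp add: ennreal_mult_less_top)
    finally show ?thesis .
  qed
  have right: "(\<integral>\<^sup>+a. ennreal (p (w @ [a])) \<partial>count_space UNIV) = ennreal (p w)" for w
  proof (rule LIMSEQ_unique[OF dc])
    show "(\<integral>\<^sup>+a. ennreal (avg_bound (w @ [a])) \<partial>count_space UNIV) < \<infinity>"
      using g_append_le by (intro bound_fin) (auto simp: mult_ac)
    show "(\<lambda>n. \<integral>\<^sup>+a. ennreal (b (r n) (w @ [a])) \<partial>count_space UNIV) \<longlonglongrightarrow> ennreal (p w)"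
    proof (rule Lim_transform_eventually[OF ep], rule eventually_mono[OF big[of "length w"]])
      fix n assume n: "length w < r n"
      then have "(\<integral>\<^sup>+a. ennreal (b (r n) (w @ [a])) \<partial>count_space UNIV) = (\<integral>\<^sup>+a. avg (r n) (w @ [a]) \<partial>count_space UNIV)"
        by (intro nn_integral_cong b_avg) auto
      also have "\<dots> = avg (r n) w" using n by (rule avg_right)
      also have "\<dots> = ennreal (b (r n) w)" using n by (intro b_avg[symmetric]) auto
      finally show "ennreal (b (r n) w) = (\<integral>\<^sup>+a. ennreal (b (r n) (w @ [a])) \<partial>count_space UNIV)" ..
    qed
  qed
  have left: "(\<integral>\<^sup>+a. ennreal (p (a # w)) \<partial>count_space UNIV) = ennreal (p w)" for w
  proof -
    \<comment> \<open>The end term at position \<open>j\<close>: a single window against a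
      normalisation by \<open>r n\<close> windows, hence of order \<open>1 / r n\<close>.\<close>
    define d where "d j n = window (r n) w (j (r n)) / ennreal (real (r n) * Z (2 * N + 2 * r n))" for j and n
    have d0: "d j \<longlonglongrightarrow> 0" if j: "\<And>n. j n \<le> n" for j
    proof (rule tendsto_sandwich[where f = "\<lambda>_. 0" and h = "\<lambda>n. ennreal (avg_bound w / real n)"])
      show "\<forall>\<^sub>F n in sequentially. d j n \<le> ennreal (avg_bound w / real n)"
        using big[of "length w"] eventually_gt_at_top[of 0]
      proof eventually_elim
        fix n :: nat assume n: "length w < r n" "0 < n"
        have "d j n \<le> ennreal (avg_bound w * Z (2 * N + 2 * r n)) / ennreal (real (r n) * Z (2 * N + 2 * r n))"
          unfolding d_def using n j by (intro divide_right_mono_ennreal window_le) auto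
        also have "\<dots> = ennreal (avg_bound w / real (r n))"
          using n Z_pos[of "2 * N + 2 * r n"] by (subst divide_ennreal) (auto simp: avg_bound_nonneg Z_nonneg)
        also have "\<dots> \<le> ennreal (avg_bound w / real n)"
          using n rn[of n] by (intro ennreal_leI divide_left_mono) (auto simp: avg_bound_nonneg)
        finally show "d j n \<le> ennreal (avg_bound w / real n)" .
      qed
      show "(\<lambda>n. ennreal (avg_bound w / real n)) \<longlonglongrightarrow> 0"
        using tendsto_ennrealI[OF lim_const_over_n[of "avg_bound w"]] by simp
    qed auto
    have fin: "(\<integral>\<^sup>+a. ennreal (avg_bound (a # w)) \<partial>count_space UNIV) < \<infinity>"
    proof (rule bound_fin)
      show "g (a # w) \<le> D * g w * g [a]" for a using g_append_le[of "[a]" w] by (simp add: mult_ac)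
    qed simp
    have "(\<lambda>n. (\<integral>\<^sup>+a. ennreal (b (r n) (a # w)) \<partial>count_space UNIV) + d (\<lambda>_. 0) n) \<longlonglongrightarrow> (\<integral>\<^sup>+a. ennreal (p (a # w)) \<partial>count_space UNIV) + 0"
      by (intro tendsto_add dc fin d0) auto
    moreover have "(\<lambda>n. (\<integral>\<^sup>+a. ennreal (b (r n) (a # w)) \<partial>count_space UNIV) + d (\<lambda>_. 0) n) \<longlonglongrightarrow> ennreal (p w) + 0"
    proof (rule Lim_transform_eventually, rule tendsto_add)
      show "(\<lambda>n. ennreal (b (r n) w)) \<longlonglongrightarrow> ennreal (p w)" by (rule ep)
      show "d (\<lambda>n. n) \<longlonglongrightarrow> 0" by (rule d0) simp
      show "\<forall>\<^sub>F n in sequentially. ennreal (b (r n) w) + d (\<lambda>n. n) n = (\<integral>\<^sup>+a. ennreal (b (r n) (a # w)) \<partial>count_space UNIV) + d (\<lambda>_. 0) n"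
      proof (rule eventually_mono[OF big[of "length w"]])
        fix n assume n: "length w < r n"
        then have "(\<integral>\<^sup>+a. ennreal (b (r n) (a # w)) \<partial>count_space UNIV) = (\<integral>\<^sup>+a. avg (r n) (a # w) \<partial>count_space UNIV)"
          by (intro nn_integral_cong b_avg) auto
        moreover have "ennreal (b (r n) w) = avg (r n) w" using n by (intro b_avg) auto
        ultimately show "ennreal (b (r n) w) + d (\<lambda>n. n) n = (\<integral>\<^sup>+a. ennreal (b (r n) (a # w)) \<partial>count_space UNIV) + d (\<lambda>_. 0) n"
          using avg_left[OF n] by (simp add: d_def)
      qed
    qed
    ultimately have "(\<integral>\<^sup>+a. ennreal (p (a # w)) \<partial>count_space UNIV) + 0 = ennreal (p w) + 0"
      by (rule LIMSEQ_unique)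
    then show ?thesis by simp
  qed
  have p_ge: "\<kappa>^2 / (E^4 * Z N ^ 2) * (g w / Z (length w)) \<le> p w" for w
  proof (rule LIMSEQ_le_const[OF p])
    obtain m where m: "\<And>n. m \<le> n \<Longrightarrow> length w < r n" using big[of "length w"] unfolding eventually_sequentially by blast
    have "\<kappa>^2 / (E^4 * Z N ^ 2) * (g w / Z (length w)) \<le> b (r n) w" if "m \<le> n" for n
    proof -
      have "ennreal (\<kappa>^2 / (E^4 * Z N ^ 2) * (g w / Z (length w))) \<le> ennreal (b (r n) w)"
        using m[OF that] avg_ge[of "r n" w] b_avg[of "r n" w] by simp
      then show ?thesis using b_nonneg by simp
    qed
    then show "\<exists>m. \<forall>n\<ge>m. \<kappa>^2 / (E^4 * Z N ^ 2) * (g w / Z (length w)) \<le> b (r n) w" by blast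
  qed
  \<comment> \<open>\<open>avg_bound\<close> contributes \<open>D^2 * E^2\<close>, and the remaining
    \<open>E\<close> exchanges \<open>Z\<close> for the exponential. \<open>K2\<close> inverts the
    lower bound \<open>avg_ge\<close> in the same way.\<close>
  define K1 where "K1 = D^2 * E^2 * E"
  define K2 where "K2 = E * (E^4 * Z N ^ 2) / \<kappa>^2"
  have K1: "p w \<le> K1 * (g w * exp (- real (length w) * P))" for w
  proof -
    have "exp (real (length w) * P) \<le> E * Z (length w)" by (rule Z_ge_exp)
    then have "1 / Z (length w) \<le> E * exp (- real (length w) * P)"
      using Z_pos[of "length w"] by (simp add: exp_minus field_simps)
    then have "D^2 * E^2 * g w * (1 / Z (length w)) \<le> D^2 * E^2 * g w * (E * exp (- real (length w) * P))"
      by (intro mult_left_mono) (auto simp: g_nonneg)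
    then show ?thesis using p_le[of w] by (simp add: avg_bound_def K1_def mult_ac)
  qed
  have K2: "g w * exp (- real (length w) * P) \<le> K2 * p w" for w
  proof -
    have "Z (length w) \<le> E * exp (real (length w) * P)" by (rule Z_le_exp)
    then have "exp (- real (length w) * P) \<le> E / Z (length w)"
      using Z_pos[of "length w"] by (simp add: exp_minus field_simps)
    then have "g w * exp (- real (length w) * P) \<le> g w * (E / Z (length w))"
      by (intro mult_left_mono) (auto simp: g_nonneg)
    also have "\<dots> = K2 * (\<kappa>^2 / (E^4 * Z N ^ 2) * (g w / Z (length w)))"
      using \<kappa>_pos E_pos Z_pos[of N] by (simp add: K2_def field_simps)
    also have "\<dots> \<le> K2 * p w"
      using p_ge[of w] E_pos by (intro mult_left_mono) (auto simp: K2_def)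
    finally show ?thesis .
  qed
  have K1p: "0 < K1" using D_ge_1 E_pos by (simp add: K1_def)
  show ?thesis
  proof (intro exI conjI allI)
    show "0 < max K1 K2" using K1p by simp
    show "p w \<le> max K1 K2 * (g w * exp (- real (length w) * P))" for w
      by (rule order_trans[OF K1]) (intro mult_right_mono, auto simp: g_nonneg)
    show "g w * exp (- real (length w) * P) \<le> max K1 K2 * p w" for w
      by (rule order_trans[OF K2]) (intro mult_right_mono, auto simp: p_nonneg)
  qed (use p_Nil p_nonneg left right in auto)
qed

end

section \<open>Cylinders and the Borel structure\<close>

definition init_word :: "nat \<Rightarrow> (nat \<Rightarrow> 's) \<Rightarrow> 's list" where
  "init_word n x = map x [0..<n]"

lemma length_init_word [simp]: "length (init_word n x) = n"
  by (simp add: init_word_def)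

lemma nth_init_word [simp]: "i < n \<Longrightarrow> init_word n x ! i = x i"
  by (simp add: init_word_def)

lemma init_word_0 [simp]: "init_word 0 x = []"
  by (simp add: init_word_def)

lemma shift_map_funpow: "(shift_map ^^ n) x = (\<lambda>i. x (i + n))"
  by (induction n arbitrary: x) (auto simp: shift_map_def funpow_swap1)

lemma init_word_add: "init_word (n + m) x = init_word n x @ init_word m ((shift_map ^^ n) x)"
  by (rule nth_equalityI) (auto simp: nth_append shift_map_funpow)

lemma init_word_Suc: "init_word (Suc n) x = x 0 # init_word n (shift_map x)"
  using init_word_add[of "Suc 0" n x] by (simp add: init_word_def)

lemma take_init_word: "m \<le> n \<Longrightarrow> take m (init_word n x) = init_word m x"
  by (simp add: init_word_def take_map)

lemma init_word_eq_iff: "init_word n x = init_word n y \<longleftrightarrow> (\<forall>i<n. x i = y i)"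
  by (auto simp: init_word_def)

lemma cylinder_init_word: "cylinder t w = {x \<in> markov_shift t. init_word (length w) x = w}"
  by (auto simp: cylinder_def list_eq_iff_nth_eq)

lemma cylinder_Nil [simp]: "cylinder t [] = markov_shift t"
  by (simp add: cylinder_def)

lemma shift_map_markov: "x \<in> markov_shift t \<Longrightarrow> shift_map x \<in> markov_shift t"
  by (simp add: markov_shift_def shift_map_def)

lemma shift_map_funpow_markov: "x \<in> markov_shift t \<Longrightarrow> (shift_map ^^ n) x \<in> markov_shift t"
  by (simp add: markov_shift_def shift_map_funpow)

lemma cylinder_inadmissible: "w \<noteq> [] \<Longrightarrow> \<not> admissible t w \<Longrightarrow> cylinder t w = {}"
proof (rule ccontr)
  assume w: "w \<noteq> []" "\<not> admissible t w" "cylinder t w \<noteq> {}"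
  then obtain x i where x: "x \<in> cylinder t w" and i: "Suc i < length w" "t (w ! i) (w ! Suc i) \<noteq> 1"
    by (auto simp: admissible_def)
  then have "w ! i = x i" "w ! Suc i = x (Suc i)" by (auto simp: cylinder_def)
  with x i(2) show False by (simp add: cylinder_def markov_shift_def)
qed

lemma admissible_init_word: "x \<in> markov_shift t \<Longrightarrow> 0 < n \<Longrightarrow> admissible t (init_word n x)"
  by (auto simp: admissible_def markov_shift_def init_word_def)

text \<open>The shorter word is either a prefix of the longer one or disagrees with it somewhere, so
  cylinders are nested or disjoint.\<close>

lemma cylinder_Int:
  "cylinder t v \<inter> cylinder t w = {} \<or> cylinder t v \<inter> cylinder t w = cylinder t v \<or> cylinder t v \<inter> cylinder t w = cylinder t w"
proof -
  have *: "cylinder t v \<inter> cylinder t w = {} \<or> cylinder t v \<inter> cylinder t w = cylinder t w"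
    if "length v \<le> length w" for v w
  proof (rule disjCI)
    assume "cylinder t v \<inter> cylinder t w \<noteq> cylinder t w"
    then obtain y where y: "y \<in> cylinder t w" "y \<notin> cylinder t v" by blast
    then obtain j where "j < length v" "y j \<noteq> v ! j" by (auto simp: cylinder_def)
    then have "v ! j \<noteq> w ! j" "j < length v" using y(1) that by (auto simp: cylinder_def)
    then show "cylinder t v \<inter> cylinder t w = {}" using that by (force simp: cylinder_def)
  qed
  show ?thesis using *[of v w] *[of w v] by (metis inf_commute nle_le)
qed

lemma topspace_markov_topology: "topspace (markov_topology t) = markov_shift t"
proof -
  have "x \<in> \<Union>{cylinder t w |w. admissible t w}" if "x \<in> markov_shift t" for x
  proof -
    have "admissible t (init_word 1 x)" "x \<in> cylinder t (init_word 1 x)"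
      using that admissible_init_word[OF that, of 1] by (auto simp: cylinder_init_word)
    then show ?thesis by blast
  qed
  moreover have "\<Union>{cylinder t w |w. admissible t w} \<subseteq> markov_shift t" by (auto simp: cylinder_def)
  ultimately show ?thesis
    unfolding markov_topology_def topology_generated_by_topspace by blast
qed

lemma openin_markov_subset: "openin (markov_topology t) U \<Longrightarrow> U \<subseteq> markov_shift t"
  using openin_subset[of "markov_topology t" U] by (simp add: topspace_markov_topology)

text \<open>Nestedness turns the generating cylinders into a base: the intersection of two cylinders
  with a common point is one of the two.\<close>

lemma openin_markov_cylinder:
  assumes "openin (markov_topology t) U" "x \<in> U"
  shows "\<exists>w. x \<in> cylinder t w \<and> cylinder t w \<subseteq> U"
proof -
  have "generate_topology_on {cylinder t w | w. admissible t w} U"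
    using assms(1) unfolding markov_topology_def by (simp add: openin_topology_generated_by_iff)
  then show ?thesis using assms(2)
  proof (induction U arbitrary: x)
    case (Int a b)
    have "x \<in> a" "x \<in> b" using Int.prems by auto
    then obtain v w where vw: "x \<in> cylinder t v \<inter> cylinder t w" "cylinder t v \<inter> cylinder t w \<subseteq> a \<inter> b"
      using Int.IH(1)[of x] Int.IH(2)[of x] by blast
    then have "cylinder t v \<inter> cylinder t w \<in> {cylinder t v, cylinder t w}"
      using cylinder_Int[of t v w] by auto
    then show ?case using vw by auto
  next
    case (UN K)
    then show ?case by (meson Union_iff Union_upper order_trans)
  qed auto
qed

lemma space_markov_borel [simp]: "space (markov_borel t) = markov_shift t"
  unfolding markov_borel_def by (rule space_measure_of) (use openin_markov_subset in blast)

text \<open>There are only countably many words, so an open set is a countable union of the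
  cylinders inside it.\<close>

lemma sets_markov_borel: "sets (markov_borel t) = sigma_sets (markov_shift t) (range (cylinder t))"
proof -
  have 1: "sets (markov_borel t) = sigma_sets (markov_shift t) {U. openin (markov_topology t) U}"
    unfolding markov_borel_def by (rule sets_measure_of) (use openin_markov_subset in blast)
  have "U \<in> sigma_sets (markov_shift t) (range (cylinder t))" if "openin (markov_topology t) U" for U
  proof -
    have "U = \<Union>(cylinder t ` {w. cylinder t w \<subseteq> U})" using openin_markov_cylinder[OF that] by blast
    moreover have "\<Union>(cylinder t ` {w. cylinder t w \<subseteq> U}) \<in> sigma_sets (markov_shift t) (range (cylinder t))"
      by (rule sigma_sets_UNION) (auto intro: sigma_sets.Basic)
    ultimately show ?thesis by simp
  qed
  moreover have "cylinder t w \<in> sigma_sets (markov_shift t) {U. openin (markov_topology t) U}" for w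
  proof (cases "w = [] \<or> \<not> admissible t w")
    case True
    then show ?thesis using cylinder_inadmissible[of w t] by (cases "w = []") (auto intro: sigma_sets_top sigma_sets.Empty)
  next
    case False
    then have "openin (markov_topology t) (cylinder t w)"
      unfolding markov_topology_def by (intro topology_generated_by_Basis) auto
    then show ?thesis by (auto intro: sigma_sets.Basic)
  qed
  ultimately have "sigma_sets (markov_shift t) {U. openin (markov_topology t) U} = sigma_sets (markov_shift t) (range (cylinder t))"
    by (intro sigma_sets_eqI) auto
  with 1 show ?thesis by simp
qed

lemma cylinder_sets [measurable]: "cylinder t w \<in> sets (markov_borel t)"
  unfolding sets_markov_borel by (auto intro: sigma_sets.Basic)

lemma measurable_into_markov_borel:
  assumes "f \<in> space M \<rightarrow> markov_shift t" "\<And>w. f -` cylinder t w \<inter> space M \<in> sets M"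
  shows "f \<in> measurable M (markov_borel t)"
proof -
  have "f \<in> measurable M (sigma (markov_shift t) (range (cylinder t)))"
    using assms by (intro measurable_measure_of) (auto simp: cylinder_def)
  moreover have "sets (sigma (markov_shift t) (range (cylinder t))) = sets (markov_borel t)"
    unfolding sets_markov_borel by (rule sets_measure_of) (auto simp: cylinder_def)
  ultimately show ?thesis using measurable_cong_sets[OF refl] by blast
qed

lemma measurable_init_word [measurable]: "init_word n \<in> measurable (markov_borel t) (count_space UNIV)"
proof (subst measurable_count_space_eq2_countable)
  show "init_word n \<in> space (markov_borel t) \<rightarrow> UNIV \<and>
    (\<forall>w\<in>UNIV. init_word n -` {w} \<inter> space (markov_borel t) \<in> sets (markov_borel t))"
  proof (intro conjI ballI)
    fix w :: "'a list"
    have "init_word n -` {w} \<inter> space (markov_borel t) = (if length w = n then cylinder t w else {})"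
      by (auto simp: cylinder_init_word)
    then show "init_word n -` {w} \<inter> space (markov_borel t) \<in> sets (markov_borel t)" by simp
  qed auto
qed

lemma measurable_shift_map [measurable]: "shift_map \<in> measurable (markov_borel t) (markov_borel t)"
proof (rule measurable_into_markov_borel)
  show "shift_map \<in> space (markov_borel t) \<rightarrow> markov_shift t" using shift_map_markov by auto
  fix w
  have "shift_map -` cylinder t w \<inter> space (markov_borel t) = (\<Union>a. cylinder t (a # w))"
    by (auto simp: cylinder_init_word init_word_Suc shift_map_markov)
  then show "shift_map -` cylinder t w \<inter> space (markov_borel t) \<in> sets (markov_borel t)" by auto
qed

lemma measurable_shift_map_funpow [measurable]: "(shift_map ^^ n) \<in> measurable (markov_borel t) (markov_borel t)"
  by (induction n) (auto intro: measurable_comp)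

lemma continuous_imp_markov_borel_measurable:
  assumes "continuous_map (markov_topology t) euclideanreal h"
  shows "h \<in> borel_measurable (markov_borel t)"
proof (rule borel_measurableI)
  fix U :: "real set" assume "open U"
  then have "openin (markov_topology t) {x \<in> topspace (markov_topology t). h x \<in> U}"
    using assms by (intro openin_continuous_map_preimage) auto
  moreover have "{x \<in> topspace (markov_topology t). h x \<in> U} = h -` U \<inter> space (markov_borel t)"
    by (auto simp: topspace_markov_topology)
  moreover have "V \<in> sets (markov_borel t)" if "openin (markov_topology t) V" for V
    unfolding markov_borel_def using that
    by (subst sets_measure_of) (use openin_markov_subset in \<open>auto intro: sigma_sets.Basic\<close>)
  ultimately show "h -` U \<inter> space (markov_borel t) \<in> sets (markov_borel t)" by auto
qed

section \<open>Measures determined by, and constructed from, the masses of cylinders\<close>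

lemma measure_eqI_cylinder:
  assumes M: "finite_measure M" "sets M = sets (markov_borel t)" and N: "sets N = sets (markov_borel t)"
    and eq: "\<And>w. emeasure M (cylinder t w) = emeasure N (cylinder t w)"
  shows "M = N"
proof (rule measure_eqI_generator_eq[where E = "insert {} (range (cylinder t))" and \<Omega> = "markov_shift t" and A = "\<lambda>_. markov_shift t"])
  show "Int_stable (insert {} (range (cylinder t)))"
  proof (rule Int_stableI)
    fix a b assume ab: "a \<in> insert {} (range (cylinder t))" "b \<in> insert {} (range (cylinder t))"
    show "a \<inter> b \<in> insert {} (range (cylinder t))"
    proof (cases "a = {} \<or> b = {}")
      case False
      with ab obtain v w where "a = cylinder t v" "b = cylinder t w" by auto
      then show ?thesis using cylinder_Int[of t v w] by (elim disjE) auto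
    qed auto
  qed
  have "sigma_sets (markov_shift t) (insert {} (range (cylinder t))) = sigma_sets (markov_shift t) (range (cylinder t))"
    by (intro sigma_sets_eqI) (auto intro: sigma_sets.Empty sigma_sets.Basic)
  then show "sets M = sigma_sets (markov_shift t) (insert {} (range (cylinder t)))"
    "sets N = sigma_sets (markov_shift t) (insert {} (range (cylinder t)))"
    using M N by (simp_all add: sets_markov_borel)
  show "emeasure M X = emeasure N X" if "X \<in> insert {} (range (cylinder t))" for X
    using that eq by auto
  show "range (\<lambda>_. markov_shift t) \<subseteq> insert {} (range (cylinder t))"
    by (auto intro: range_eqI[of _ _ "[]"])
  show "insert {} (range (cylinder t)) \<subseteq> Pow (markov_shift t)" by (auto simp: cylinder_def)
  show "emeasure M (markov_shift t) \<noteq> \<infinity>" using M(1) by (simp add: finite_measure.emeasure_finite)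
qed auto

text \<open>The letter after \<open>w\<close> is drawn with conditional probability
  \<open>p (w @ [a]) / p w\<close>; the Ionescu-Tulcea theorem glues these kernels into one measure
  on sequences.\<close>

lemma word_measure_exists:
  fixes p :: "'s::countable list \<Rightarrow> real"
  assumes p_nonneg: "\<And>w. 0 \<le> p w" and p_Nil: "p [] = 1"
    and p_right: "\<And>w. (\<integral>\<^sup>+a. ennreal (p (w @ [a])) \<partial>count_space UNIV) = ennreal (p w)"
  shows "\<exists>M. prob_space M \<and> sets M = sets (PiM UNIV (\<lambda>_. count_space UNIV))
    \<and> (\<forall>w. emeasure M {x. init_word (length w) x = w} = ennreal (p w))"
proof -
  \<comment> \<open>After a word of mass 0 every extension has mass 0 as well, so the choice there
    is free; a point mass keeps \<open>k w\<close> a probability measure.\<close>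
  define k where "k w = (if p w = 0 then return (count_space UNIV) undefined
     else density (count_space UNIV) (\<lambda>a::'s. ennreal (p (w @ [a]) / p w)))" for w
  have prob_k: "prob_space (k w)" for w
  proof (cases "p w = 0")
    case False
    then have "p w > 0" using p_nonneg[of w] by simp
    then have "(\<integral>\<^sup>+a. ennreal (p (w @ [a]) / p w) \<partial>count_space UNIV) = (\<integral>\<^sup>+a. ennreal (p (w @ [a])) / ennreal (p w) \<partial>count_space UNIV)"
      by (intro nn_integral_cong) (simp add: divide_ennreal p_nonneg)
    also have "\<dots> = 1" using \<open>p w > 0\<close> by (simp add: nn_integral_divide p_right ennreal_divide_self)
    finally show ?thesis using False
      by (intro prob_spaceI) (simp add: k_def emeasure_density)
  qed (auto simp: k_def intro: prob_space_return)
  have sets_k[simp]: "sets (k w) = UNIV" "space (k w) = UNIV" for w by (auto simp: k_def)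
  let ?M = "\<lambda>_::nat. count_space (UNIV :: 's set)"
  have meas_map: "(\<lambda>\<omega>. map \<omega> [0..<n]) \<in> measurable (PiM {0..<n} ?M) (count_space UNIV)" for n
  proof (subst measurable_count_space_eq2_countable)
    show "(\<lambda>\<omega>. map \<omega> [0..<n]) \<in> space (PiM {0..<n} ?M) \<rightarrow> UNIV \<and>
      (\<forall>w\<in>UNIV. (\<lambda>\<omega>. map \<omega> [0..<n]) -` {w} \<inter> space (PiM {0..<n} ?M) \<in> sets (PiM {0..<n} ?M))"
    proof (intro conjI ballI)
      fix w :: "'s list"
      have "(\<lambda>\<omega>. map \<omega> [0..<n]) -` {w} \<inter> space (PiM {0..<n} ?M)
         = (if length w = n then {\<omega> \<in> space (PiM {0..<n} ?M). \<forall>i\<in>{0..<n}. \<omega> i = w ! i} else {})"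
      proof -
        have "map \<omega> [0..<n] = w \<longleftrightarrow> length w = n \<and> (\<forall>i\<in>{0..<n}. \<omega> i = w ! i)" for \<omega> :: "nat \<Rightarrow> 's"
          by (auto intro!: nth_equalityI)
        then show ?thesis by auto
      qed
      also have "\<dots> \<in> sets (PiM {0..<n} ?M)" by simp
      finally show "(\<lambda>\<omega>. map \<omega> [0..<n]) -` {w} \<inter> space (PiM {0..<n} ?M) \<in> sets (PiM {0..<n} ?M)" .
    qed auto
  qed
  have k_meas: "k \<in> measurable (count_space UNIV) (subprob_algebra (count_space UNIV))"
    using prob_k by (auto simp: space_subprob_algebra prob_space_imp_subprob_space)
  interpret IT: Ionescu_Tulcea "\<lambda>n \<omega>. k (map \<omega> [0..<n])" ?M
  proof (rule Ionescu_Tulcea.intro)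
    show "(\<lambda>\<omega>. k (map \<omega> [0..<n])) \<in> measurable (PiM {0..<n} ?M) (subprob_algebra (count_space UNIV))" for n
      using measurable_compose[OF meas_map k_meas] .
  qed (rule prob_k)
  define cyl where "cyl w = {\<omega> \<in> space (PiM {0..<length w} ?M). map \<omega> [0..<length w] = w}" for w
  have cyl_sets [measurable]: "cyl w \<in> sets (PiM {0..<length w} ?M)" for w
    unfolding cyl_def using measurable_sets[OF meas_map, of "{w}" "length w"] by (simp add: vimage_def Int_def conj_commute)
  have und: "(\<lambda>_. undefined) \<in> space (PiM {0..<0} ?M)" by (simp add: space_PiM)
  have C: "emeasure (IT.C 0 (length w) (\<lambda>_. undefined)) (cyl w) = ennreal (p w)" for w
  proof (induction w rule: rev_induct)
    case Nil
    have "emeasure (return (PiM {0..<0} ?M) (\<lambda>_. undefined)) (cyl []) = indicator (cyl []) (\<lambda>_. undefined)"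
      using cyl_sets[of "[]"] by (intro emeasure_return) simp
    moreover have "(\<lambda>_. undefined) \<in> cyl []" using und by (simp add: cyl_def)
    ultimately show ?case by (simp add: p_Nil)
  next
    case (snoc a w)
    let ?n = "length w"
    have sC: "space (IT.C 0 ?n (\<lambda>_. undefined)) = space (PiM {0..<?n} ?M)"
      using IT.space_C[OF und, of ?n] by simp
    have setsC: "sets (IT.C 0 ?n (\<lambda>_. undefined)) = sets (PiM {0..<?n} ?M)"
      using IT.sets_C[OF und, of ?n] by simp
    have m: "IT.eP ?n \<in> measurable (IT.C 0 ?n (\<lambda>_. undefined)) (subprob_algebra (PiM {0..<Suc ?n} ?M))"
      using IT.measurable_eP[of ?n] measurable_cong_sets[OF setsC refl] by blast
    have cyl': "cyl (w @ [a]) \<in> sets (PiM {0..<Suc ?n} ?M)" using cyl_sets[of "w @ [a]"] by simp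
    \<comment> \<open>The kernel keeps the letters drawn so far and appends one, so the longer word
      is hit only if \<open>w\<close> was and the new letter is \<open>a\<close>.\<close>
    have eP: "emeasure (IT.eP ?n \<omega>) (cyl (w @ [a])) = emeasure (k w) {a} * indicator (cyl w) \<omega>"
      if \<omega>: "\<omega> \<in> space (PiM {0..<?n} ?M)" for \<omega>
    proof -
      have upd: "fun_upd \<omega> ?n x \<in> space (PiM {0..<Suc ?n} ?M)" for x
        using \<omega> by (auto simp: space_PiM PiE_def extensional_def)
      have mp: "map (fun_upd \<omega> ?n x) [0..<Suc ?n] = map \<omega> [0..<?n] @ [x]" for x
        by simp
      have "(\<lambda>x. fun_upd \<omega> ?n x) -` cyl (w @ [a]) \<inter> UNIV = (if \<omega> \<in> cyl w then {a} else {})"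
        using \<omega> upd mp by (auto simp: cyl_def)
      then show ?thesis
        using IT.emeasure_eP[OF \<omega> cyl'] \<omega> by (auto simp: cyl_def split: if_splits)
    qed
    have "emeasure (IT.C 0 (Suc ?n) (\<lambda>_. undefined)) (cyl (w @ [a]))
        = (\<integral>\<^sup>+\<omega>. emeasure (IT.eP ?n \<omega>) (cyl (w @ [a])) \<partial>IT.C 0 ?n (\<lambda>_. undefined))"
      unfolding IT.C.simps add_0 using sC
      by (intro emeasure_bind[OF _ m cyl']) (simp add: space_PiM PiE_eq_empty_iff)
    also have "\<dots> = (\<integral>\<^sup>+\<omega>. emeasure (k w) {a} * indicator (cyl w) \<omega> \<partial>IT.C 0 ?n (\<lambda>_. undefined))"
      using sC by (intro nn_integral_cong eP) simp
    also have "\<dots> = emeasure (k w) {a} * ennreal (p w)"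
      using cyl_sets[of w] setsC snoc.IH by (subst nn_integral_cmult_indicator) auto
    also have "\<dots> = ennreal (p (w @ [a]))"
    proof (cases "p w = 0")
      case True
      have "ennreal (p (w @ [a])) \<le> (\<integral>\<^sup>+a. ennreal (p (w @ [a])) \<partial>count_space UNIV)"
        by (rule nn_integral_ge_point) simp
      also have "\<dots> = 0" by (simp add: p_right True)
      finally show ?thesis using True by simp
    next
      case False
      then have "emeasure (k w) {a} = ennreal (p (w @ [a]) / p w)"
        by (simp add: k_def emeasure_density nn_integral_count_space_indicator[symmetric] nn_integral_count_space_finite)
      then show ?thesis using False p_nonneg by (simp add: ennreal_mult[symmetric] divide_nonneg_nonneg)
    qed
    finally show ?case by simp
  qed
  have lim: "emeasure IT.PF.lim {x. init_word (length w) x = w} = ennreal (p w)" for w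
  proof -
    have e: "IT.PF.emb UNIV {0..<length w} (cyl w) = {x. init_word (length w) x = w}"
    proof -
      have "map (restrict x {0..<length w}) [0..<length w] = map x [0..<length w]" for x :: "nat \<Rightarrow> 's"
        by (intro map_cong) auto
      moreover have "x \<in> IT.PF.emb UNIV {0..<length w} (cyl w) \<longleftrightarrow> map (restrict x {0..<length w}) [0..<length w] = w" for x
        by (auto simp: prod_emb_def cyl_def space_PiM PiE_def)
      ultimately show ?thesis by (simp only: set_eq_iff mem_Collect_eq init_word_def) blast
    qed
    have "emeasure IT.PF.lim {x. init_word (length w) x = w} = emeasure (IT.CI {0..<length w}) (cyl w)"
      unfolding e[symmetric] by (rule IT.lim) auto
    also have "\<dots> = emeasure (IT.C 0 (length w) (\<lambda>_. undefined)) (IT.PF.emb {0..<length w} {0..<length w} (cyl w))"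
      by (rule IT.emeasure_CI) auto
    also have "IT.PF.emb {0..<length w} {0..<length w} (cyl w) = cyl w"
      using sets.sets_into_space[OF cyl_sets[of w]] by (intro prod_emb_id) (simp add: space_PiM)
    finally show ?thesis by (simp add: C)
  qed
  show ?thesis
  proof (intro exI conjI allI)
    show sl: "sets IT.PF.lim = sets (PiM UNIV ?M)" by simp
    show "emeasure IT.PF.lim {x. init_word (length w) x = w} = ennreal (p w)" for w
      by (rule lim)
    from lim[of "[]"] show "prob_space IT.PF.lim"
      using sets_eq_imp_space_eq[OF sl] by (intro prob_spaceI) (simp add: p_Nil space_PiM)
  qed
qed

text \<open>Presents the shift space as the complement of countably many events about finite words,
  which is how it is seen to be measurable and of full measure among all sequences.\<close>

lemma markov_shift_words:
  "x \<in> markov_shift t \<longleftrightarrow> (\<forall>w. w \<noteq> [] \<longrightarrow> \<not> admissible t w \<longrightarrow> init_word (length w) x \<noteq> w)"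
proof
  assume "x \<in> markov_shift t"
  then show "\<forall>w. w \<noteq> [] \<longrightarrow> \<not> admissible t w \<longrightarrow> init_word (length w) x \<noteq> w"
    using admissible_init_word by (metis length_greater_0_conv)
next
  assume *: "\<forall>w. w \<noteq> [] \<longrightarrow> \<not> admissible t w \<longrightarrow> init_word (length w) x \<noteq> w"
  have "t (x i) (x (Suc i)) = 1" for i
  proof -
    define w where "w = init_word (Suc (Suc i)) x"
    have "w \<noteq> []" "init_word (length w) x = w" by (auto simp: w_def init_word_def)
    with * have "admissible t w" by blast
    then have "t (w ! i) (w ! Suc i) = 1" by (auto simp: admissible_def w_def)
    then show ?thesis by (simp add: w_def)
  qed
  then show "x \<in> markov_shift t" by (simp add: markov_shift_def)
qed

lemma cylinder_disjoint: "length v = length w \<Longrightarrow> v \<noteq> w \<Longrightarrow> cylinder t v \<inter> cylinder t w = {}"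
  by (auto simp: cylinder_init_word)

lemma emeasure_shift_preimage_cylinder:
  assumes "sets M = sets (markov_borel t)"
  shows "emeasure M (shift_map -` cylinder t w \<inter> markov_shift t) = (\<integral>\<^sup>+a. emeasure M (cylinder t (a # w)) \<partial>count_space UNIV)"
proof -
  have "shift_map -` cylinder t w \<inter> markov_shift t = (\<Union>a. cylinder t (a # w))"
    by (auto simp: cylinder_init_word init_word_Suc shift_map_markov)
  then show ?thesis
    by (simp only:) (rule emeasure_UN_countable,
      auto simp: assms disjoint_family_on_def cylinder_disjoint)
qed

lemma invariant_measure_exists:
  fixes p :: "'s::countable list \<Rightarrow> real"
  assumes p_nonneg: "\<And>w. 0 \<le> p w" and p_Nil: "p [] = 1"
    and p_right: "\<And>w. (\<integral>\<^sup>+a. ennreal (p (w @ [a])) \<partial>count_space UNIV) = ennreal (p w)"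
    and p_left: "\<And>w. (\<integral>\<^sup>+a. ennreal (p (a # w)) \<partial>count_space UNIV) = ennreal (p w)"
    and p_adm: "\<And>w. w \<noteq> [] \<Longrightarrow> \<not> admissible t w \<Longrightarrow> p w = 0"
  shows "\<exists>\<mu>\<in>invariant_measures t. \<forall>w. measure \<mu> (cylinder t w) = p w"
proof -
  obtain M where "prob_space M" and sM: "sets M = sets (PiM UNIV (\<lambda>_. count_space UNIV))"
    and M: "\<And>w. emeasure M {x. init_word (length w) x = w} = ennreal (p w)"
    using word_measure_exists[OF p_nonneg p_Nil p_right] by blast
  interpret prob_space M by fact
  have spM: "space M = UNIV" using sets_eq_imp_space_eq[OF sM] by (simp add: space_PiM)
  have W [measurable]: "{x. init_word (length w) x = w} \<in> sets M" for w
  proof -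
    have "{x. init_word (length w) x = w} = {x \<in> space (PiM UNIV (\<lambda>_. count_space UNIV)). \<forall>i\<in>{..<length w}. x i = w ! i}"
      by (auto simp: space_PiM list_eq_iff_nth_eq)
    also have "\<dots> \<in> sets (PiM UNIV (\<lambda>_. count_space UNIV))" by measurable
    finally show ?thesis by (simp add: sM)
  qed
  define Bad where "Bad = (\<Union>w\<in>{w. w \<noteq> [] \<and> \<not> admissible t w}. {x. init_word (length w) x = w})"
  have Sigma: "markov_shift t = - Bad"
    unfolding Bad_def set_eq_iff markov_shift_words by auto
  have Bad_null: "Bad \<in> null_sets M"
    unfolding Bad_def by (intro null_sets_UN') (auto simp: null_sets_def M p_adm W)
  then have AE: "AE x in M. x \<in> markov_shift t"
    unfolding Sigma using AE_not_in by fastforce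
  have [measurable]: "markov_shift t \<in> sets M"
    using Bad_null sets.compl_sets[of Bad M] by (auto simp: Sigma spM Compl_eq_Diff_UNIV null_sets_def)
  have "\<exists>x0. x0 \<in> markov_shift t"
  proof (rule ccontr)
    assume "\<nexists>x0. x0 \<in> markov_shift t"
    then have "AE x in M. False" using AE by simp
    then show False by (simp add: AE_const)
  qed
  then obtain x0 where x0: "x0 \<in> markov_shift t" ..
  \<comment> \<open>\<open>M\<close> lives on all sequences. The retraction sends the null set
    \<open>Bad\<close> to one point, so the image measure lives on the shift space and the masses of
    cylinders are unchanged.\<close>
  define r where "r x = (if x \<in> markov_shift t then x else x0)" for x
  have r [measurable]: "r \<in> measurable M (markov_borel t)"
  proof (rule measurable_into_markov_borel)
    show "r \<in> space M \<rightarrow> markov_shift t" using x0 by (auto simp: r_def)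
    fix w
    have "r -` cylinder t w \<inter> space M = (markov_shift t \<inter> {x. init_word (length w) x = w})
        \<union> (if x0 \<in> cylinder t w then Bad else {})"
      using x0 unfolding Sigma by (auto simp: r_def cylinder_init_word spM Sigma)
    then show "r -` cylinder t w \<inter> space M \<in> sets M" using Bad_null by (auto simp: null_sets_def)
  qed
  define \<mu> where "\<mu> = distr M (markov_borel t) r"
  have \<mu>_cyl: "emeasure \<mu> (cylinder t w) = ennreal (p w)" for w
  proof -
    have "emeasure \<mu> (cylinder t w) = emeasure M (r -` cylinder t w \<inter> space M)"
      unfolding \<mu>_def by (rule emeasure_distr) auto
    also have "\<dots> = emeasure M {x. init_word (length w) x = w}"
    proof (rule emeasure_eq_AE)
      show "AE x in M. x \<in> r -` cylinder t w \<inter> space M \<longleftrightarrow> x \<in> {x. init_word (length w) x = w}"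
        using AE by eventually_elim (auto simp: r_def cylinder_init_word spM)
      show "r -` cylinder t w \<inter> space M \<in> sets M" by (rule measurable_sets[OF r]) auto
    qed (rule W)
    finally show ?thesis by (simp add: M)
  qed
  have s\<mu>: "sets \<mu> = sets (markov_borel t)" by (simp add: \<mu>_def)
  have sp\<mu>: "space \<mu> = markov_shift t" by (simp add: \<mu>_def)
  interpret \<mu>: prob_space \<mu> unfolding \<mu>_def by (rule prob_space_distr) (rule r)
  have sh: "shift_map \<in> measurable \<mu> \<mu>"
    using measurable_shift_map[of t] measurable_cong_sets[OF s\<mu> s\<mu>] by blast
  have "distr \<mu> \<mu> shift_map = \<mu>"
  proof (rule measure_eqI_cylinder)
    show "finite_measure (distr \<mu> \<mu> shift_map)"
      using prob_space.prob_space_distr[OF \<mu>.prob_space_axioms sh] by (simp add: prob_space_def)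
    show "emeasure (distr \<mu> \<mu> shift_map) (cylinder t w) = emeasure \<mu> (cylinder t w)" for w
    proof -
      have "emeasure (distr \<mu> \<mu> shift_map) (cylinder t w) = emeasure \<mu> (shift_map -` cylinder t w \<inter> markov_shift t)"
        using sh by (subst emeasure_distr) (auto simp: s\<mu> sp\<mu>)
      also have "\<dots> = (\<integral>\<^sup>+a. ennreal (p (a # w)) \<partial>count_space UNIV)"
        by (simp add: emeasure_shift_preimage_cylinder[OF s\<mu>] \<mu>_cyl)
      finally show ?thesis by (simp add: p_left \<mu>_cyl)
    qed
  qed (auto simp: s\<mu>)
  then have "\<mu> \<in> invariant_measures t"
    using sh s\<mu> \<mu>.prob_space_axioms by (simp add: invariant_measures_def measure_preserving_map_def)
  moreover have "measure \<mu> (cylinder t w) = p w" for w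
    using \<mu>_cyl[of w] by (simp add: measure_def p_nonneg)
  ultimately show ?thesis by blast
qed

section \<open>Approximation of Borel sets by sets depending on finitely many letters\<close>

definition word_set :: "('s::countable \<Rightarrow> 's \<Rightarrow> nat) \<Rightarrow> nat \<Rightarrow> 's list set \<Rightarrow> (nat \<Rightarrow> 's) set" where
  "word_set t n E = {x \<in> markov_shift t. init_word n x \<in> E}"

lemma word_set_sets [measurable]: "word_set t n E \<in> sets (markov_borel t)"
proof -
  have "word_set t n E = init_word n -` E \<inter> space (markov_borel t)" by (auto simp: word_set_def)
  then show ?thesis using measurable_sets[OF measurable_init_word, of E n t] by simp
qed

lemma word_set_refine: "n \<le> m \<Longrightarrow> word_set t n E = word_set t m {w. take n w \<in> E}"
  by (auto simp: word_set_def take_init_word)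

lemma emeasure_word_decomp:
  assumes s: "sets M = sets (markov_borel t)" and A: "A \<in> sets M"
  shows "emeasure M (A \<inter> word_set t n E) = (\<integral>\<^sup>+w. emeasure M (A \<inter> cylinder t w) \<partial>count_space {w \<in> E. length w = n})"
proof -
  have "A \<inter> word_set t n E = (\<Union>w\<in>{w \<in> E. length w = n}. A \<inter> cylinder t w)"
    by (auto simp: word_set_def cylinder_init_word)
  then show ?thesis
    by (simp only:) (rule emeasure_UN_countable,
      insert A cylinder_disjoint, auto simp: s disjoint_family_on_def, blast)
qed

text \<open>One set has to serve both measures, so the error is measured by their sum. The
  approximable sets contain the cylinders and are closed under complements and countable
  unions.\<close>

lemma cylinder_approximation:
  assumes M: "finite_measure M" "sets M = sets (markov_borel t)"
    and N: "finite_measure N" "sets N = sets (markov_borel t)"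
    and A: "A \<in> sets (markov_borel t)" and e: "0 < e"
  shows "\<exists>n E. measure M (sym_diff A (word_set t n E)) + measure N (sym_diff A (word_set t n E)) < e"
proof -
  interpret M: finite_measure M by fact
  interpret N: finite_measure N by fact
  define m where "m X = measure M X + measure N X" for X
  have m_le: "m X \<le> m Y + m Z" if "X \<subseteq> Y \<union> Z" "X \<in> sets (markov_borel t)" "Y \<in> sets (markov_borel t)" "Z \<in> sets (markov_borel t)" for X Y Z
  proof -
    have "measure M X \<le> measure M (Y \<union> Z)" "measure N X \<le> measure N (Y \<union> Z)"
      using that M N by (auto intro!: M.finite_measure_mono N.finite_measure_mono)
    moreover have "measure M (Y \<union> Z) \<le> measure M Y + measure M Z" "measure N (Y \<union> Z) \<le> measure N Y + measure N Z"
      using that M N by (auto intro!: measure_Un_le)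
    ultimately show ?thesis unfolding m_def by linarith
  qed
  define good where "good X \<longleftrightarrow> (\<forall>e>0. \<exists>n E. m (sym_diff X (word_set t n E)) < e)" for X
  have good_un: "good (X \<union> Y)" if gX: "good X" and gY: "good Y" and X[measurable]: "X \<in> sets (markov_borel t)" and Y[measurable]: "Y \<in> sets (markov_borel t)" for X Y
    unfolding good_def
  proof (intro allI impI)
    fix e :: real assume "0 < e"
    then obtain n E k F where 1: "m (sym_diff X (word_set t n E)) < e/2" "m (sym_diff Y (word_set t k F)) < e/2"
      using gX gY unfolding good_def by (meson half_gt_zero)
    define l where "l = max n k"
    have "word_set t l {w. take n w \<in> E \<or> take k w \<in> F} = word_set t n E \<union> word_set t k F"
      using word_set_refine[of n l t E] word_set_refine[of k l t F] by (auto simp: l_def word_set_def)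
    then have "m (sym_diff (X \<union> Y) (word_set t l {w. take n w \<in> E \<or> take k w \<in> F}))
      \<le> m (sym_diff X (word_set t n E)) + m (sym_diff Y (word_set t k F))"
      by (intro m_le) auto
    then have "m (sym_diff (X \<union> Y) (word_set t l {w. take n w \<in> E \<or> take k w \<in> F})) < e" using 1 by linarith
    then show "\<exists>n E. m (sym_diff (X \<union> Y) (word_set t n E)) < e" by blast
  qed
  have "A \<in> sigma_sets (markov_shift t) (range (cylinder t))" using A by (simp add: sets_markov_borel)
  then have "good A"
  proof (induction A)
    case (Basic a)
    then obtain w where "a = cylinder t w" by auto
    then have "a = word_set t (length w) {w}" by (auto simp: cylinder_init_word word_set_def)
    then show ?case unfolding good_def m_def by (intro allI impI exI[of _ "length w"] exI[of _ "{w}"]) simp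
  next
    case Empty
    have "word_set t 0 {} = {}" by (simp add: word_set_def)
    then show ?case unfolding good_def m_def by (intro allI impI exI[of _ 0] exI[of _ "{}"]) simp
  next
    case (Compl a)
    show ?case unfolding good_def
    proof (intro allI impI)
      fix e :: real assume "0 < e"
      then obtain n E where 1: "m (sym_diff a (word_set t n E)) < e" using Compl.IH unfolding good_def by blast
      have "a \<subseteq> markov_shift t" using Compl.hyps by (rule sigma_sets_into_sp[rotated]) (auto simp: cylinder_def)
      then have "sym_diff (markov_shift t - a) (word_set t n (- E)) = sym_diff a (word_set t n E)"
        by (auto simp: word_set_def)
      then show "\<exists>n E. m (sym_diff (markov_shift t - a) (word_set t n E)) < e" using 1 by (intro exI[of _ n] exI[of _ "-E"]) simp
    qed
  next
    \<comment> \<open>Continuity from below for both measures reduces the countable union to a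
      finite one.\<close>
    case (Union a)
    have a[measurable]: "a i \<in> sets (markov_borel t)" for i using Union.hyps by (simp add: sets_markov_borel)
    have fin: "good (\<Union>i<k. a i)" for k
    proof (induction k)
      case 0
      have "word_set t 0 {} = {}" by (simp add: word_set_def)
      then show ?case unfolding good_def m_def by (intro allI impI exI[of _ 0] exI[of _ "{}"]) simp
    next
      case (Suc k)
      then show ?case using good_un[of "\<Union>i<k. a i" "a k"] Union.IH[of k] by (simp add: lessThan_Suc Un_commute)
    qed
    have inc: "incseq (\<lambda>k. \<Union>i<k. a i)" by (auto simp: incseq_def intro: less_le_trans)
    have un: "(\<Union>k. \<Union>i<k. a i) = \<Union>(range a)" by auto
    have "(\<lambda>k. m (\<Union>i<k. a i)) \<longlonglongrightarrow> m (\<Union>(range a))"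
    proof -
      have "range (\<lambda>k. \<Union>i<k. a i) \<subseteq> sets (markov_borel t)" by auto
      then show ?thesis
        unfolding m_def un[symmetric]
        by (intro tendsto_add M.finite_Lim_measure_incseq[OF _ inc] N.finite_Lim_measure_incseq[OF _ inc]) (simp_all only: M N)
    qed
    show ?case unfolding good_def
    proof (intro allI impI)
      fix e :: real assume e: "0 < e"
      obtain k where "norm (m (\<Union>i<k. a i) - m (\<Union>(range a))) < e/2"
        using LIMSEQ_D[OF \<open>(\<lambda>k. m (\<Union>i<k. a i)) \<longlonglongrightarrow> m (\<Union>(range a))\<close>, of "e/2"] e by auto
      then have k: "m (\<Union>(range a)) - m (\<Union>i<k. a i) < e/2" unfolding real_norm_def by linarith
      obtain n E where nE: "m (sym_diff (\<Union>i<k. a i) (word_set t n E)) < e/2"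
        using fin[of k] half_gt_zero[OF e] unfolding good_def by blast
      have "m (\<Union>(range a) - (\<Union>i<k. a i)) = m (\<Union>(range a)) - m (\<Union>i<k. a i)"
        unfolding m_def using M N by (subst M.finite_measure_Diff, auto, subst N.finite_measure_Diff) auto
      moreover have "m (sym_diff (\<Union>(range a)) (word_set t n E)) \<le> m (\<Union>(range a) - (\<Union>i<k. a i)) + m (sym_diff (\<Union>i<k. a i) (word_set t n E))"
        by (intro m_le) auto
      ultimately have "m (sym_diff (\<Union>(range a)) (word_set t n E)) < e" using k nE by linarith
      then show "\<exists>n E. m (sym_diff (\<Union>(range a)) (word_set t n E)) < e" by blast
    qed
  qed
  then show ?thesis using e unfolding good_def m_def by blast
qed

lemma emeasure_le_of_cylinder:
  assumes M: "finite_measure M" "sets M = sets (markov_borel t)"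
    and N: "finite_measure N" "sets N = sets (markov_borel t)"
    and le: "\<And>w. emeasure M (cylinder t w) \<le> emeasure N (cylinder t w)"
    and A: "A \<in> sets (markov_borel t)"
  shows "emeasure M A \<le> emeasure N A"
proof -
  interpret M: finite_measure M by fact
  interpret N: finite_measure N by fact
  have sp: "space M = markov_shift t" "space N = markov_shift t"
    using sets_eq_imp_space_eq[OF M(2)] sets_eq_imp_space_eq[OF N(2)] by auto
  have ws: "measure M (word_set t n E) \<le> measure N (word_set t n E)" for n E
  proof -
    have "emeasure M (markov_shift t \<inter> word_set t n E) \<le> emeasure N (markov_shift t \<inter> word_set t n E)"
      using M N le
      by (subst (1 2) emeasure_word_decomp) (auto intro!: nn_integral_mono simp: sp[symmetric] Int_absorb1 cylinder_def sets.Int_space_eq1)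
    moreover have "markov_shift t \<inter> word_set t n E = word_set t n E" by (auto simp: word_set_def)
    ultimately show ?thesis by (simp add: M.emeasure_eq_measure N.emeasure_eq_measure)
  qed
  have "measure M A \<le> measure N A + e" if "0 < e" for e
  proof -
    obtain n E where 1: "measure M (sym_diff A (word_set t n E)) + measure N (sym_diff A (word_set t n E)) < e"
      using cylinder_approximation[OF M N A \<open>0 < e\<close>] by blast
    let ?W = "word_set t n E"
    have "measure M A \<le> measure M (?W \<union> sym_diff A ?W)" using A M by (intro M.finite_measure_mono) auto
    also have "\<dots> \<le> measure M ?W + measure M (sym_diff A ?W)" using A M by (intro measure_Un_le) auto
    also have "measure M ?W \<le> measure N ?W" by (rule ws)
    also have "measure N ?W \<le> measure N (A \<union> sym_diff A ?W)" using A N by (intro N.finite_measure_mono) auto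
    also have "\<dots> \<le> measure N A + measure N (sym_diff A ?W)" using A N by (intro measure_Un_le) auto
    finally show ?thesis using 1 by linarith
  qed
  then have "measure M A \<le> measure N A" by (rule field_le_epsilon)
  then show ?thesis by (simp add: M.emeasure_eq_measure N.emeasure_eq_measure)
qed

section \<open>Mixing of quasi-Bernoulli measures\<close>

locale measure_preserving = prob_space M for M :: "'a measure" +
  fixes T :: "'a \<Rightarrow> 'a"
  assumes T_measurable: "T \<in> measurable M M" and distr_T: "distr M M T = M"
begin

lemma funpow_measurable [measurable]: "(T ^^ n) \<in> measurable M M"
proof (induction n)
  case (Suc n)
  show ?case unfolding funpow.simps by (rule measurable_comp[OF Suc T_measurable])
qed simp

lemma distr_funpow: "distr M M (T ^^ n) = M"
proof (induction n)
  case 0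
  show ?case using distr_id[of M] by (simp add: id_def)
next
  case (Suc n)
  have "distr M M (T ^^ Suc n) = distr (distr M M (T ^^ n)) M T"
    by (subst distr_distr[OF T_measurable funpow_measurable]) simp
  also have "\<dots> = M" using Suc distr_T by simp
  finally show ?case .
qed

end

locale shift_measure =
  fixes t :: "'s::countable \<Rightarrow> 's \<Rightarrow> nat" and \<mu> :: "(nat \<Rightarrow> 's) measure"
  assumes inv: "\<mu> \<in> invariant_measures t"
begin

sublocale measure_preserving \<mu> shift_map
  using inv
  by (auto simp: invariant_measures_def measure_preserving_map_def measure_preserving_def measure_preserving_axioms_def)

lemma sets_eq [simp, measurable_cong]: "sets \<mu> = sets (markov_borel t)"
  using inv by (simp add: invariant_measures_def)

lemma space_eq [simp]: "space \<mu> = markov_shift t"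
  using sets_eq_imp_space_eq[OF sets_eq] by simp

lemma preimage_sets [measurable]: "B \<in> sets (markov_borel t) \<Longrightarrow> (shift_map ^^ n) -` B \<inter> markov_shift t \<in> sets (markov_borel t)"
  using measurable_sets[OF funpow_measurable, of B n] by simp

lemma emeasure_preimage: "B \<in> sets (markov_borel t) \<Longrightarrow> emeasure \<mu> ((shift_map ^^ n) -` B \<inter> markov_shift t) = emeasure \<mu> B"
  using emeasure_distr[OF funpow_measurable, of B n] by (simp add: distr_funpow)

lemma measure_preimage: "B \<in> sets (markov_borel t) \<Longrightarrow> measure \<mu> ((shift_map ^^ n) -` B \<inter> markov_shift t) = measure \<mu> B"
  using emeasure_preimage[of B n] by (simp add: measure_def)

text \<open>Density of cylinder functions in L^1, by induction from indicators. Factoring the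
  approximant through \<open>init_word k\<close> makes it constant on cylinders of length
  \<open>k\<close>.\<close>

lemma cylinder_functions_dense:
  fixes h :: "(nat \<Rightarrow> 's) \<Rightarrow> real"
  assumes "integrable \<mu> h"
  shows "\<forall>e>0. \<exists>k \<psi>. integrable \<mu> (\<lambda>x. \<psi> (init_word k x)) \<and> (\<integral>x. \<bar>h x - \<psi> (init_word k x)\<bar> \<partial>\<mu>) < e"
  using assms
proof (induction rule: integrable_induct)
  case (base A c)
  show ?case
  proof (intro allI impI)
    fix e :: real assume "0 < e"
    then have e': "0 < e / (1 + \<bar>c\<bar>)" by simp
    have A: "A \<in> sets (markov_borel t)" using base by simp
    \<comment> \<open>\<open>cylinder_approximation\<close> expects two measures; here both are
      \<mu>.\<close>
    then obtain k E where E: "measure \<mu> (sym_diff A (word_set t k E)) + measure \<mu> (sym_diff A (word_set t k E)) < e / (1 + \<bar>c\<bar>)"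
      using cylinder_approximation[OF finite_measure_axioms sets_eq finite_measure_axioms sets_eq A e'] by blast
    let ?D = "sym_diff A (word_set t k E)"
    have ind: "indicator E (init_word k x) = (indicator (word_set t k E) x :: real)" if "x \<in> markov_shift t" for x
      using that by (simp add: word_set_def indicator_def)
    have "integrable \<mu> (\<lambda>x. indicator (word_set t k E) x *\<^sub>R c)"
      by (intro integrable_scaleR_left integrable_real_indicator) (auto simp: emeasure_eq_measure)
    then have "integrable \<mu> (\<lambda>x. indicator E (init_word k x) *\<^sub>R c)"
      using Bochner_Integration.integrable_cong[OF refl, of \<mu> "\<lambda>x. indicator E (init_word k x) *\<^sub>R c" "\<lambda>x. indicator (word_set t k E) x *\<^sub>R c"] ind
      by simp
    moreover have "(\<integral>x. \<bar>indicat_real A x *\<^sub>R c - indicator E (init_word k x) *\<^sub>R c\<bar> \<partial>\<mu>) < e"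
    proof -
      have "(\<integral>x. \<bar>indicat_real A x *\<^sub>R c - indicator E (init_word k x) *\<^sub>R c\<bar> \<partial>\<mu>) = (\<integral>x. \<bar>c\<bar> * indicator ?D x \<partial>\<mu>)"
        by (intro Bochner_Integration.integral_cong refl) (simp add: ind, auto simp: indicator_def)
      also have "\<dots> = \<bar>c\<bar> * measure \<mu> ?D"
      proof -
        have "?D \<in> sets (markov_borel t)" using A by auto
        then have "?D \<inter> markov_shift t = ?D" using sets.sets_into_space by fastforce
        then show ?thesis by simp
      qed
      also have "\<dots> \<le> (1 + \<bar>c\<bar>) * measure \<mu> ?D" by (intro mult_right_mono) auto
      also have "\<dots> < e"
      proof -
        have "measure \<mu> ?D < e / (1 + \<bar>c\<bar>)" using E measure_nonneg[of \<mu> ?D] by linarith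
        then show ?thesis by (simp add: field_simps)
      qed
      finally show ?thesis .
    qed
    ultimately show "\<exists>k \<psi>. integrable \<mu> (\<lambda>x. \<psi> (init_word k x)) \<and> (\<integral>x. \<bar>indicat_real A x *\<^sub>R c - \<psi> (init_word k x)\<bar> \<partial>\<mu>) < e"
      by (intro exI[of _ k] exI[of _ "\<lambda>w. indicator E w *\<^sub>R c"]) auto
  qed
next
  case (add f g)
  show ?case
  proof (intro allI impI)
    fix e :: real assume "0 < e"
    then have "0 < e/2" by simp
    then obtain k \<phi> l \<psi> where 1: "integrable \<mu> (\<lambda>x. \<phi> (init_word k x))" "(\<integral>x. \<bar>f x - \<phi> (init_word k x)\<bar> \<partial>\<mu>) < e/2"
       "integrable \<mu> (\<lambda>x. \<psi> (init_word l x))" "(\<integral>x. \<bar>g x - \<psi> (init_word l x)\<bar> \<partial>\<mu>) < e/2"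
      using add.IH by meson
    define \<xi> where "\<xi> w = \<phi> (take k w) + \<psi> (take l w)" for w
    have \<xi>: "\<xi> (init_word (max k l) x) = \<phi> (init_word k x) + \<psi> (init_word l x)" for x
      by (simp add: \<xi>_def take_init_word)
    have "(\<integral>x. \<bar>f x + g x - \<xi> (init_word (max k l) x)\<bar> \<partial>\<mu>)
      \<le> (\<integral>x. \<bar>f x - \<phi> (init_word k x)\<bar> + \<bar>g x - \<psi> (init_word l x)\<bar> \<partial>\<mu>)"
      unfolding \<xi> using 1 add.hyps by (intro integral_mono) auto
    also have "\<dots> = (\<integral>x. \<bar>f x - \<phi> (init_word k x)\<bar> \<partial>\<mu>) + (\<integral>x. \<bar>g x - \<psi> (init_word l x)\<bar> \<partial>\<mu>)"
      using 1 add.hyps by (intro Bochner_Integration.integral_add) auto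
    also have "\<dots> < e" using 1 by linarith
    finally show "\<exists>k \<psi>. integrable \<mu> (\<lambda>x. \<psi> (init_word k x)) \<and> (\<integral>x. \<bar>f x + g x - \<psi> (init_word k x)\<bar> \<partial>\<mu>) < e"
      using 1 by (intro exI[of _ "max k l"] exI[of _ \<xi>]) (auto simp: \<xi>)
  qed
next
  case (lim f s)
  have "(\<lambda>i. \<integral>x. \<bar>f x - s i x\<bar> \<partial>\<mu>) \<longlonglongrightarrow> (\<integral>x. 0 \<partial>\<mu>)"
  proof (rule integral_dominated_convergence[where w = "\<lambda>x. 3 * \<bar>f x\<bar>"])
    show "AE x in \<mu>. (\<lambda>i. \<bar>f x - s i x\<bar>) \<longlonglongrightarrow> 0"
    proof (rule AE_I2)
      fix x assume "x \<in> space \<mu>"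
      then have "(\<lambda>i. f x - s i x) \<longlonglongrightarrow> f x - f x" using lim by (intro tendsto_diff tendsto_const) auto
      then show "(\<lambda>i. \<bar>f x - s i x\<bar>) \<longlonglongrightarrow> 0" by (simp add: tendsto_rabs_zero)
    qed
    show "AE x in \<mu>. norm \<bar>f x - s i x\<bar> \<le> 3 * \<bar>f x\<bar>" for i
    proof (rule AE_I2)
      fix x assume "x \<in> space \<mu>"
      then have "\<bar>s i x\<bar> \<le> 2 * \<bar>f x\<bar>" using lim(3)[of x i] by simp
      then show "norm \<bar>f x - s i x\<bar> \<le> 3 * \<bar>f x\<bar>" by simp
    qed
  qed (use lim in auto)
  then have L: "(\<lambda>i. \<integral>x. \<bar>f x - s i x\<bar> \<partial>\<mu>) \<longlonglongrightarrow> 0" by simp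
  show ?case
  proof (intro allI impI)
    fix e :: real assume e: "0 < e"
    then obtain i where i: "(\<integral>x. \<bar>f x - s i x\<bar> \<partial>\<mu>) < e/2"
      using order_tendstoD(2)[OF L, of "e/2"] by (auto simp: eventually_sequentially)
    obtain k \<psi> where 1: "integrable \<mu> (\<lambda>x. \<psi> (init_word k x))" "(\<integral>x. \<bar>s i x - \<psi> (init_word k x)\<bar> \<partial>\<mu>) < e/2"
      using lim.IH[of i] e by (meson half_gt_zero)
    have "(\<integral>x. \<bar>f x - \<psi> (init_word k x)\<bar> \<partial>\<mu>) \<le> (\<integral>x. \<bar>f x - s i x\<bar> + \<bar>s i x - \<psi> (init_word k x)\<bar> \<partial>\<mu>)"
      using 1 lim by (intro integral_mono) auto
    also have "\<dots> = (\<integral>x. \<bar>f x - s i x\<bar> \<partial>\<mu>) + (\<integral>x. \<bar>s i x - \<psi> (init_word k x)\<bar> \<partial>\<mu>)"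
      using 1 lim by (intro Bochner_Integration.integral_add) auto
    also have "\<dots> < e" using 1 i by linarith
    finally show "\<exists>k \<psi>. integrable \<mu> (\<lambda>x. \<psi> (init_word k x)) \<and> (\<integral>x. \<bar>f x - \<psi> (init_word k x)\<bar> \<partial>\<mu>) < e"
      using 1 by blast
  qed
qed

end

section \<open>Doeblin contraction and its consequences\<close>

locale quasi_bernoulli_measure = shift_measure t \<mu>
  for t :: "'s::countable \<Rightarrow> 's \<Rightarrow> nat" and \<mu> +
  fixes c :: real and N :: nat
  assumes c_pos: "0 < c"
    and lower: "c * measure \<mu> (cylinder t u) * measure \<mu> (cylinder t w)
      \<le> measure \<mu> (cylinder t u \<inter> ((shift_map ^^ (length u + N)) -` cylinder t w \<inter> markov_shift t))"
begin

lemma c_le_1: "c \<le> 1"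
  using lower[of "[]" "[]"] prob_space prob_le_1 by (simp, metis mult.right_neutral order_trans)

text \<open>Both sides are finite measures in \<open>B\<close>, a multiple of \<mu> and an image of
  \<mu> restricted to a cylinder, so comparing them on cylinders suffices.\<close>

lemma lower_set:
  assumes B: "B \<in> sets (markov_borel t)"
  shows "ennreal (c * measure \<mu> (cylinder t u)) * emeasure \<mu> B
    \<le> emeasure \<mu> (cylinder t u \<inter> ((shift_map ^^ (length u + N)) -` B \<inter> markov_shift t))"
proof -
  define M where "M = scale_measure (ennreal (c * measure \<mu> (cylinder t u))) \<mu>"
  define R where "R = distr (density \<mu> (indicator (cylinder t u))) \<mu> (shift_map ^^ (length u + N))"
  have R: "emeasure R X = emeasure \<mu> (cylinder t u \<inter> ((shift_map ^^ (length u + N)) -` X \<inter> markov_shift t))"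
    if "X \<in> sets (markov_borel t)" for X
    unfolding R_def using that by (subst emeasure_distr) (auto simp: emeasure_restricted)
  have "emeasure M B \<le> emeasure R B"
  proof (rule emeasure_le_of_cylinder[OF _ _ _ _ _ B])
    show "finite_measure M" unfolding M_def
      by (rule finite_measureI) (simp add: emeasure_scale_measure ennreal_mult_eq_top_iff)
    show "finite_measure R" using R[of "markov_shift t"] sets.top[of "markov_borel t"]
      by (intro finite_measureI) (simp add: R_def emeasure_eq_measure)
    show "emeasure M (cylinder t w) \<le> emeasure R (cylinder t w)" for w
      using lower[of u w] c_pos unfolding M_def
      by (simp add: R emeasure_scale_measure emeasure_eq_measure ennreal_mult[symmetric])
  qed (auto simp: M_def R_def)
  then show ?thesis by (simp add: M_def R[OF B] emeasure_scale_measure)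
qed

text \<open>
  The number \<open>r\<close> bounds the eventual distance in total variation between the iterated images of \<open>\<rho>\<close> and \<open>\<mu>\<close>,
  relative to the mass of \<open>\<rho>\<close>; the threshold \<open>n0\<close> depends on \<open>\<rho>\<close> but not on \<open>B\<close>.
\<close>

definition contracts :: "real \<Rightarrow> bool" where
  "contracts r \<longleftrightarrow> (\<forall>\<rho>. finite_measure \<rho> \<longrightarrow> sets \<rho> = sets (markov_borel t) \<longrightarrow> absolutely_continuous \<mu> \<rho> \<longrightarrow>
     (\<exists>n0. \<forall>n\<ge>n0. \<forall>B\<in>sets (markov_borel t).
        \<bar>measure \<rho> ((shift_map ^^ n) -` B \<inter> markov_shift t) - measure \<rho> (markov_shift t) * measure \<mu> B\<bar>
          \<le> r * measure \<rho> (markov_shift t)))"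

lemma contracts_1: "contracts 1"
  unfolding contracts_def
proof (intro allI impI exI[of _ 0] ballI)
  fix \<rho> :: "(nat \<Rightarrow> 's) measure" and n B
  assume "finite_measure \<rho>" and s: "sets \<rho> = sets (markov_borel t)"
  interpret \<rho>: finite_measure \<rho> by fact
  let ?X = "measure \<rho> ((shift_map ^^ n) -` B \<inter> markov_shift t)" and ?a = "measure \<rho> (markov_shift t)"
  have "?X \<le> ?a" using sets.top[of "markov_borel t"] by (intro \<rho>.finite_measure_mono) (auto simp: s)
  moreover have "?a * measure \<mu> B \<le> ?a * 1" by (intro mult_left_mono prob_le_1) auto
  moreover have "0 \<le> ?X" "0 \<le> ?a * measure \<mu> B" by auto
  ultimately show "\<bar>?X - ?a * measure \<mu> B\<bar> \<le> 1 * ?a" by linarith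
qed

text \<open>
  Up to a small error in total variation, \<open>\<rho>\<close> has a density depending on the first \<open>k\<close> letters only.
  Its image under the \<open>(k + N)\<close>-th iterate dominates \<open>c\<close> times its mass times \<open>\<mu>\<close>, and only the remaining
  fraction \<open>1 - c\<close> still has to be compared with \<open>\<mu>\<close>.
\<close>

lemma contracts_step:
  assumes r: "contracts r" "0 \<le> r" "r \<le> 1" and \<delta>: "0 < \<delta>"
  shows "contracts ((1 - c) * r + \<delta>)"
  unfolding contracts_def
proof (intro allI impI)
  fix \<rho> :: "(nat \<Rightarrow> 's) measure"
  assume fin: "finite_measure \<rho>" and s: "sets \<rho> = sets (markov_borel t)" and ac: "absolutely_continuous \<mu> \<rho>"
  interpret \<rho>: finite_measure \<rho> by fact
  have sp: "space \<rho> = markov_shift t" using sets_eq_imp_space_eq[OF s] by simp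
  have topS [measurable]: "markov_shift t \<in> sets (markov_borel t)" using sets.top[of "markov_borel t"] by simp
  define a where "a = measure \<rho> (markov_shift t)"
  show "\<exists>n0. \<forall>n\<ge>n0. \<forall>B\<in>sets (markov_borel t).
        \<bar>measure \<rho> ((shift_map ^^ n) -` B \<inter> markov_shift t) - measure \<rho> (markov_shift t) * measure \<mu> B\<bar>
          \<le> ((1 - c) * r + \<delta>) * measure \<rho> (markov_shift t)"
  \<comment> \<open>The permitted error \<eta> will be proportional to \<open>a\<close>, so the zero
    measure is treated apart.\<close>
  proof (cases "a = 0")
    case True
    have "measure \<rho> X = 0" if "X \<in> sets (markov_borel t)" for X
    proof -
      have "measure \<rho> X \<le> a" unfolding a_def sp[symmetric] by (rule \<rho>.bounded_measure)
      then show ?thesis using True measure_nonneg[of \<rho> X] by simp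
    qed
    then show ?thesis by simp
  next
    case False
    then have a: "0 < a" unfolding a_def using measure_nonneg[of \<rho> "markov_shift t"] by linarith
    \<comment> \<open>A third, because the error is paid three times: in replacing \<rho> by
      \<open>\<rho>1\<close>, in comparing the masses \<open>a\<close> and \<open>a1\<close>, and in
      bounding the mass of the remainder.\<close>
    define \<eta> where "\<eta> = \<delta> * a / 3"
    have \<eta>: "0 < \<eta>" using a \<delta> by (simp add: \<eta>_def)
    obtain h0 where h0 [measurable]: "h0 \<in> borel_measurable \<mu>" and \<rho>h0: "density \<mu> h0 = \<rho>"
      using Radon_Nikodym[OF ac] s by auto
    have h0_int: "(\<integral>\<^sup>+x. h0 x \<partial>\<mu>) = ennreal a"
    proof -
      have "emeasure \<rho> (space \<mu>) = (\<integral>\<^sup>+x. h0 x * indicator (space \<mu>) x \<partial>\<mu>)"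
        unfolding \<rho>h0[symmetric] by (rule emeasure_density[OF h0]) auto
      also have "\<dots> = (\<integral>\<^sup>+x. h0 x \<partial>\<mu>)" by (rule nn_integral_cong) (auto simp: indicator_def)
      finally show ?thesis by (simp add: a_def \<rho>.emeasure_eq_measure)
    qed
    have h0_fin: "AE x in \<mu>. h0 x \<noteq> \<infinity>"
      by (rule nn_integral_noteq_infinite) (auto simp: h0_int)
    define h where "h x = enn2real (h0 x)" for x
    have h_h0: "AE x in \<mu>. ennreal (h x) = h0 x" using h0_fin by eventually_elim (simp add: h_def less_top)
    have h_nn: "0 \<le> h x" for x by (simp add: h_def)
    have h_meas [measurable]: "h \<in> borel_measurable \<mu>" unfolding h_def by measurable
    have "(\<integral>\<^sup>+x. ennreal (h x) \<partial>\<mu>) = ennreal a"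
      using nn_integral_cong_AE[OF h_h0] h0_int by simp
    then have h_int: "integrable \<mu> h"
      by (intro integrableI_nonneg) (auto simp: h_nn)
    have \<rho>h: "measure \<rho> X = (\<integral>x. h x * indicator X x \<partial>\<mu>)" if "X \<in> sets (markov_borel t)" for X
    proof -
      have "emeasure \<rho> X = (\<integral>\<^sup>+x. h0 x * indicator X x \<partial>\<mu>)"
        unfolding \<rho>h0[symmetric] using that by (intro emeasure_density) auto
      also have "\<dots> = (\<integral>\<^sup>+x. ennreal (h x * indicator X x) \<partial>\<mu>)"
        by (intro nn_integral_cong_AE, use h_h0 in eventually_elim) (auto simp: indicator_def)
      also have "\<dots> = ennreal (\<integral>x. h x * indicator X x \<partial>\<mu>)"
        using that h_int h_nn by (intro nn_integral_eq_integral integrable_mult_indicator[of _ _ h, simplified mult.commute[of "indicator _ _"] real_scaleR_def]) auto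
      finally show ?thesis by (simp add: measure_def h_nn)
    qed
    obtain k \<psi> where \<psi>: "integrable \<mu> (\<lambda>x. \<psi> (init_word k x))" "(\<integral>x. \<bar>h x - \<psi> (init_word k x)\<bar> \<partial>\<mu>) < \<eta>"
      using cylinder_functions_dense[OF h_int] \<eta> by blast
    \<comment> \<open>As \<open>h\<close> is nonnegative, cutting off negative values does not
      increase the distance to it.\<close>
    define \<phi> where "\<phi> w = max 0 (\<psi> w)" for w
    have \<phi>_nn: "0 \<le> \<phi> w" for w by (simp add: \<phi>_def)
    have \<phi>_int: "integrable \<mu> (\<lambda>x. \<phi> (init_word k x))" unfolding \<phi>_def using \<psi> by auto
    have \<phi>: "(\<integral>x. \<bar>h x - \<phi> (init_word k x)\<bar> \<partial>\<mu>) < \<eta>"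
    proof -
      have "(\<integral>x. \<bar>h x - \<phi> (init_word k x)\<bar> \<partial>\<mu>) \<le> (\<integral>x. \<bar>h x - \<psi> (init_word k x)\<bar> \<partial>\<mu>)"
        using h_int \<psi> \<phi>_int by (intro integral_mono) (auto simp: \<phi>_def h_nn max_def intro: order_trans[OF _ abs_ge_self])
      then show ?thesis using \<psi> by linarith
    qed
    have \<phi>_meas [measurable]: "(\<lambda>x. \<phi> (init_word k x)) \<in> borel_measurable \<mu>" using \<phi>_int by auto
    define \<rho>1 where "\<rho>1 = density \<mu> (\<lambda>x. ennreal (\<phi> (init_word k x)))"
    have s1: "sets \<rho>1 = sets (markov_borel t)" "space \<rho>1 = markov_shift t" by (auto simp: \<rho>1_def)
    have \<rho>1: "emeasure \<rho>1 X = ennreal (\<integral>x. \<phi> (init_word k x) * indicator X x \<partial>\<mu>)" if "X \<in> sets (markov_borel t)" for X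
    proof -
      have "emeasure \<rho>1 X = (\<integral>\<^sup>+x. ennreal (\<phi> (init_word k x) * indicator X x) \<partial>\<mu>)"
        unfolding \<rho>1_def using that by (subst emeasure_density) (auto intro!: nn_integral_cong simp: indicator_def)
      also have "\<dots> = ennreal (\<integral>x. \<phi> (init_word k x) * indicator X x \<partial>\<mu>)"
        using that \<phi>_int \<phi>_nn by (intro nn_integral_eq_integral integrable_real_mult_indicator) auto
      finally show ?thesis .
    qed
    have m1: "measure \<rho>1 X = (\<integral>x. \<phi> (init_word k x) * indicator X x \<partial>\<mu>)" if "X \<in> sets (markov_borel t)" for X
      using \<rho>1[OF that] by (simp add: measure_def \<phi>_nn)
    interpret \<rho>1: finite_measure \<rho>1 by (rule finite_measureI) (simp add: s1 \<rho>1)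
    define a1 where "a1 = measure \<rho>1 (markov_shift t)"
    have a1: "0 \<le> a1" by (simp add: a1_def)
    have close: "\<bar>measure \<rho> X - measure \<rho>1 X\<bar> \<le> \<eta>" if X: "X \<in> sets (markov_borel t)" for X
    proof -
      have i1: "integrable \<mu> (\<lambda>x. h x * indicator X x)" "integrable \<mu> (\<lambda>x. \<phi> (init_word k x) * indicator X x)"
        using X h_int \<phi>_int by (auto intro!: integrable_real_mult_indicator)
      have "\<bar>measure \<rho> X - measure \<rho>1 X\<bar> = \<bar>\<integral>x. h x * indicator X x - \<phi> (init_word k x) * indicator X x \<partial>\<mu>\<bar>"
        using i1 by (simp add: \<rho>h[OF X] m1[OF X])
      also have "\<dots> \<le> (\<integral>x. \<bar>h x * indicator X x - \<phi> (init_word k x) * indicator X x\<bar> \<partial>\<mu>)"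
        by (rule integral_abs_bound)
      also have "\<dots> \<le> (\<integral>x. \<bar>h x - \<phi> (init_word k x)\<bar> \<partial>\<mu>)"
        using i1 h_int \<phi>_int by (intro integral_mono) (auto simp: indicator_def)
      finally show ?thesis using \<phi> by linarith
    qed
    \<comment> \<open>On each cylinder of length \<open>k\<close> the measure \<open>\<rho>1\<close>
      is a multiple of \<mu>, so \<open>lower_set\<close> applies after \<open>k + N\<close>
      steps.\<close>
    define m where "m = k + N"
    define \<rho>2 where "\<rho>2 = distr \<rho>1 \<mu> (shift_map ^^ m)"
    have fm: "(shift_map ^^ n) \<in> measurable \<rho>1 \<mu>" for n
      using funpow_measurable[of n] measurable_cong_sets[of \<rho>1 \<mu> \<mu> \<mu>] s1 by auto
    have s2: "sets \<rho>2 = sets (markov_borel t)" "space \<rho>2 = markov_shift t" by (auto simp: \<rho>2_def)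
    have e2: "emeasure \<rho>2 X = emeasure \<rho>1 ((shift_map ^^ m) -` X \<inter> markov_shift t)" if "X \<in> sets (markov_borel t)" for X
      unfolding \<rho>2_def using that fm by (subst emeasure_distr) (auto simp: s1)
    have m2: "measure \<rho>2 X = measure \<rho>1 ((shift_map ^^ m) -` X \<inter> markov_shift t)" if "X \<in> sets (markov_borel t)" for X
      using e2[OF that] by (simp add: measure_def)
    interpret \<rho>2: finite_measure \<rho>2 by (rule finite_measureI) (simp add: s2 e2)
    define \<rho>0 where "\<rho>0 = scale_measure (ennreal (c * a1)) \<mu>"
    have e0: "emeasure \<rho>0 X = ennreal (c * a1 * measure \<mu> X)" for X
      using a1 c_pos by (simp add: \<rho>0_def emeasure_scale_measure emeasure_eq_measure ennreal_mult)
    have s0: "sets \<rho>0 = sets (markov_borel t)" by (simp add: \<rho>0_def)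
    interpret \<rho>0: finite_measure \<rho>0 by (rule finite_measureI) (simp add: e0)
    have cyl1: "emeasure \<rho>1 (X \<inter> cylinder t w) = ennreal (\<phi> w) * emeasure \<mu> (X \<inter> cylinder t w)"
      if "X \<in> sets (markov_borel t)" "length w = k" for X w
    proof -
      have "emeasure \<rho>1 (X \<inter> cylinder t w) = (\<integral>\<^sup>+x. ennreal (\<phi> w) * indicator (X \<inter> cylinder t w) x \<partial>\<mu>)"
        unfolding \<rho>1_def using that
        by (subst emeasure_density) (auto intro!: nn_integral_cong simp: indicator_def cylinder_init_word)
      then show ?thesis using that by (simp add: nn_integral_cmult_indicator)
    qed
    have full: "X \<inter> word_set t k UNIV = X" if "X \<in> sets (markov_borel t)" for X
      using sets.sets_into_space[OF that] by (auto simp: word_set_def)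
    have le: "emeasure \<rho>0 X \<le> emeasure \<rho>2 X" if X: "X \<in> sets (markov_borel t)" for X
    proof -
      let ?Y = "(shift_map ^^ m) -` X \<inter> markov_shift t"
      have Y: "?Y \<in> sets (markov_borel t)" using X by simp
      have a1_eq: "ennreal a1 = (\<integral>\<^sup>+w. ennreal (\<phi> w) * emeasure \<mu> (cylinder t w) \<partial>count_space {w \<in> UNIV. length w = k})"
      proof -
        have "ennreal a1 = emeasure \<rho>1 (markov_shift t \<inter> word_set t k UNIV)"
          by (simp add: a1_def full \<rho>1.emeasure_eq_measure)
        also have "\<dots> = (\<integral>\<^sup>+w. emeasure \<rho>1 (markov_shift t \<inter> cylinder t w) \<partial>count_space {w \<in> UNIV. length w = k})"
          by (rule emeasure_word_decomp) (auto simp: s1)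
        also have "\<dots> = (\<integral>\<^sup>+w. ennreal (\<phi> w) * emeasure \<mu> (cylinder t w) \<partial>count_space {w \<in> UNIV. length w = k})"
          by (intro nn_integral_cong, subst cyl1) (auto simp: cylinder_def Int_def conj_ac intro!: arg_cong[where f="emeasure \<mu>"] arg_cong2[where f="(*)"])
        finally show ?thesis .
      qed
      have "emeasure \<rho>0 X = ennreal c * emeasure \<mu> X * ennreal a1"
        using a1 c_pos by (simp add: e0 emeasure_eq_measure ennreal_mult mult_ac)
      also have "\<dots> = (\<integral>\<^sup>+w. ennreal c * emeasure \<mu> X * (ennreal (\<phi> w) * emeasure \<mu> (cylinder t w)) \<partial>count_space {w \<in> UNIV. length w = k})"
        unfolding a1_eq by (rule nn_integral_cmult[symmetric]) auto
      also have "\<dots> \<le> (\<integral>\<^sup>+w. emeasure \<rho>1 (?Y \<inter> cylinder t w) \<partial>count_space {w \<in> UNIV. length w = k})"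
      proof (rule nn_integral_mono)
        fix w assume "w \<in> space (count_space {w \<in> UNIV :: 's list set. length w = k})"
        then have w: "length w = k" by simp
        have "ennreal c * emeasure \<mu> X * (ennreal (\<phi> w) * emeasure \<mu> (cylinder t w))
          = ennreal (\<phi> w) * (ennreal (c * measure \<mu> (cylinder t w)) * emeasure \<mu> X)"
          using c_pos by (simp add: emeasure_eq_measure ennreal_mult mult_ac)
        also have "\<dots> \<le> ennreal (\<phi> w) * emeasure \<mu> (cylinder t w \<inter> ?Y)"
          using lower_set[OF X, of w] unfolding w m_def by (intro mult_left_mono) auto
        also have "\<dots> = emeasure \<rho>1 (?Y \<inter> cylinder t w)"
          using cyl1[OF Y w] by (simp add: Int_commute)
        finally show "ennreal c * emeasure \<mu> X * (ennreal (\<phi> w) * emeasure \<mu> (cylinder t w)) \<le> emeasure \<rho>1 (?Y \<inter> cylinder t w)" .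
      qed
      also have "\<dots> = emeasure \<rho>1 (?Y \<inter> word_set t k UNIV)"
        using Y by (intro emeasure_word_decomp[symmetric]) (auto simp: s1)
      also have "\<dots> = emeasure \<rho>2 X" using e2[OF X] full[OF Y] by simp
      finally show ?thesis .
    qed
    \<comment> \<open>What is left after removing the part proportional to \<mu>. Its mass is
      \<open>(1 - c) * a1\<close>, and the assumed bound with factor \<open>r\<close> is applied to
      it.\<close>
    define \<rho>3 where "\<rho>3 = diff_measure \<rho>2 \<rho>0"
    have e3: "emeasure \<rho>3 X = emeasure \<rho>2 X - emeasure \<rho>0 X" if "X \<in> sets (markov_borel t)" for X
      unfolding \<rho>3_def using that le \<rho>2.finite_measure_axioms \<rho>0.finite_measure_axioms
      by (intro emeasure_diff_measure) (auto simp: s0 s2)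
    have s3: "sets \<rho>3 = sets (markov_borel t)" "space \<rho>3 = markov_shift t" by (auto simp: \<rho>3_def s2)
    have m3: "measure \<rho>3 X = measure \<rho>2 X - c * a1 * measure \<mu> X" if X: "X \<in> sets (markov_borel t)" for X
    proof -
      have 0: "0 \<le> c * a1 * measure \<mu> X" using a1 c_pos by simp
      have "ennreal (c * a1 * measure \<mu> X) \<le> ennreal (measure \<rho>2 X)"
        using le[OF X] unfolding e0 \<rho>2.emeasure_eq_measure .
      then have "c * a1 * measure \<mu> X \<le> measure \<rho>2 X" by simp
      moreover have "emeasure \<rho>3 X = ennreal (measure \<rho>2 X - c * a1 * measure \<mu> X)"
        unfolding e3[OF X] e0 \<rho>2.emeasure_eq_measure by (rule ennreal_minus[OF 0])
      ultimately show ?thesis by (simp add: measure_def)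
    qed
    have fin3: "finite_measure \<rho>3" by (rule finite_measureI) (simp add: s3 e3 \<rho>2.emeasure_eq_measure)
    have ac3: "absolutely_continuous \<mu> \<rho>3"
      unfolding absolutely_continuous_def
    proof
      fix X assume "X \<in> null_sets \<mu>"
      then have X: "X \<in> sets (markov_borel t)" "emeasure \<mu> X = 0" by (auto simp: null_sets_def)
      let ?Y = "(shift_map ^^ m) -` X \<inter> markov_shift t"
      have Y: "?Y \<in> sets (markov_borel t)" "emeasure \<mu> ?Y = 0" using X by (auto simp: emeasure_preimage)
      then have "emeasure \<rho>1 ?Y = 0"
        unfolding \<rho>1_def using absolutely_continuousI_density[of "\<lambda>x. ennreal (\<phi> (init_word k x))" \<mu>]
        by (auto simp: absolutely_continuous_def null_sets_def)
      then have "emeasure \<rho>3 X = 0" using e3[OF X(1)] e2[OF X(1)] by simp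
      then show "X \<in> null_sets \<rho>3" using X s3 by (auto simp: null_sets_def)
    qed
    obtain n0 where n0: "\<And>n B. n0 \<le> n \<Longrightarrow> B \<in> sets (markov_borel t) \<Longrightarrow>
        \<bar>measure \<rho>3 ((shift_map ^^ n) -` B \<inter> markov_shift t) - measure \<rho>3 (markov_shift t) * measure \<mu> B\<bar>
          \<le> r * measure \<rho>3 (markov_shift t)"
      using r(1) fin3 s3(1) ac3 unfolding contracts_def by blast
    have m3S: "measure \<rho>3 (markov_shift t) = (1 - c) * a1"
    proof -
      have "(shift_map ^^ m) -` markov_shift t \<inter> markov_shift t = markov_shift t"
        using shift_map_funpow_markov by auto
      then have "measure \<rho>2 (markov_shift t) = a1" by (simp add: m2 a1_def)
      then show ?thesis using prob_space by (simp add: m3 algebra_simps)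
    qed
    show ?thesis
    proof (intro exI allI impI ballI)
      fix n B assume n: "n0 + m \<le> n" and B: "B \<in> sets (markov_borel t)"
      define n' where "n' = n - m"
      have n': "n = n' + m" "n0 \<le> n'" using n by (auto simp: n'_def)
      let ?X = "(shift_map ^^ n) -` B \<inter> markov_shift t" and ?Y = "(shift_map ^^ n') -` B \<inter> markov_shift t"
      have X: "?X \<in> sets (markov_borel t)" and Y: "?Y \<in> sets (markov_borel t)" using B by auto
      have "(shift_map ^^ m) -` ?Y \<inter> markov_shift t = ?X"
        unfolding n' funpow_add using shift_map_funpow_markov by auto
      \<comment> \<open>By invariance of \<mu> the removed part contributes exactly
        \<open>c * a1 * measure \<mu> B\<close> at every later time, so it cancels in the
        comparison.\<close>
      then have "measure \<rho>1 ?X = measure \<rho>3 ?Y + c * a1 * measure \<mu> B"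
        using m3[OF Y] m2[OF Y] by (simp add: measure_preimage B)
      then have 1: "\<bar>measure \<rho>1 ?X - a1 * measure \<mu> B\<bar> \<le> r * ((1 - c) * a1)"
        using n0[OF n'(2) B] unfolding m3S by (simp add: algebra_simps)
      have 2: "\<bar>a1 * measure \<mu> B - a * measure \<mu> B\<bar> \<le> \<eta>"
      proof -
        have "\<bar>a1 * measure \<mu> B - a * measure \<mu> B\<bar> = \<bar>a - a1\<bar> * measure \<mu> B"
          by (simp add: left_diff_distrib[symmetric] abs_mult abs_minus_commute)
        also have "\<dots> \<le> \<eta> * 1" using close[OF topS] \<eta> unfolding a_def a1_def by (intro mult_mono prob_le_1) auto
        finally show ?thesis by simp
      qed
      have "a1 \<le> a + \<eta>" using close[OF topS] unfolding a_def a1_def by linarith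
      then have "r * ((1 - c) * a1) \<le> r * ((1 - c) * (a + \<eta>))"
        using r c_le_1 by (intro mult_left_mono) auto
      also have "\<dots> = (1 - c) * r * a + r * (1 - c) * \<eta>" by (simp add: algebra_simps)
      also have "r * (1 - c) * \<eta> \<le> 1 * \<eta>"
        using r c_le_1 c_pos \<eta> by (intro mult_right_mono mult_le_one) auto
      finally have "\<bar>measure \<rho> ?X - a * measure \<mu> B\<bar> \<le> (1 - c) * r * a + 3 * \<eta>"
        using 1 2 close[OF X] by linarith
      also have "\<dots> = ((1 - c) * r + \<delta>) * a" by (simp add: \<eta>_def algebra_simps)
      finally show "\<bar>measure \<rho> ?X - measure \<rho> (markov_shift t) * measure \<mu> B\<bar> \<le> ((1 - c) * r + \<delta>) * measure \<rho> (markov_shift t)"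
        unfolding a_def .
    qed
  qed
qed

text \<open>Each step improves the bound by the factor \<open>1 - c\<close>; half of the gain is
  spent on the approximation error \<open>c / 2 * r\<close>.\<close>

lemma contracts_power: "contracts ((1 - c / 2) ^ k)"
proof (induction k)
  case 0 show ?case using contracts_1 by simp
next
  case (Suc k)
  define r where "r = (1 - c/2) ^ k"
  have r: "0 < r" "r \<le> 1" using c_pos c_le_1 by (auto simp: r_def intro!: power_le_one)
  have "contracts ((1 - c) * r + c / 2 * r)"
    using Suc r c_pos by (intro contracts_step) (auto simp: r_def)
  also have "(1 - c) * r + c / 2 * r = (1 - c/2) ^ Suc k" by (simp add: r_def algebra_simps)
  finally show ?case .
qed

lemma absolutely_continuous_limit:
  assumes "finite_measure \<rho>" "sets \<rho> = sets (markov_borel t)" "absolutely_continuous \<mu> \<rho>" "B \<in> sets (markov_borel t)"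
  shows "(\<lambda>n. measure \<rho> ((shift_map ^^ n) -` B \<inter> markov_shift t)) \<longlonglongrightarrow> measure \<rho> (markov_shift t) * measure \<mu> B"
proof (rule LIMSEQ_I)
  fix e :: real assume e: "0 < e"
  define a where "a = measure \<rho> (markov_shift t)"
  have "(\<lambda>k. (1 - c/2) ^ k * a) \<longlonglongrightarrow> 0 * a" 
    using c_pos c_le_1 by (intro tendsto_mult tendsto_const LIMSEQ_power_zero) auto
  then obtain k where k: "(1 - c/2) ^ k * a < e"
    using order_tendstoD(2)[of "\<lambda>k. (1 - c/2) ^ k * a" 0 sequentially e] e by (auto simp: eventually_sequentially)
  obtain n0 where "\<And>n. n0 \<le> n \<Longrightarrow> \<bar>measure \<rho> ((shift_map ^^ n) -` B \<inter> markov_shift t) - a * measure \<mu> B\<bar> \<le> (1 - c/2) ^ k * a"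
    using contracts_power[of k] assms unfolding contracts_def a_def by blast
  then show "\<exists>no. \<forall>n\<ge>no. norm (measure \<rho> ((shift_map ^^ n) -` B \<inter> markov_shift t) - measure \<rho> (markov_shift t) * measure \<mu> B) < e"
    using k unfolding a_def[symmetric] real_norm_def by (meson le_less_trans)
qed

lemma mixing: "mixing_map \<mu> shift_map"
  unfolding mixing_map_def
proof (intro conjI ballI)
  show "measure_preserving_map \<mu> shift_map" using inv by (simp add: invariant_measures_def)
  fix A B assume A: "A \<in> sets \<mu>" and B: "B \<in> sets \<mu>"
  \<comment> \<open>For \<mu> restricted to \<open>A\<close>, convergence of the iterated images is
    the mixing statement.\<close>
  define \<rho> where "\<rho> = density \<mu> (indicator A)"
  have e\<rho>: "emeasure \<rho> X = emeasure \<mu> (A \<inter> X)" if "X \<in> sets (markov_borel t)" for X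
    unfolding \<rho>_def using that A by (subst emeasure_restricted) auto
  then have \<rho>: "measure \<rho> X = measure \<mu> (A \<inter> X)" if "X \<in> sets (markov_borel t)" for X
    using that by (simp add: measure_def)
  have "space \<rho> \<in> sets (markov_borel t)" using sets.top[of "markov_borel t"] by (simp add: \<rho>_def)
  then have "finite_measure \<rho>"
    by (intro finite_measureI) (simp add: e\<rho> emeasure_eq_measure)
  moreover have "absolutely_continuous \<mu> \<rho>" unfolding \<rho>_def using A by (intro absolutely_continuousI_density) auto
  ultimately have "(\<lambda>n. measure \<rho> ((shift_map ^^ n) -` B \<inter> markov_shift t)) \<longlonglongrightarrow> measure \<rho> (markov_shift t) * measure \<mu> B"
    using B by (intro absolutely_continuous_limit) (auto simp: \<rho>_def)
  moreover have "measure \<rho> (markov_shift t) = measure \<mu> A"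
    using sets.top[of "markov_borel t"] sets.sets_into_space[OF A] by (simp add: \<rho> Int_absorb2)
  ultimately show "(\<lambda>n. measure \<mu> (A \<inter> ((shift_map ^^ n) -` B \<inter> space \<mu>))) \<longlonglongrightarrow> measure \<mu> A * measure \<mu> B"
    using B by (simp add: \<rho>)
qed

lemma absolutely_continuous_unique:
  assumes "\<nu> \<in> invariant_measures t" "absolutely_continuous \<mu> \<nu>"
  shows "\<nu> = \<mu>"
proof (rule measure_eqI)
  interpret \<nu>: shift_measure t \<nu> using assms by unfold_locales
  show "sets \<nu> = sets \<mu>" by simp
  fix B assume "B \<in> sets \<nu>"
  then have B: "B \<in> sets (markov_borel t)" by simp
  \<comment> \<open>Invariance of \<nu> makes this sequence constant, so its value is the
    limit.\<close>
  have "(\<lambda>n. measure \<nu> ((shift_map ^^ n) -` B \<inter> markov_shift t)) \<longlonglongrightarrow> measure \<nu> (markov_shift t) * measure \<mu> B"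
    using assms(2) B \<nu>.finite_measure_axioms by (intro absolutely_continuous_limit) auto
  then have "measure \<nu> B = measure \<mu> B"
    using \<nu>.prob_space by (simp add: \<nu>.measure_preimage[OF B] LIMSEQ_const_iff)
  then show "emeasure \<nu> B = emeasure \<mu> B" by (simp add: emeasure_eq_measure \<nu>.emeasure_eq_measure)
qed

end

section \<open>Entropy of countable random variables\<close>

lemma measurable_pair_countable:
  fixes X :: "'a \<Rightarrow> 'c::countable" and Y :: "'a \<Rightarrow> 'd::countable"
  assumes "X \<in> measurable M (count_space UNIV)" "Y \<in> measurable M (count_space UNIV)"
  shows "(\<lambda>x. (X x, Y x)) \<in> measurable M (count_space UNIV)"
  using measurable_Pair[OF assms] by (simp add: pair_measure_countable)

context prob_space
begin

definition fiber_prob :: "('a \<Rightarrow> 'c) \<Rightarrow> 'c \<Rightarrow> real" where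
  "fiber_prob X v = prob {y \<in> space M. X y = v}"

text \<open>
  Since \<open>ln 0 = 0\<close> in HOL, the information is \<open>0\<close> on null fibres.
\<close>

definition info :: "('a \<Rightarrow> 'c) \<Rightarrow> 'a \<Rightarrow> real" where
  "info X x = - ln (fiber_prob X (X x))"

lemma fiber_prob_nonneg: "0 \<le> fiber_prob X v"
  by (simp add: fiber_prob_def)

lemma fiber_prob_le_1: "fiber_prob X v \<le> 1"
  by (simp add: fiber_prob_def)

lemma info_nonneg: "0 \<le> info X x"
  using fiber_prob_nonneg[of X "X x"] fiber_prob_le_1[of X "X x"]
  by (cases "fiber_prob X (X x) = 0") (auto simp: info_def)

lemma fiber_sets [measurable]:
  "X \<in> measurable M (count_space UNIV) \<Longrightarrow> {y \<in> space M. X y = v} \<in> events"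
  using measurable_sets[of X M "count_space UNIV" "{v}"] by (simp add: vimage_def Int_def conj_commute)

lemma countable_rv_function_measurable:
  fixes X :: "'a \<Rightarrow> 'c::countable"
  shows "X \<in> measurable M (count_space UNIV) \<Longrightarrow> (\<lambda>x. \<phi> (X x) :: real) \<in> borel_measurable M"
  by (rule measurable_compose[of X M "count_space UNIV"]) auto

lemma info_measurable [measurable]:
  fixes X :: "'a \<Rightarrow> 'c::countable"
  shows "X \<in> measurable M (count_space UNIV) \<Longrightarrow> info X \<in> borel_measurable M"
  unfolding info_def by (rule countable_rv_function_measurable)

lemma nn_integral_countable_rv:
  fixes X :: "'a \<Rightarrow> 'c::countable"
  assumes X [measurable]: "X \<in> measurable M (count_space UNIV)"
  shows "(\<integral>\<^sup>+x. \<phi> (X x) \<partial>M) = (\<integral>\<^sup>+v. \<phi> v * ennreal (fiber_prob X v) \<partial>count_space UNIV)"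
proof -
  have "(\<integral>\<^sup>+x. \<phi> (X x) \<partial>M) = (\<integral>\<^sup>+x. (\<integral>\<^sup>+v. \<phi> v * indicator {y \<in> space M. X y = v} x \<partial>count_space UNIV) \<partial>M)"
  proof (rule nn_integral_cong)
    fix x assume "x \<in> space M"
    then have "(\<integral>\<^sup>+v. \<phi> v * indicator {y \<in> space M. X y = v} x \<partial>count_space UNIV)
       = (\<integral>\<^sup>+v. \<phi> (X x) * indicator {X x} v \<partial>count_space UNIV)"
      by (intro nn_integral_cong) (auto simp: indicator_def)
    also have "\<dots> = \<phi> (X x)" by (subst nn_integral_cmult_indicator) auto
    finally show "\<phi> (X x) = (\<integral>\<^sup>+v. \<phi> v * indicator {y \<in> space M. X y = v} x \<partial>count_space UNIV)" ..
  qed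
  also have "\<dots> = (\<integral>\<^sup>+v. (\<integral>\<^sup>+x. \<phi> v * indicator {y \<in> space M. X y = v} x \<partial>M) \<partial>count_space UNIV)"
    by (rule nn_integral_count_space_nn_integral) auto
  also have "\<dots> = (\<integral>\<^sup>+v. \<phi> v * ennreal (fiber_prob X v) \<partial>count_space UNIV)"
    by (intro nn_integral_cong) (simp add: nn_integral_cmult_indicator fiber_prob_def emeasure_eq_measure)
  finally show ?thesis .
qed

lemma sum_fiber_prob:
  fixes X :: "'a \<Rightarrow> 'c::countable"
  assumes "X \<in> measurable M (count_space UNIV)"
  shows "(\<integral>\<^sup>+v. ennreal (fiber_prob X v) \<partial>count_space UNIV) = 1"
  using nn_integral_countable_rv[OF assms, of "\<lambda>_. 1"] by (simp add: emeasure_space_1)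

lemma AE_fiber_prob_pos:
  fixes X :: "'a \<Rightarrow> 'c::countable"
  assumes X [measurable]: "X \<in> measurable M (count_space UNIV)"
  shows "AE x in M. 0 < fiber_prob X (X x)"
proof -
  have "(\<integral>\<^sup>+x. indicator {v. fiber_prob X v = 0} (X x) \<partial>M) = (\<integral>\<^sup>+v. 0 \<partial>(count_space UNIV :: 'c measure))"
    unfolding nn_integral_countable_rv[OF X] by (intro nn_integral_cong) (auto simp: indicator_def)
  then have "AE x in M. indicator {v. fiber_prob X v = 0} (X x) = (0::ennreal)"
    using nn_integral_0_iff_AE[of "\<lambda>x. indicator {v. fiber_prob X v = 0} (X x)" M] measurable_compose[OF X, of "indicator {v. fiber_prob X v = 0}" borel]
    by simp
  then show ?thesis
    by eventually_elim (use fiber_prob_nonneg in \<open>auto simp: indicator_def less_le split: if_splits\<close>)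
qed

text \<open>Pointwise \<open>ln r \<le> r - 1\<close> for the ratio \<open>r\<close> of reference
  weight to true probability, whose integral is at most 1. Information is nonnegative, so the same
  pointwise bound yields its integrability: finite entropy is a conclusion.\<close>

lemma gibbs_inequality:
  fixes X :: "'a \<Rightarrow> 'c::countable"
  assumes X [measurable]: "X \<in> measurable M (count_space UNIV)"
    and q: "\<And>v. 0 \<le> q v" "(\<integral>\<^sup>+v. ennreal (q v) \<partial>count_space UNIV) \<le> 1"
    and pos: "AE x in M. 0 < q (X x)" and int: "integrable M (\<lambda>x. - ln (q (X x)))"
  shows "integrable M (info X)" "expectation (info X) \<le> expectation (\<lambda>x. - ln (q (X x)))"
proof -
  define r where "r v = q v / fiber_prob X v" for v
  have r_nn: "0 \<le> r v" for v using q fiber_prob_nonneg by (auto simp: r_def intro!: divide_nonneg_nonneg)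
  have "(\<integral>\<^sup>+x. ennreal (r (X x)) \<partial>M) = (\<integral>\<^sup>+v. ennreal (r v) * ennreal (fiber_prob X v) \<partial>count_space UNIV)"
    by (rule nn_integral_countable_rv[OF X])
  also have "\<dots> \<le> (\<integral>\<^sup>+v. ennreal (q v) \<partial>count_space UNIV)"
  proof (rule nn_integral_mono)
    fix v
    \<comment> \<open>On a null fibre division by zero makes \<open>r v = 0\<close>; equality may
      fail there, the inequality does not.\<close>
    have "r v * fiber_prob X v \<le> q v" using q(1)[of v] by (cases "fiber_prob X v = 0") (auto simp: r_def)
    then show "ennreal (r v) * ennreal (fiber_prob X v) \<le> ennreal (q v)"
      by (subst ennreal_mult[symmetric]) (auto simp: r_nn fiber_prob_nonneg intro: ennreal_leI)
  qed
  finally have r1: "(\<integral>\<^sup>+x. ennreal (r (X x)) \<partial>M) \<le> 1" using q(2) by simp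
  have r_meas: "(\<lambda>x. r (X x)) \<in> borel_measurable M" by (rule countable_rv_function_measurable[OF X])
  have r_int: "integrable M (\<lambda>x. r (X x))"
    using r1 r_meas r_nn by (intro integrableI_nonneg) (auto simp: le_less_trans)
  have "ennreal (expectation (\<lambda>x. r (X x))) \<le> 1"
    using nn_integral_eq_integral[OF r_int] r_nn r1 by simp
  then have r_le: "expectation (\<lambda>x. r (X x)) \<le> 1" by (simp add: r_nn)
  have le: "AE x in M. info X x \<le> - ln (q (X x)) + (r (X x) - 1)"
    using pos AE_fiber_prob_pos[OF X]
  proof eventually_elim
    fix x assume *: "0 < q (X x)" "0 < fiber_prob X (X x)"
    have "ln (r (X x)) \<le> r (X x) - 1" using * by (intro ln_le_minus_one) (simp add: r_def)
    then show "info X x \<le> - ln (q (X x)) + (r (X x) - 1)" using * by (simp add: info_def r_def ln_div)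
  qed
  have int2: "integrable M (\<lambda>x. - ln (q (X x)) + (r (X x) - 1))"
    using int r_int by (intro Bochner_Integration.integrable_add Bochner_Integration.integrable_diff) auto
  show I: "integrable M (info X)"
  proof (rule Bochner_Integration.integrable_bound[OF int2])
    show "AE x in M. norm (info X x) \<le> norm (- ln (q (X x)) + (r (X x) - 1))"
      using le
    proof eventually_elim
      fix x assume "info X x \<le> - ln (q (X x)) + (r (X x) - 1)"
      then show "norm (info X x) \<le> norm (- ln (q (X x)) + (r (X x) - 1))"
        using info_nonneg[of X x] unfolding real_norm_def by linarith
    qed
  qed simp
  have "expectation (info X) \<le> expectation (\<lambda>x. - ln (q (X x)) + (r (X x) - 1))"
    using I int2 le by (rule integral_mono_AE)
  also have "\<dots> = expectation (\<lambda>x. - ln (q (X x))) + (expectation (\<lambda>x. r (X x)) - 1)"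
    using int r_int by (subst Bochner_Integration.integral_add) (auto simp: prob_space)
  finally show "expectation (info X) \<le> expectation (\<lambda>x. - ln (q (X x)))" using r_le by simp
qed

text \<open>A coarser variable has larger fibres, hence less information. The comparison is almost
  everywhere, since the value 0 assigned to null fibres breaks it there.\<close>

lemma info_coarser:
  fixes X :: "'a \<Rightarrow> 'c::countable" and Y :: "'a \<Rightarrow> 'd::countable"
  assumes X [measurable]: "X \<in> measurable M (count_space UNIV)" and Y [measurable]: "Y \<in> measurable M (count_space UNIV)"
    and h: "\<And>x. x \<in> space M \<Longrightarrow> X x = h (Y x)"
  shows "AE x in M. info X x \<le> info Y x"
    and "integrable M (info Y) \<Longrightarrow> integrable M (info X)"
    and "integrable M (info Y) \<Longrightarrow> expectation (info X) \<le> expectation (info Y)"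
proof -
  show le: "AE x in M. info X x \<le> info Y x"
    using AE_fiber_prob_pos[OF Y] AE_space
  proof eventually_elim
    fix x assume *: "0 < fiber_prob Y (Y x)" "x \<in> space M"
    have "fiber_prob Y (Y x) \<le> fiber_prob X (X x)"
      unfolding fiber_prob_def using h *(2) by (intro finite_measure_mono) auto
    then show "info X x \<le> info Y x" using * by (simp add: info_def)
  qed
  assume Y: "integrable M (info Y)"
  show I: "integrable M (info X)"
  proof (rule Bochner_Integration.integrable_bound[OF Y])
    show "AE x in M. norm (info X x) \<le> norm (info Y x)"
      using le
    proof eventually_elim
      fix x assume "info X x \<le> info Y x"
      then show "norm (info X x) \<le> norm (info Y x)"
        using info_nonneg[of X x] unfolding real_norm_def by linarith
    qed
  qed simp
  show "expectation (info X) \<le> expectation (info Y)"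
    using I Y le by (rule integral_mono_AE)
qed

text \<open>Gibbs' inequality with the product of the two laws as reference weight.\<close>

lemma info_pair_subadditive:
  fixes X :: "'a \<Rightarrow> 'c::countable" and Y :: "'a \<Rightarrow> 'd::countable"
  assumes X [measurable]: "X \<in> measurable M (count_space UNIV)" and Y [measurable]: "Y \<in> measurable M (count_space UNIV)"
    and int: "integrable M (info X)" "integrable M (info Y)"
  shows "integrable M (info (\<lambda>x. (X x, Y x)))"
    and "expectation (info (\<lambda>x. (X x, Y x))) \<le> expectation (info X) + expectation (info Y)"
proof -
  define q where "q = (\<lambda>(u, v). fiber_prob X u * fiber_prob Y v)"
  have pair: "(\<lambda>x. (X x, Y x)) \<in> measurable M (count_space UNIV)"
    by (rule measurable_pair_countable[OF X Y])
  have q_nn: "0 \<le> q v" for v by (auto simp: q_def fiber_prob_nonneg split: prod.splits)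
  have q_sum: "(\<integral>\<^sup>+v. ennreal (q v) \<partial>count_space UNIV) \<le> 1"
  proof -
    have "(\<integral>\<^sup>+v. ennreal (q v) \<partial>count_space UNIV) = (\<integral>\<^sup>+u. (\<integral>\<^sup>+v. ennreal (q (u, v)) \<partial>count_space UNIV) \<partial>count_space UNIV)"
      by (rule nn_integral_fst_count_space[symmetric])
    also have "\<dots> = (\<integral>\<^sup>+u. ennreal (fiber_prob X u) * (\<integral>\<^sup>+v. ennreal (fiber_prob Y v) \<partial>count_space UNIV) \<partial>count_space UNIV)"
      by (subst nn_integral_cmult[symmetric]) (auto simp: q_def ennreal_mult fiber_prob_nonneg)
    finally show ?thesis by (simp add: sum_fiber_prob)
  qed
  have pos: "AE x in M. 0 < q (X x, Y x)"
    using AE_fiber_prob_pos[OF X] AE_fiber_prob_pos[OF Y] by eventually_elim (simp add: q_def)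
  have eq: "AE x in M. - ln (q (X x, Y x)) = info X x + info Y x"
    using AE_fiber_prob_pos[OF X] AE_fiber_prob_pos[OF Y]
    by eventually_elim (simp add: q_def info_def ln_mult)
  have meas: "(\<lambda>x. - ln (q (X x, Y x))) \<in> borel_measurable M"
    using countable_rv_function_measurable[OF pair, of "\<lambda>v. - ln (q v)"] .
  have int2: "integrable M (\<lambda>x. - ln (q (X x, Y x)))"
    using integrable_cong_AE[OF meas _ eq] int by auto
  have "expectation (\<lambda>x. - ln (q (X x, Y x))) = expectation (info X) + expectation (info Y)"
    using integral_cong_AE[OF meas _ eq] int by auto
  then show "integrable M (info (\<lambda>x. (X x, Y x)))"
    "expectation (info (\<lambda>x. (X x, Y x))) \<le> expectation (info X) + expectation (info Y)"
    using gibbs_inequality[OF pair q_nn q_sum pos int2] by auto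
qed

end

lemma word_sum_prod_le_1:
  assumes "\<And>i. (\<integral>\<^sup>+a. ennreal (k i a) \<partial>count_space UNIV) \<le> 1"
  shows "word_sum n (\<lambda>s. \<Prod>i<n. ennreal (k i (s ! i))) \<le> 1"
  using assms
proof (induction n arbitrary: k)
  case (Suc n)
  have "word_sum (Suc n) (\<lambda>s. \<Prod>i<Suc n. ennreal (k i (s ! i)))
     = (\<integral>\<^sup>+a. ennreal (k 0 a) * word_sum n (\<lambda>w. \<Prod>i<n. ennreal (k (Suc i) (w ! i))) \<partial>count_space UNIV)"
    by (simp add: word_sum_Suc prod.lessThan_Suc_shift word_sum_cmult del: prod.lessThan_Suc)
  also have "\<dots> \<le> (\<integral>\<^sup>+a. ennreal (k 0 a) * 1 \<partial>count_space UNIV)"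
    using Suc.prems by (intro nn_integral_mono mult_left_mono Suc.IH) auto
  also have "\<dots> \<le> 1" using Suc.prems[of 0] by simp
  finally show ?case .
qed simp

context prob_space
begin

text \<open>
  Gibbs' inequality for the reference law that draws \<open>Y\<close> from its own distribution and then the
  letters of \<open>S\<close> independently from the sub-probability kernels \<open>k i (Y x)\<close>. It stands in for conditional entropy.
\<close>

lemma info_kernel_bound:
  fixes S :: "'a \<Rightarrow> 'c::countable list" and Y :: "'a \<Rightarrow> 'd::countable"
  assumes S [measurable]: "S \<in> measurable M (count_space UNIV)" and Y [measurable]: "Y \<in> measurable M (count_space UNIV)"
    and len: "\<And>x. length (S x) = n"
    and k_nn: "\<And>i y a. 0 \<le> k i y a" and k_sum: "\<And>i y. (\<integral>\<^sup>+a. ennreal (k i y a) \<partial>count_space UNIV) \<le> 1"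
    and k_pos: "AE x in M. \<forall>i<n. 0 < k i (Y x) (S x ! i)"
    and intY: "integrable M (info Y)"
    and int: "\<And>i. i < n \<Longrightarrow> integrable M (\<lambda>x. - ln (k i (Y x) (S x ! i)))"
  shows "integrable M (info (\<lambda>x. (S x, Y x)))"
    and "expectation (info (\<lambda>x. (S x, Y x))) \<le> expectation (info Y) + (\<Sum>i<n. expectation (\<lambda>x. - ln (k i (Y x) (S x ! i))))"
proof -
  \<comment> \<open>Lists of the wrong length get weight 0, so that the total mass becomes a sum
    over words of length \<open>n\<close>.\<close>
  define q where "q = (\<lambda>(s, y). if length s = n then fiber_prob Y y * (\<Prod>i<n. k i y (s ! i)) else 0)"
  have pair: "(\<lambda>x. (S x, Y x)) \<in> measurable M (count_space UNIV)"
    by (rule measurable_pair_countable[OF S Y])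
  have q_nn: "0 \<le> q v" for v
    by (auto simp: q_def fiber_prob_nonneg k_nn prod_nonneg split: prod.splits)
  have q_sum: "(\<integral>\<^sup>+v. ennreal (q v) \<partial>count_space UNIV) \<le> 1"
  proof -
    have "(\<integral>\<^sup>+v. ennreal (q v) \<partial>count_space UNIV) = (\<integral>\<^sup>+y. (\<integral>\<^sup>+s. ennreal (q (s, y)) \<partial>count_space UNIV) \<partial>count_space UNIV)"
      by (rule nn_integral_snd_count_space[symmetric])
    also have "\<dots> = (\<integral>\<^sup>+y. ennreal (fiber_prob Y y) * word_sum n (\<lambda>s. \<Prod>i<n. ennreal (k i y (s ! i))) \<partial>count_space UNIV)"
      unfolding word_sum_UNIV
      by (subst nn_integral_cmult[symmetric])
        (auto simp: q_def ennreal_mult fiber_prob_nonneg k_nn prod_nonneg prod_ennreal indicator_def intro!: nn_integral_cong)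
    also have "\<dots> \<le> (\<integral>\<^sup>+y. ennreal (fiber_prob Y y) * 1 \<partial>count_space UNIV)"
      by (intro nn_integral_mono mult_left_mono word_sum_prod_le_1 k_sum) auto
    finally show ?thesis by (simp add: sum_fiber_prob)
  qed
  have pos: "AE x in M. 0 < q (S x, Y x)"
    using k_pos AE_fiber_prob_pos[OF Y] by eventually_elim (auto simp: q_def len intro!: mult_pos_pos prod_pos)
  have eq: "AE x in M. - ln (q (S x, Y x)) = info Y x + (\<Sum>i<n. - ln (k i (Y x) (S x ! i)))"
    using k_pos AE_fiber_prob_pos[OF Y]
  proof eventually_elim
    fix x assume *: "\<forall>i<n. 0 < k i (Y x) (S x ! i)" "0 < fiber_prob Y (Y x)"
    define d where "d = (\<Prod>i<n. k i (Y x) (S x ! i))"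
    have "ln d = (\<Sum>i<n. ln (k i (Y x) (S x ! i)))"
      unfolding d_def using * by (intro ln_prod) auto
    moreover have "0 < d" unfolding d_def using * by (intro prod_pos) auto
    moreover have "q (S x, Y x) = fiber_prob Y (Y x) * d" by (simp add: q_def len d_def)
    ultimately show "- ln (q (S x, Y x)) = info Y x + (\<Sum>i<n. - ln (k i (Y x) (S x ! i)))"
      using * by (simp add: info_def ln_mult sum_negf)
  qed
  have meas: "(\<lambda>x. - ln (q (S x, Y x))) \<in> borel_measurable M"
    using countable_rv_function_measurable[OF pair, of "\<lambda>v. - ln (q v)"] .
  have I: "integrable M (\<lambda>x. info Y x + (\<Sum>i<n. - ln (k i (Y x) (S x ! i))))"
    using intY int by (intro Bochner_Integration.integrable_add Bochner_Integration.integrable_sum) auto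
  have int2: "integrable M (\<lambda>x. - ln (q (S x, Y x)))"
    using integrable_cong_AE[OF meas _ eq] I by auto
  have "expectation (\<lambda>x. - ln (q (S x, Y x))) = expectation (\<lambda>x. info Y x + (\<Sum>i<n. - ln (k i (Y x) (S x ! i))))"
    using integral_cong_AE[OF meas _ eq] I by auto
  also have "\<dots> = expectation (info Y) + (\<Sum>i<n. expectation (\<lambda>x. - ln (k i (Y x) (S x ! i))))"
    using intY int by (subst Bochner_Integration.integral_add) (auto simp del: integral_minus intro!: Bochner_Integration.integral_sum)
  finally show "integrable M (info (\<lambda>x. (S x, Y x)))"
    "expectation (info (\<lambda>x. (S x, Y x))) \<le> expectation (info Y) + (\<Sum>i<n. expectation (\<lambda>x. - ln (k i (Y x) (S x ! i))))"
    using gibbs_inequality[OF pair q_nn q_sum pos int2] by auto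
qed

section \<open>Finite partitions as fibres of random variables\<close>

definition fibers :: "('a \<Rightarrow> 'c) \<Rightarrow> 'a set set" where
  "fibers X = (\<lambda>x. {y \<in> space M. X y = X x}) ` space M"

lemma partition_entropy_fibers:
  fixes X :: "'a \<Rightarrow> 'c::countable"
  assumes X [measurable]: "X \<in> measurable M (count_space UNIV)" and fin: "finite (X ` space M)"
  shows "integrable M (info X)" "partition_entropy M (fibers X) = expectation (info X)"
proof -
  have eq: "info X x = (\<Sum>v\<in>X ` space M. - ln (fiber_prob X v) * indicator {y \<in> space M. X y = v} x)" if "x \<in> space M" for x
  proof -
    have "(\<Sum>v\<in>X ` space M. - ln (fiber_prob X v) * indicator {y \<in> space M. X y = v} x)
        = (\<Sum>v\<in>X ` space M. if v = X x then - ln (fiber_prob X v) else 0)"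
      using that by (intro sum.cong) (auto simp: indicator_def)
    then show ?thesis using that fin by (simp add: info_def)
  qed
  have int: "integrable M (\<lambda>x. \<Sum>v\<in>X ` space M. - ln (fiber_prob X v) * indicator {y \<in> space M. X y = v} x)"
    by (intro Bochner_Integration.integrable_sum integrable_mult_right integrable_real_indicator) (auto simp: emeasure_eq_measure)
  show "integrable M (info X)"
    using Bochner_Integration.integrable_cong[where M = M and N = M and f = "info X", OF refl eq] int by blast
  have fib: "fibers X = (\<lambda>v. {y \<in> space M. X y = v}) ` (X ` space M)" by (auto simp: fibers_def)
  have inj: "inj_on (\<lambda>v. {y \<in> space M. X y = v}) (X ` space M)" by (rule inj_onI) blast
  have "expectation (info X) = (\<Sum>v\<in>X ` space M. - ln (fiber_prob X v) * fiber_prob X v)"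
  proof -
    have "expectation (info X) = expectation (\<lambda>x. \<Sum>v\<in>X ` space M. - ln (fiber_prob X v) * indicator {y \<in> space M. X y = v} x)"
      by (rule Bochner_Integration.integral_cong[OF refl eq])
    also have "\<dots> = (\<Sum>v\<in>X ` space M. expectation (\<lambda>x. - ln (fiber_prob X v) * indicator {y \<in> space M. X y = v} x))"
      by (intro Bochner_Integration.integral_sum integrable_mult_right integrable_real_indicator) (auto simp: emeasure_eq_measure)
    also have "\<dots> = (\<Sum>v\<in>X ` space M. - ln (fiber_prob X v) * fiber_prob X v)"
    proof (intro sum.cong refl)
      fix v
      have "{y \<in> space M. X y = v} \<inter> space M = {y \<in> space M. X y = v}" by auto
      then show "expectation (\<lambda>x. - ln (fiber_prob X v) * indicator {y \<in> space M. X y = v} x) = - ln (fiber_prob X v) * fiber_prob X v"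
        by (simp only: Bochner_Integration.integral_mult_right_zero Bochner_Integration.integral_indicator fiber_prob_def)
    qed
    finally show ?thesis .
  qed
  also have "\<dots> = partition_entropy M (fibers X)"
    unfolding partition_entropy_def fib using inj
    by (subst sum.reindex) (auto simp: fiber_prob_def sum_negf mult.commute)
  finally show "partition_entropy M (fibers X) = expectation (info X)" ..
qed

lemma fibers_partition:
  fixes X :: "'a \<Rightarrow> 'c::countable"
  assumes X [measurable]: "X \<in> measurable M (count_space UNIV)" and fin: "finite (X ` space M)"
  shows "finite (fibers X)" "partition_on (space M) (fibers X)" "fibers X \<subseteq> events"
proof -
  have "fibers X = (\<lambda>v. {y \<in> space M. X y = v}) ` (X ` space M)" by (auto simp: fibers_def)
  then show "finite (fibers X)" using fin by simp
  show "partition_on (space M) (fibers X)" unfolding partition_on_def fibers_def disjoint_def by auto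
  show "fibers X \<subseteq> events" by (auto simp: fibers_def)
qed

text \<open>Numbering the cells turns a finite partition into a variable, so that partition
  entropies become expectations of information functions.\<close>

lemma partition_as_fibers:
  assumes "finite Q" "partition_on (space M) Q" "Q \<subseteq> events"
  shows "\<exists>X :: 'a \<Rightarrow> nat. X \<in> measurable M (count_space UNIV) \<and> finite (X ` space M) \<and> fibers X = Q"
proof -
  obtain f :: "'a set \<Rightarrow> nat" where f: "inj_on f Q" using finite_imp_inj_to_nat_seg[OF assms(1)] by blast
  have uniq: "\<exists>!A. A \<in> Q \<and> x \<in> A" if "x \<in> space M" for x
    using assms(2) that unfolding partition_on_def disjoint_def by auto
  define cell where "cell x = (THE A. A \<in> Q \<and> x \<in> A)" for x
  have cell: "cell x \<in> Q" "x \<in> cell x" if "x \<in> space M" for x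
    using theI'[OF uniq[OF that]] by (auto simp: cell_def)
  have cell_eq: "cell x = A" if "A \<in> Q" "x \<in> A" for x A
  proof -
    have "x \<in> space M" using assms(2) that by (auto simp: partition_on_def)
    then show ?thesis using uniq[of x] cell[of x] that by blast
  qed
  define X where "X x = f (cell x)" for x
  have fib: "{y \<in> space M. X y = X x} = cell x" if x: "x \<in> space M" for x
  proof -
    have "cell x \<subseteq> space M" using cell[OF x] assms(3) sets.sets_into_space by blast
    moreover have "X y = X x \<longleftrightarrow> cell y = cell x" if "y \<in> space M" for y
      using f cell[OF that] cell[OF x] by (auto simp: X_def inj_on_def)
    moreover have "cell y = cell x \<longleftrightarrow> y \<in> cell x" if "y \<in> space M" for y
      using cell(2)[OF that] cell_eq[OF cell(1)[OF x], of y] by auto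
    ultimately show ?thesis by blast
  qed
  have fin: "finite (X ` space M)"
  proof -
    have "X ` space M \<subseteq> f ` Q" using cell by (auto simp: X_def)
    then show ?thesis using assms(1) finite_subset by blast
  qed
  have meas: "X \<in> measurable M (count_space UNIV)"
  proof (subst measurable_count_space_eq2_countable)
    show "X \<in> space M \<rightarrow> UNIV \<and> (\<forall>v\<in>UNIV. X -` {v} \<inter> space M \<in> events)"
    proof (intro conjI ballI)
      fix v
      show "X -` {v} \<inter> space M \<in> events"
      proof (cases "v \<in> X ` space M")
        case True
        then obtain x where x: "x \<in> space M" "v = X x" by auto
        then have "X -` {v} \<inter> space M = cell x" using fib[OF x(1)] by auto
        then show ?thesis using cell[OF x(1)] assms(3) by auto
      next
        case False
        then have "X -` {v} \<inter> space M = {}" by auto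
        then show ?thesis by simp
      qed
    qed auto
  qed
  have "fibers X = Q"
  proof -
    have "fibers X = cell ` space M" unfolding fibers_def by (intro image_cong refl fib)
    also have "\<dots> = Q"
    proof
      show "cell ` space M \<subseteq> Q" using cell by auto
      show "Q \<subseteq> cell ` space M"
      proof
        fix A assume A: "A \<in> Q"
        then have "A \<noteq> {}" using assms(2) by (auto simp: partition_on_def)
        then obtain x where "x \<in> A" by auto
        moreover have "x \<in> space M" using A \<open>x \<in> A\<close> assms(2) by (auto simp: partition_on_def)
        ultimately show "A \<in> cell ` space M" using cell_eq[OF A] by auto
      qed
    qed
    finally show ?thesis .
  qed
  with meas fin show ?thesis by blast
qed

end

section \<open>Entropy of itineraries and the generating partition\<close>

context measure_preserving
begin

lemma funpow_space: "x \<in> space M \<Longrightarrow> (T ^^ n) x \<in> space M"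
  using funpow_measurable by (rule measurable_space)

lemma expectation_funpow:
  fixes \<phi> :: "'a \<Rightarrow> real"
  assumes "integrable M \<phi>"
  shows "integrable M (\<lambda>x. \<phi> ((T ^^ n) x))" "expectation (\<lambda>x. \<phi> ((T ^^ n) x)) = expectation \<phi>"
  using integrable_distr_eq[OF funpow_measurable, of \<phi> n] integral_distr[OF funpow_measurable, of \<phi> n] assms
  by (auto simp: distr_funpow)

lemma prob_funpow: "B \<in> events \<Longrightarrow> prob ((T ^^ n) -` B \<inter> space M) = prob B"
  using measure_distr[OF funpow_measurable, of B n] by (simp add: distr_funpow)

lemma info_funpow:
  fixes X :: "'a \<Rightarrow> 'c::countable"
  assumes X: "X \<in> measurable M (count_space UNIV)"
  shows "info (\<lambda>x. X ((T ^^ n) x)) x = info X ((T ^^ n) x)"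
proof -
  have "(T ^^ n) -` {y \<in> space M. X y = v} \<inter> space M = {y \<in> space M. X ((T ^^ n) y) = v}" for v
    using funpow_space by auto
  then have "fiber_prob (\<lambda>x. X ((T ^^ n) x)) v = fiber_prob X v" for v
    using prob_funpow[OF fiber_sets[OF X], of n v] by (simp add: fiber_prob_def)
  then show ?thesis by (simp add: info_def)
qed

definition itinerary :: "('a \<Rightarrow> 'c) \<Rightarrow> nat \<Rightarrow> 'a \<Rightarrow> 'c list" where
  "itinerary X n x = map (\<lambda>i. X ((T ^^ i) x)) [0..<n]"

lemma length_itinerary [simp]: "length (itinerary X n x) = n"
  by (simp add: itinerary_def)

lemma nth_itinerary [simp]: "i < n \<Longrightarrow> itinerary X n x ! i = X ((T ^^ i) x)"
  by (simp add: itinerary_def)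

lemma itinerary_eq_iff: "itinerary X n x = itinerary X n y \<longleftrightarrow> (\<forall>i<n. X ((T ^^ i) x) = X ((T ^^ i) y))"
  by (auto simp: itinerary_def)

lemma itinerary_add: "itinerary X (n + m) x = itinerary X n x @ itinerary X m ((T ^^ n) x)"
proof (rule nth_equalityI)
  fix i assume "i < length (itinerary X (n + m) x)"
  moreover have "(T ^^ i) x = (T ^^ (i - n)) ((T ^^ n) x)" if "n \<le> i"
    using that funpow_add[of "i - n" n T] by simp
  ultimately show "itinerary X (n + m) x ! i = (itinerary X n x @ itinerary X m ((T ^^ n) x)) ! i"
    by (auto simp: nth_append)
qed simp

lemma itinerary_measurable [measurable]:
  fixes X :: "'a \<Rightarrow> 'c::countable"
  assumes X: "X \<in> measurable M (count_space UNIV)"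
  shows "itinerary X n \<in> measurable M (count_space UNIV)"
proof (induction n)
  case 0
  have "itinerary X 0 = (\<lambda>_. [])" by (simp add: itinerary_def fun_eq_iff)
  then show ?case by simp
next
  case (Suc n)
  have "(\<lambda>x. X ((T ^^ n) x)) \<in> measurable M (count_space UNIV)"
    using measurable_compose[OF funpow_measurable X] .
  from measurable_compose[OF measurable_pair_countable[OF Suc this], of "\<lambda>(u, a). u @ [a]" "count_space UNIV"]
  have "(\<lambda>x. itinerary X n x @ [X ((T ^^ n) x)]) \<in> measurable M (count_space UNIV)" by simp
  moreover have "itinerary X (Suc n) = (\<lambda>x. itinerary X n x @ [X ((T ^^ n) x)])"
    by (simp add: itinerary_def fun_eq_iff)
  ultimately show ?case by simp
qed

definition block_entropy :: "('a \<Rightarrow> 'c) \<Rightarrow> nat \<Rightarrow> real" where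
  "block_entropy X n = expectation (info (itinerary X n))"

definition entropy_rate :: "('a \<Rightarrow> 'c) \<Rightarrow> real" where
  "entropy_rate X = lim (\<lambda>n. block_entropy X n / real n)"

lemma block_entropy_nonneg: "0 \<le> block_entropy X n"
  unfolding block_entropy_def by (intro Bochner_Integration.integral_nonneg info_nonneg)

text \<open>The long itinerary is a function of two shorter ones, the second seen after
  \<open>n\<close> steps; by invariance this second one carries the same block entropy as at time
  0.\<close>

lemma itinerary_subadditive:
  fixes X :: "'a \<Rightarrow> 'c::countable"
  assumes X: "X \<in> measurable M (count_space UNIV)"
    and n: "integrable M (info (itinerary X n))" and m: "integrable M (info (itinerary X m))"
  shows "integrable M (info (itinerary X (n + m)))"
    and "block_entropy X (n + m) \<le> block_entropy X n + block_entropy X m"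
proof -
  define Y where "Y x = itinerary X m ((T ^^ n) x)" for x
  have Y: "Y \<in> measurable M (count_space UNIV)"
    unfolding Y_def using measurable_compose[OF funpow_measurable itinerary_measurable[OF X]] .
  have iY: "info Y x = info (itinerary X m) ((T ^^ n) x)" for x
    using info_funpow[OF itinerary_measurable[OF X], of m n x] by (simp add: Y_def[abs_def])
  have intY: "integrable M (info Y)" "expectation (info Y) = block_entropy X m"
    using expectation_funpow[OF m, of n] by (simp_all add: block_entropy_def iY[THEN ext])
  have coarse: "itinerary X (n + m) x = (\<lambda>(u, v). u @ v) (itinerary X n x, Y x)" for x
    by (simp add: Y_def itinerary_add)
  note pair = info_pair_subadditive[OF itinerary_measurable[OF X] Y n intY(1)]
  note meas = measurable_pair_countable[OF itinerary_measurable[OF X, of n] Y]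
  show "integrable M (info (itinerary X (n + m)))"
    using info_coarser(2)[OF itinerary_measurable[OF X] meas coarse pair(1)] .
  have "block_entropy X (n + m) \<le> expectation (info (\<lambda>x. (itinerary X n x, Y x)))"
    unfolding block_entropy_def using info_coarser(3)[OF itinerary_measurable[OF X] meas coarse pair(1)] .
  then show "block_entropy X (n + m) \<le> block_entropy X n + block_entropy X m"
    using pair(2) intY(2) by (simp add: block_entropy_def)
qed

lemma info_itinerary_integrable:
  fixes X :: "'a \<Rightarrow> 'c::countable"
  assumes X: "X \<in> measurable M (count_space UNIV)" and int: "integrable M (info X)"
  shows "integrable M (info (itinerary X n))"
proof (induction n)
  case 0
  have "info (itinerary X 0) x = 0" for x
    by (simp add: info_def fiber_prob_def itinerary_def prob_space)
  then show ?case by (simp cong: Bochner_Integration.integrable_cong)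
next
  case (Suc n)
  have "itinerary X (Suc 0) x = (\<lambda>a. [a]) (X x)" for x by (simp add: itinerary_def)
  from info_coarser(2)[OF itinerary_measurable[OF X] X this int]
  have "integrable M (info (itinerary X (Suc 0)))" .
  from itinerary_subadditive(1)[OF X Suc this] show ?case by simp
qed

lemma block_entropy_subadditive:
  fixes X :: "'a \<Rightarrow> 'c::countable"
  assumes X: "X \<in> measurable M (count_space UNIV)" and int: "integrable M (info X)"
  shows "block_entropy X (n + m) \<le> block_entropy X n + block_entropy X m"
  using itinerary_subadditive(2)[OF X info_itinerary_integrable[OF X int] info_itinerary_integrable[OF X int]] .

lemma entropy_rate_limit:
  fixes X :: "'a \<Rightarrow> 'c::countable"
  assumes X: "X \<in> measurable M (count_space UNIV)" and int: "integrable M (info X)"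
  shows "(\<lambda>n. block_entropy X n / real n) \<longlonglongrightarrow> entropy_rate X"
    and "0 < n \<Longrightarrow> entropy_rate X \<le> block_entropy X n / real n"
proof -
  have "\<exists>l. (\<lambda>n. block_entropy X n / real n) \<longlonglongrightarrow> l \<and> (\<forall>n>0. l \<le> block_entropy X n / real n)"
    by (rule fekete_limit[where b = 0]) (simp_all add: block_entropy_subadditive[OF X int] block_entropy_nonneg)
  then obtain l where l: "(\<lambda>n. block_entropy X n / real n) \<longlonglongrightarrow> l" "\<And>n. 0 < n \<Longrightarrow> l \<le> block_entropy X n / real n"
    by blast
  have "entropy_rate X = l" unfolding entropy_rate_def using l(1) by (rule limI)
  with l show "(\<lambda>n. block_entropy X n / real n) \<longlonglongrightarrow> entropy_rate X"
    and "0 < n \<Longrightarrow> entropy_rate X \<le> block_entropy X n / real n" by auto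
qed

text \<open>Both sides consist of the classes of points with equal values at times
  \<open>0..<n\<close>. For \<open>n = 0\<close> the refinement of the empty family is
  \<open>UNIV\<close>, which need not be the space.\<close>

lemma iterated_refinement_fibers:
  assumes n: "0 < n"
  shows "iterated_refinement M T (fibers X) n = fibers (itinerary X n)"
proof -
  define P where "P i = (\<lambda>A. (T ^^ i) -` A \<inter> space M) ` fibers X" for i
  define c where "c i x = {y \<in> space M. X ((T ^^ i) y) = X ((T ^^ i) x)}" for i x
  have c_in: "c i x \<in> P i" "x \<in> c i x" if "x \<in> space M" for i x
  proof -
    have "c i x = (T ^^ i) -` {y \<in> space M. X y = X ((T ^^ i) x)} \<inter> space M"
      using funpow_space by (auto simp: c_def)
    moreover have "{y \<in> space M. X y = X ((T ^^ i) x)} \<in> fibers X"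
      unfolding fibers_def using funpow_space[OF that] by (rule imageI)
    ultimately show "c i x \<in> P i" unfolding P_def by (rule image_eqI)
    show "x \<in> c i x" using that by (simp add: c_def)
  qed
  have c_uniq: "B = c i x" if "B \<in> P i" "x \<in> B" for B i x
    using that funpow_space unfolding P_def fibers_def c_def by auto
  have fib: "{y \<in> space M. itinerary X n y = itinerary X n x} = (\<Inter>i<n. c i x)" if "x \<in> space M" for x
    using n by (auto simp: itinerary_eq_iff c_def)
  have "common_refinement (P ` {..<n}) = fibers (itinerary X n)"
  proof
    show "common_refinement (P ` {..<n}) \<subseteq> fibers (itinerary X n)"
    proof
      fix A assume "A \<in> common_refinement (P ` {..<n})"
      then obtain f where f: "\<And>i. i < n \<Longrightarrow> f (P i) \<in> P i" and A: "A = (\<Inter>i<n. f (P i))" and "A \<noteq> {}"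
        unfolding common_refinement by auto
      then obtain x where x: "x \<in> A" by auto
      have fc: "f (P i) = c i x" if "i < n" for i using c_uniq[OF f[OF that]] x A that by auto
      have "x \<in> c 0 x" using x A n fc by force
      then have "x \<in> space M" by (simp add: c_def)
      moreover have "A = (\<Inter>i<n. c i x)" using A fc by auto
      ultimately show "A \<in> fibers (itinerary X n)" using fib unfolding fibers_def by auto
    qed
    show "fibers (itinerary X n) \<subseteq> common_refinement (P ` {..<n})"
    proof
      fix A assume "A \<in> fibers (itinerary X n)"
      then obtain x where x: "x \<in> space M" and A: "A = (\<Inter>i<n. c i x)" using fib unfolding fibers_def by auto
      \<comment> \<open>The selector must be a function of the partition and not of the index,
        because different \<open>i\<close> may give the same partition.\<close>
      define f where "f Q = (THE B. B \<in> Q \<and> x \<in> B)" for Q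
      have f: "f (P i) = c i x" for i
        unfolding f_def using c_in[OF x] c_uniq by (intro the_equality) auto
      have "x \<in> A" using c_in[OF x] A by auto
      moreover have "f \<in> Pi (P ` {..<n}) (\<lambda>Q. Q)" using f c_in[OF x] by auto
      moreover have "A = \<Inter>(f ` (P ` {..<n}))" using A f by auto
      ultimately show "A \<in> common_refinement (P ` {..<n})" unfolding common_refinement by blast
    qed
  qed
  then show ?thesis by (simp add: iterated_refinement_def P_def)
qed

lemma finite_itinerary_range:
  assumes "finite (X ` space M)" shows "finite (itinerary X n ` space M)"
proof (rule finite_subset)
  show "itinerary X n ` space M \<subseteq> {xs. set xs \<subseteq> X ` space M \<and> length xs = n}"
    using funpow_space by (auto simp: itinerary_def)
  show "finite {xs. set xs \<subseteq> X ` space M \<and> length xs = n}" using assms by (rule finite_lists_length_eq)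
qed

lemma partition_entropy_rate_fibers:
  fixes X :: "'a \<Rightarrow> 'c::countable"
  assumes X: "X \<in> measurable M (count_space UNIV)" and fin: "finite (X ` space M)"
  shows "partition_entropy_rate M T (fibers X) = entropy_rate X"
proof -
  have eqn: "block_entropy X n / real n = partition_entropy M (iterated_refinement M T (fibers X) n) / real n" if "0 < n" for n
    using that partition_entropy_fibers(2)[OF itinerary_measurable[OF X] finite_itinerary_range[OF fin]]
    by (simp add: iterated_refinement_fibers block_entropy_def)
  have "\<forall>\<^sub>F n in sequentially. block_entropy X n / real n = partition_entropy M (iterated_refinement M T (fibers X) n) / real n"
    by (intro eventually_mono[OF eventually_gt_at_top[of 0]] eqn)
  from Lim_transform_eventually[OF entropy_rate_limit(1)[OF X partition_entropy_fibers(1)[OF X fin]] this]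
  show ?thesis unfolding partition_entropy_rate_def by (rule limI)
qed

lemma entropy_rate_le_measure_entropy:
  fixes X :: "'a \<Rightarrow> 'c::countable"
  assumes X: "X \<in> measurable M (count_space UNIV)" and fin: "finite (X ` space M)"
  shows "ereal (entropy_rate X) \<le> measure_entropy M T"
  unfolding measure_entropy_def partition_entropy_rate_fibers[OF X fin, symmetric]
  using fibers_partition[OF X fin] by (intro SUP_upper) auto

lemma measure_entropy_leI:
  assumes "\<And>X :: 'a \<Rightarrow> nat. X \<in> measurable M (count_space UNIV) \<Longrightarrow> finite (X ` space M) \<Longrightarrow> entropy_rate X \<le> b"
  shows "measure_entropy M T \<le> ereal b"
  unfolding measure_entropy_def
proof (intro SUP_least)
  fix Q assume "Q \<in> {Q. finite Q \<and> partition_on (space M) Q \<and> Q \<subseteq> events}"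
  then obtain X :: "'a \<Rightarrow> nat" where X: "X \<in> measurable M (count_space UNIV)" "finite (X ` space M)" "fibers X = Q"
    using partition_as_fibers by blast
  show "ereal (partition_entropy_rate M T Q) \<le> ereal b"
    using assms[OF X(1,2)] partition_entropy_rate_fibers[OF X(1,2)] X(3) by simp
qed

end

section \<open>The entropy is the entropy rate of the first-letter process\<close>

context shift_measure
begin

abbreviation letter :: "(nat \<Rightarrow> 's) \<Rightarrow> 's" where "letter x \<equiv> x 0"

lemma itinerary_letter: "itinerary letter n = init_word n"
  by (rule ext, rule nth_equalityI) (simp_all add: shift_map_funpow)

lemma letter_measurable [measurable]: "letter \<in> measurable \<mu> (count_space UNIV)"
proof -
  have "(\<lambda>x. hd (init_word (Suc 0) x)) \<in> measurable (markov_borel t) (count_space UNIV)"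
    using measurable_compose[OF measurable_init_word, of hd "count_space UNIV" "Suc 0" t] by simp
  then show ?thesis by (simp add: init_word_def cong: measurable_cong_sets)
qed

lemma init_word_measurable [measurable]: "init_word n \<in> measurable \<mu> (count_space UNIV)"
  using itinerary_measurable[OF letter_measurable, of n] by (simp add: itinerary_letter)

text \<open>
  A finite partition is predicted from the first \<open>m\<close> letters with small error probability. The
  kernel trusts the prediction with probability \<open>1 - \<delta>\<close> and spreads \<open>\<delta>\<close> evenly, so that an itinerary of
  length \<open>n\<close> costs at most \<open>n \<eta>\<close> on top of the word of length \<open>n + m\<close>.
\<close>

lemma measure_entropy_le_rate:
  assumes int: "integrable \<mu> (info letter)"
  shows "measure_entropy \<mu> shift_map \<le> ereal (entropy_rate letter)"
proof (rule measure_entropy_leI, rule field_le_epsilon)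
  fix X :: "(nat \<Rightarrow> 's) \<Rightarrow> nat" and \<eta> :: real
  assume X [measurable]: "X \<in> measurable \<mu> (count_space UNIV)" and fin: "finite (X ` space \<mu>)" and \<eta>: "0 < \<eta>"
  obtain Q where Q: "\<And>x. x \<in> markov_shift t \<Longrightarrow> X x < Q" "0 < Q"
  proof
    show "X x < Suc (Max (X ` space \<mu>))" if "x \<in> markov_shift t" for x
      using that fin by (simp add: less_Suc_eq_le)
  qed simp
  \<comment> \<open>Chosen so that a correct prediction costs \<open>\<eta> / 2\<close>; a wrong one
    costs \<open>L\<close>.\<close>
  define \<delta> where "\<delta> = 1 - exp (- \<eta> / 2)"
  have \<delta>: "0 < \<delta>" "\<delta> < 1" "- ln (1 - \<delta>) = \<eta> / 2" using \<eta> by (auto simp: \<delta>_def)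
  define L where "L = - ln (\<delta> / real Q)"
  \<comment> \<open>So small that wrong predictions, of probability at most \<open>2 * e\<close>,
    add no more than \<open>\<eta> / 2\<close> on average.\<close>
  define e where "e = \<eta> / (4 * (1 + \<bar>L\<bar>))"
  have e: "0 < e" using \<eta> by (simp add: e_def add_pos_nonneg)
  have intX: "integrable \<mu> (\<lambda>x. real (X x))"
    by (rule integrable_const_bound[where B = "real Q"]) (use Q in \<open>auto intro!: AE_I2 less_imp_le\<close>)
  obtain m \<psi> where \<psi>: "integrable \<mu> (\<lambda>x. \<psi> (init_word m x))" "(\<integral>x. \<bar>real (X x) - \<psi> (init_word m x)\<bar> \<partial>\<mu>) < e"
    using cylinder_functions_dense[OF intX] e by blast
  \<comment> \<open>\<open>X\<close> is integer valued, so rounding errs only where the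
    approximation is off by at least one half; this gives the bound \<open>2 * e\<close> on the
    error probability.\<close>
  define guess where "guess w = nat (round (\<psi> w))" for w
  define bad where "bad = {x \<in> space \<mu>. X x \<noteq> guess (init_word m x)}"
  have guess_meas [measurable]: "(\<lambda>x. guess (init_word m x)) \<in> measurable \<mu> (count_space UNIV)"
    by (rule measurable_compose[OF init_word_measurable]) simp
  have bad_meas [measurable]: "bad \<in> sets \<mu>" unfolding bad_def by measurable
  have bad_int: "integrable \<mu> (indicat_real bad)"
    using bad_meas by (intro integrable_real_indicator) (auto simp: emeasure_eq_measure)
  have bad_le: "prob bad \<le> 2 * e"
  proof -
    have half: "1 / 2 \<le> \<bar>real (X x) - \<psi> (init_word m x)\<bar>" if "x \<in> bad" for x
    proof (rule ccontr)
      assume "\<not> ?thesis"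
      then have "\<bar>\<psi> (init_word m x) - real_of_int (int (X x))\<bar> < 1 / 2" by linarith
      then have "round (\<psi> (init_word m x)) = int (X x)" by (rule round_unique')
      with that show False by (simp add: bad_def guess_def)
    qed
    have "prob bad / 2 = (\<integral>x. indicator bad x / 2 \<partial>\<mu>)"
      using sets.sets_into_space[OF bad_meas] by (simp add: Int_absorb2)
    also have "\<dots> \<le> (\<integral>x. \<bar>real (X x) - \<psi> (init_word m x)\<bar> \<partial>\<mu>)"
    proof (rule integral_mono)
      show "integrable \<mu> (\<lambda>x. indicat_real bad x / 2)" using bad_int by simp
      show "indicat_real bad x / 2 \<le> \<bar>real (X x) - \<psi> (init_word m x)\<bar>" for x
        using half[of x] by (cases "x \<in> bad") auto
    qed (use \<psi> intX in simp)
    finally show ?thesis using \<psi>(2) by linarith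
  qed
  define \<phi> where "\<phi> x = (if X x = guess (init_word m x) then \<eta> / 2 else L)" for x
  have \<phi>_eq: "\<phi> x = \<eta> / 2 + (L - \<eta> / 2) * indicator bad x" if "x \<in> space \<mu>" for x
    using that by (auto simp: \<phi>_def bad_def)
  have \<phi>_int: "integrable \<mu> \<phi>"
  proof -
    have "integrable \<mu> (\<lambda>x. \<eta> / 2 + (L - \<eta> / 2) * indicator bad x)"
      using bad_int by (intro Bochner_Integration.integrable_add integrable_mult_right) auto
    then show ?thesis using Bochner_Integration.integrable_cong[where M = \<mu> and N = \<mu> and f = \<phi>, OF refl \<phi>_eq] by blast
  qed
  have \<phi>_le: "expectation \<phi> \<le> \<eta>"
  proof -
    have "expectation \<phi> = (\<integral>x. \<eta> / 2 + (L - \<eta> / 2) * indicator bad x \<partial>\<mu>)"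
      by (rule Bochner_Integration.integral_cong[OF refl \<phi>_eq])
    also have "\<dots> = \<eta> / 2 + (L - \<eta> / 2) * prob bad"
      using sets.sets_into_space[OF bad_meas] bad_int prob_space
      by (subst Bochner_Integration.integral_add) (simp_all add: Int_absorb2)
    also have "\<dots> \<le> \<eta> / 2 + (1 + \<bar>L\<bar>) * (2 * e)"
      using bad_le \<eta> by (intro add_left_mono mult_mono) auto
    also have "\<dots> = \<eta>" using \<eta> by (simp add: e_def field_simps)
    finally show ?thesis .
  qed
  \<comment> \<open>Here \<open>y\<close> is to be the word of length \<open>n + m\<close>; its
    \<open>m\<close> letters from position \<open>i\<close> on predict the value of \<open>X\<close>
    at time \<open>i\<close>.\<close>
  define k where "k i y s = (if s = guess (take m (drop i y)) then 1 - \<delta> else if s < Q then \<delta> / real Q else 0)"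
    for i :: nat and y :: "'s list" and s :: nat
  have k_nn: "0 \<le> k i y s" for i y s using \<delta> by (simp add: k_def)
  have k_sum: "(\<integral>\<^sup>+s. ennreal (k i y s) \<partial>count_space UNIV) \<le> 1" for i y
  proof -
    let ?g = "guess (take m (drop i y))"
    have "(\<integral>\<^sup>+s. ennreal (k i y s) \<partial>count_space UNIV)
      \<le> (\<integral>\<^sup>+s. ennreal (1 - \<delta>) * indicator {?g} s + ennreal (\<delta> / real Q) * indicator {..<Q} s \<partial>count_space UNIV)"
      using \<delta> by (intro nn_integral_mono) (auto simp: k_def indicator_def)
    also have "\<dots> = ennreal (1 - \<delta>) + ennreal (\<delta> / real Q) * of_nat Q"
      by (subst nn_integral_add) (auto simp: nn_integral_cmult_indicator)
    also have "\<dots> = ennreal ((1 - \<delta>) + \<delta> / real Q * real Q)"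
      using \<delta> Q(2) by (simp add: ennreal_of_nat_eq_real_of_nat ennreal_mult[symmetric] ennreal_plus[symmetric] del: ennreal_plus)
    also have "\<dots> = 1" using Q(2) by simp
    finally show ?thesis .
  qed
  have window: "take m (drop i (init_word (n + m) x)) = init_word m ((shift_map ^^ i) x)" if "i < n" for i n x
    using that by (intro nth_equalityI) (auto simp: shift_map_funpow add.commute)
  have ln_k: "- ln (k i (init_word (n + m) x) (itinerary X n x ! i)) = \<phi> ((shift_map ^^ i) x)"
    and k_pos: "0 < k i (init_word (n + m) x) (itinerary X n x ! i)"
    if "i < n" "x \<in> space \<mu>" for i n x
    using that window[OF that(1), of x] \<delta> Q(1)[OF shift_map_funpow_markov[of x t i]] Q(2)
    by (auto simp: k_def \<phi>_def L_def)
  have block: "block_entropy X n \<le> block_entropy letter (n + m) + real n * \<eta>" for n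
  proof -
    have int_k: "integrable \<mu> (\<lambda>x. - ln (k i (init_word (n + m) x) (itinerary X n x ! i)))"
      and exp_k: "expectation (\<lambda>x. - ln (k i (init_word (n + m) x) (itinerary X n x ! i))) \<le> \<eta>" if "i < n" for i
    proof -
      have "integrable \<mu> (\<lambda>x. - ln (k i (init_word (n + m) x) (itinerary X n x ! i))) \<longleftrightarrow> integrable \<mu> (\<lambda>x. \<phi> ((shift_map ^^ i) x))"
        by (rule Bochner_Integration.integrable_cong[OF refl ln_k[OF that]])
      from iffD2[OF this expectation_funpow(1)[OF \<phi>_int]]
      show "integrable \<mu> (\<lambda>x. - ln (k i (init_word (n + m) x) (itinerary X n x ! i)))" .
      have "expectation (\<lambda>x. - ln (k i (init_word (n + m) x) (itinerary X n x ! i))) = expectation (\<lambda>x. \<phi> ((shift_map ^^ i) x))"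
        by (rule Bochner_Integration.integral_cong[OF refl ln_k[OF that]])
      then show "expectation (\<lambda>x. - ln (k i (init_word (n + m) x) (itinerary X n x ! i))) \<le> \<eta>"
        using expectation_funpow(2)[OF \<phi>_int, of i] \<phi>_le by simp
    qed
    have intY: "integrable \<mu> (info (init_word (n + m)))"
      using info_itinerary_integrable[OF letter_measurable int, of "n + m"] by (simp add: itinerary_letter)
    have "AE x in \<mu>. \<forall>i<n. 0 < k i (init_word (n + m) x) (itinerary X n x ! i)"
      by (rule AE_I2) (use k_pos in blast)
    note kb = info_kernel_bound[OF itinerary_measurable[OF X] init_word_measurable length_itinerary k_nn k_sum this intY int_k]
    have "itinerary X n x = fst (itinerary X n x, init_word (n + m) x)" for x by simp
    note coarse = info_coarser(3)[OF itinerary_measurable[OF X] measurable_pair_countable[OF itinerary_measurable[OF X, of n] init_word_measurable[of "n + m"]] this kb(1)]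
    have "block_entropy X n \<le> expectation (info (init_word (n + m))) + (\<Sum>i<n. expectation (\<lambda>x. - ln (k i (init_word (n + m) x) (itinerary X n x ! i))))"
      unfolding block_entropy_def using coarse kb(2) by linarith
    also have "(\<Sum>i<n. expectation (\<lambda>x. - ln (k i (init_word (n + m) x) (itinerary X n x ! i)))) \<le> (\<Sum>i<n. \<eta>)"
      using exp_k by (intro sum_mono) auto
    finally show ?thesis by (simp add: block_entropy_def itinerary_letter)
  qed
  have lim1: "(\<lambda>n. block_entropy X n / real n) \<longlonglongrightarrow> entropy_rate X"
    using entropy_rate_limit(1)[OF X partition_entropy_fibers(1)[OF X fin]] .
  \<comment> \<open>By subadditivity the \<open>m\<close> additional letters cost at most
    \<open>block_entropy letter m\<close>, which vanishes after division by
    \<open>n\<close>.\<close>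
  have lim2: "(\<lambda>n. block_entropy letter n / real n + block_entropy letter m / real n + \<eta>) \<longlonglongrightarrow> entropy_rate letter + 0 + \<eta>"
    by (intro tendsto_add entropy_rate_limit(1)[OF letter_measurable int] lim_const_over_n tendsto_const)
  show "entropy_rate X \<le> entropy_rate letter + \<eta>"
  proof (rule LIMSEQ_le[OF lim1])
    show "(\<lambda>n. block_entropy letter n / real n + block_entropy letter m / real n + \<eta>) \<longlonglongrightarrow> entropy_rate letter + \<eta>"
      using lim2 by simp
    show "\<exists>N. \<forall>n\<ge>N. block_entropy X n / real n \<le> block_entropy letter n / real n + block_entropy letter m / real n + \<eta>"
    proof (intro exI[of _ 1] allI impI)
      fix n :: nat assume "1 \<le> n"
      then have "block_entropy X n / real n \<le> (block_entropy letter n + block_entropy letter m + real n * \<eta>) / real n"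
        using block[of n] block_entropy_subadditive[OF letter_measurable int, of n m] by (intro divide_right_mono) auto
      then show "block_entropy X n / real n \<le> block_entropy letter n / real n + block_entropy letter m / real n + \<eta>"
        using \<open>1 \<le> n\<close> by (simp add: add_divide_distrib)
    qed
  qed
qed

definition coarse_letter :: "'s set \<Rightarrow> (nat \<Rightarrow> 's) \<Rightarrow> 's option" where
  "coarse_letter F x = (if x 0 \<in> F then Some (x 0) else None)"

lemma coarse_letter_measurable [measurable]: "coarse_letter F \<in> measurable \<mu> (count_space UNIV)"
  unfolding coarse_letter_def
  using measurable_compose[OF letter_measurable, of "\<lambda>a. if a \<in> F then Some a else None" "count_space UNIV"] by simp

lemma coarse_letter_finite: "finite F \<Longrightarrow> finite (coarse_letter F ` space \<mu>)"
  by (rule finite_subset[of _ "insert None (Some ` F)"]) (auto simp: coarse_letter_def)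

definition tail_info :: "'s set \<Rightarrow> (nat \<Rightarrow> 's) \<Rightarrow> real" where
  "tail_info F x = (if x 0 \<in> F then 0 else info letter x)"

text \<open>Given the coarse itinerary, only letters outside \<open>F\<close> remain to be coded,
  and coding them by their own distribution costs \<open>tail_info F\<close> per step.\<close>

lemma entropy_rate_letter_le:
  assumes int: "integrable \<mu> (info letter)" and F: "finite F"
  shows "entropy_rate letter \<le> entropy_rate (coarse_letter F) + expectation (tail_info F)"
    and "integrable \<mu> (tail_info F)"
proof -
  have tail_meas: "tail_info F \<in> borel_measurable \<mu>"
    using countable_rv_function_measurable[OF letter_measurable, of "\<lambda>a. if a \<in> F then 0 else - ln (fiber_prob letter a)"]
    by (simp add: tail_info_def[abs_def] info_def)
  show tail_int: "integrable \<mu> (tail_info F)"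
    by (rule Bochner_Integration.integrable_bound[OF int tail_meas]) (auto simp: tail_info_def info_nonneg)
  \<comment> \<open>A visible letter is copied with probability 1; a hidden one is drawn from the
    law of the first letter.\<close>
  define k where "k i y a = (case y ! i of Some b \<Rightarrow> if a = b then 1 else 0 | None \<Rightarrow> fiber_prob letter a)"
    for i :: nat and y :: "'s option list" and a :: 's
  have k_nn: "0 \<le> k i y a" for i y a by (simp add: k_def fiber_prob_nonneg split: option.splits)
  have k_sum: "(\<integral>\<^sup>+a. ennreal (k i y a) \<partial>count_space UNIV) \<le> 1" for i y
  proof (cases "y ! i")
    case None
    then show ?thesis by (simp add: k_def sum_fiber_prob)
  next
    case (Some b)
    have "(\<integral>\<^sup>+a. ennreal (k i y a) \<partial>count_space UNIV) = (\<integral>\<^sup>+a. indicator {b} a \<partial>count_space UNIV)"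
      using Some by (intro nn_integral_cong) (auto simp: k_def indicator_def)
    then show ?thesis by simp
  qed
  let ?Y = "coarse_letter F"
  have val: "k i (itinerary ?Y n x) (init_word n x ! i) = (if ((shift_map ^^ i) x) 0 \<in> F then 1 else fiber_prob letter (((shift_map ^^ i) x) 0))"
    if "i < n" for i n x
    using that by (auto simp: k_def coarse_letter_def shift_map_funpow)
  have ln_k: "- ln (k i (itinerary ?Y n x) (init_word n x ! i)) = tail_info F ((shift_map ^^ i) x)" if "i < n" for i n x
    using val[OF that] by (simp add: tail_info_def info_def)
  have pos_all: "AE x in \<mu>. \<forall>i. 0 < fiber_prob letter (((shift_map ^^ i) x) 0)"
  proof (subst AE_all_countable, rule allI)
    fix i
    have "AE x in distr \<mu> \<mu> (shift_map ^^ i). 0 < fiber_prob letter (x 0)"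
      unfolding distr_funpow by (rule AE_fiber_prob_pos) simp
    then show "AE x in \<mu>. 0 < fiber_prob letter (((shift_map ^^ i) x) 0)"
      by (subst (asm) AE_distr_iff[OF funpow_measurable])
        (use measurable_compose[OF letter_measurable, of "\<lambda>a. 0 < fiber_prob letter a" "count_space UNIV"] in \<open>simp_all add: pred_def\<close>)
  qed
  have block: "block_entropy letter n \<le> block_entropy ?Y n + real n * expectation (tail_info F)" for n
  proof -
    have intY: "integrable \<mu> (info (itinerary ?Y n))"
      by (rule info_itinerary_integrable[OF _ partition_entropy_fibers(1)]) (auto simp: coarse_letter_finite[OF F, simplified])
    have k_pos: "AE x in \<mu>. \<forall>i<n. 0 < k i (itinerary ?Y n x) (init_word n x ! i)"
      using pos_all
    proof eventually_elim
      fix x assume pos: "\<forall>i. 0 < fiber_prob letter (((shift_map ^^ i) x) 0)"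
      show "\<forall>i<n. 0 < k i (itinerary ?Y n x) (init_word n x ! i)"
      proof (intro allI impI)
        fix i assume "i < n"
        from val[OF this, of x] show "0 < k i (itinerary ?Y n x) (init_word n x ! i)"
          using pos[rule_format, of i] by (simp split: if_splits)
      qed
    qed
    have int_k: "integrable \<mu> (\<lambda>x. - ln (k i (itinerary ?Y n x) (init_word n x ! i)))" if "i < n" for i
      using expectation_funpow(1)[OF tail_int, of i] by (simp add: ln_k[OF that])
    note kb = info_kernel_bound[OF init_word_measurable itinerary_measurable[OF coarse_letter_measurable] length_init_word k_nn k_sum k_pos intY int_k]
    have "init_word n x = fst (init_word n x, itinerary ?Y n x)" for x by simp
    note coarse = info_coarser(3)[OF init_word_measurable measurable_pair_countable[OF init_word_measurable[of n] itinerary_measurable[OF coarse_letter_measurable, of F n]] this kb(1)]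
    have "block_entropy letter n \<le> block_entropy ?Y n + (\<Sum>i<n. expectation (\<lambda>x. - ln (k i (itinerary ?Y n x) (init_word n x ! i))))"
      using coarse kb(2) by (simp add: block_entropy_def itinerary_letter)
    also have "(\<Sum>i<n. expectation (\<lambda>x. - ln (k i (itinerary ?Y n x) (init_word n x ! i)))) = (\<Sum>i<n. expectation (tail_info F))"
      by (intro sum.cong refl) (simp only: ln_k lessThan_iff expectation_funpow(2)[OF tail_int])
    finally show ?thesis by simp
  qed
  have lim1: "(\<lambda>n. block_entropy letter n / real n) \<longlonglongrightarrow> entropy_rate letter"
    by (rule entropy_rate_limit(1)[OF letter_measurable int])
  have lim2: "(\<lambda>n. block_entropy ?Y n / real n + expectation (tail_info F)) \<longlonglongrightarrow> entropy_rate ?Y + expectation (tail_info F)"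
    by (intro tendsto_add entropy_rate_limit(1) tendsto_const partition_entropy_fibers(1) coarse_letter_measurable coarse_letter_finite F)
  show "entropy_rate letter \<le> entropy_rate ?Y + expectation (tail_info F)"
  proof (rule LIMSEQ_le[OF lim1 lim2], intro exI[of _ 1] allI impI)
    fix n :: nat assume "1 \<le> n"
    then show "block_entropy letter n / real n \<le> block_entropy ?Y n / real n + expectation (tail_info F)"
      using block[of n] by (simp add: field_simps)
  qed
qed

text \<open>Let finite sets of letters exhaust the alphabet: the cost of coding the tail tends to 0
  by domination with \<open>info letter\<close>, and the coarse processes are finite
  partitions.\<close>

lemma measure_entropy_eq_rate:
  assumes int: "integrable \<mu> (info letter)"
  shows "measure_entropy \<mu> shift_map = ereal (entropy_rate letter)"
proof (rule antisym[OF measure_entropy_le_rate[OF int]])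
  define F where "F k = {a :: 's. to_nat a < k}" for k
  have F_fin: "finite (F k)" for k
    unfolding F_def using finite_vimageI[OF finite_lessThan[of k] inj_to_nat] by (simp add: vimage_def)
  have lim: "(\<lambda>k. expectation (tail_info (F k))) \<longlonglongrightarrow> expectation (\<lambda>_. 0)"
  proof (rule integral_dominated_convergence[where w = "info letter"])
    show "AE x in \<mu>. (\<lambda>k. tail_info (F k) x) \<longlonglongrightarrow> 0"
    proof (rule AE_I2)
      fix x
      show "(\<lambda>k. tail_info (F k) x) \<longlonglongrightarrow> 0"
        by (rule tendsto_eventually, rule eventually_mono[OF eventually_gt_at_top[of "to_nat (x 0)"]]) (simp add: tail_info_def F_def)
    qed
    show "AE x in \<mu>. norm (tail_info (F k) x) \<le> info letter x" for k
      by (rule AE_I2) (auto simp: tail_info_def info_nonneg)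
    show "tail_info (F k) \<in> borel_measurable \<mu>" for k
      using entropy_rate_letter_le(2)[OF int F_fin[of k]] by auto
  qed (use int in auto)
  have "(\<lambda>k. measure_entropy \<mu> shift_map + ereal (expectation (tail_info (F k)))) \<longlonglongrightarrow> measure_entropy \<mu> shift_map + ereal 0"
    using lim by (intro tendsto_add_ereal_general1 tendsto_const tendsto_ereal) auto
  moreover have "ereal (entropy_rate letter) \<le> measure_entropy \<mu> shift_map + ereal (expectation (tail_info (F k)))" for k
  proof -
    have "ereal (entropy_rate letter) \<le> ereal (entropy_rate (coarse_letter (F k))) + ereal (expectation (tail_info (F k)))"
      using entropy_rate_letter_le(1)[OF int F_fin[of k]] by simp
    also have "\<dots> \<le> measure_entropy \<mu> shift_map + ereal (expectation (tail_info (F k)))"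
      by (intro add_right_mono entropy_rate_le_measure_entropy coarse_letter_measurable coarse_letter_finite F_fin)
    finally show ?thesis .
  qed
  ultimately show "ereal (entropy_rate letter) \<le> measure_entropy \<mu> shift_map"
    by (intro LIMSEQ_le_const[where X = "\<lambda>k. measure_entropy \<mu> shift_map + ereal (expectation (tail_info (F k)))"]) auto
qed

end

section \<open>Integrable information of the first letter; absolute continuity from bounded relative
  entropy\<close>

context shift_measure
begin

lemma fiber_prob_init_word: "length w = n \<Longrightarrow> fiber_prob (init_word n) w = measure \<mu> (cylinder t w)"
  by (simp add: fiber_prob_def cylinder_init_word)

text \<open>
  Quasi-independence of consecutive letters gives \<open>H(X\<^sup>n) \<ge> n (H(X) - ln K)\<close> for every coarsening \<open>X\<close> of the
  first letter to finitely many values, so finite entropy bounds all these \<open>H(X)\<close>.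
\<close>

lemma integrable_info_letter:
  assumes upper: "\<And>a w. measure \<mu> (cylinder t (a # w)) \<le> K * measure \<mu> (cylinder t [a]) * measure \<mu> (cylinder t w)"
    and K: "0 < K" and h: "measure_entropy \<mu> shift_map < \<infinity>"
  shows "integrable \<mu> (info letter)"
proof -
  \<comment> \<open>The hypothesis concerns single letters and words. Summing over the letters of a
    coarse cell and comparing measures on cylinders extends it to cells and Borel sets.\<close>
  have set_upper: "measure \<mu> ({x \<in> space \<mu>. coarse_letter F x = b} \<inter> ((shift_map ^^ 1) -` B \<inter> markov_shift t))
      \<le> K * fiber_prob (coarse_letter F) b * measure \<mu> B" if B: "B \<in> sets (markov_borel t)" for F b B
  proof -
    define E where "E = {w. \<exists>a. w = [a] \<and> (if a \<in> F then Some a else None) = b}"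
    define A where "A = {x \<in> space \<mu>. coarse_letter F x = b}"
    have AE: "A = word_set t 1 E"
      by (auto simp: A_def word_set_def E_def coarse_letter_def init_word_def)
    have A: "A \<in> sets (markov_borel t)" unfolding AE by simp
    have topS: "markov_shift t \<in> sets (markov_borel t)" using sets.top[of "markov_borel t"] by simp
    define R where "R = distr (density \<mu> (indicator A)) \<mu> (shift_map ^^ 1)"
    define M where "M = scale_measure (ennreal (K * measure \<mu> A)) \<mu>"
    have R: "emeasure R X = emeasure \<mu> (A \<inter> ((shift_map ^^ 1) -` X \<inter> markov_shift t))"
      if "X \<in> sets (markov_borel t)" for X
    proof -
      have "emeasure R X = emeasure (density \<mu> (indicator A)) ((shift_map ^^ 1) -` X \<inter> markov_shift t)"
        unfolding R_def using that funpow_measurable[of 1] by (subst emeasure_distr) auto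
      also have "\<dots> = emeasure \<mu> (A \<inter> ((shift_map ^^ 1) -` X \<inter> markov_shift t))"
        by (rule emeasure_restricted) (use preimage_sets[OF that, of 1] A in auto)
      finally show ?thesis .
    qed
    have "emeasure R B \<le> emeasure M B"
    proof (rule emeasure_le_of_cylinder[OF _ _ _ _ _ B])
      show "finite_measure M" unfolding M_def
        by (rule finite_measureI) (simp add: emeasure_scale_measure ennreal_mult_eq_top_iff)
      have "space R = markov_shift t" by (simp add: R_def)
      then show "finite_measure R"
        by (intro finite_measureI) (simp add: R[OF topS] emeasure_eq_measure)
      show "emeasure R (cylinder t w) \<le> emeasure M (cylinder t w)" for w
      proof -
        let ?Y = "(shift_map ^^ 1) -` cylinder t w \<inter> markov_shift t"
        have Y: "?Y \<in> sets (markov_borel t)" by (rule preimage_sets) simp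
        have "emeasure R (cylinder t w) = emeasure \<mu> (?Y \<inter> word_set t 1 E)"
          by (simp add: R AE Int_commute)
        also have "\<dots> = (\<integral>\<^sup>+v. emeasure \<mu> (?Y \<inter> cylinder t v) \<partial>count_space {v \<in> E. length v = 1})"
          by (rule emeasure_word_decomp) (use Y in auto)
        also have "\<dots> \<le> (\<integral>\<^sup>+v. ennreal (K * measure \<mu> (cylinder t w)) * emeasure \<mu> (markov_shift t \<inter> cylinder t v) \<partial>count_space {v \<in> E. length v = 1})"
        proof (rule nn_integral_mono)
          fix v assume "v \<in> space (count_space {v \<in> E. length v = 1})"
          then obtain a where v: "v = [a]" by (auto simp: E_def)
          have "?Y \<inter> cylinder t v = cylinder t (a # w)"
            using shift_map_markov by (auto simp: v cylinder_init_word init_word_Suc)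
          moreover have "markov_shift t \<inter> cylinder t v = cylinder t [a]" by (auto simp: v cylinder_def)
          ultimately show "emeasure \<mu> (?Y \<inter> cylinder t v) \<le> ennreal (K * measure \<mu> (cylinder t w)) * emeasure \<mu> (markov_shift t \<inter> cylinder t v)"
            using upper[of a w] K by (simp add: emeasure_eq_measure ennreal_mult[symmetric] mult_ac)
        qed
        also have "\<dots> = ennreal (K * measure \<mu> (cylinder t w)) * (\<integral>\<^sup>+v. emeasure \<mu> (markov_shift t \<inter> cylinder t v) \<partial>count_space {v \<in> E. length v = 1})"
          by (rule nn_integral_cmult) simp
        also have "(\<integral>\<^sup>+v. emeasure \<mu> (markov_shift t \<inter> cylinder t v) \<partial>count_space {v \<in> E. length v = 1}) = emeasure \<mu> (markov_shift t \<inter> word_set t 1 E)"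
          by (rule emeasure_word_decomp[symmetric]) (use topS in auto)
        also have "markov_shift t \<inter> word_set t 1 E = A" using AE by (auto simp: word_set_def)
        finally show ?thesis
          using K by (simp add: M_def emeasure_scale_measure emeasure_eq_measure ennreal_mult[symmetric] mult_ac)
      qed
    qed (auto simp: M_def R_def)
    then have "ennreal (measure \<mu> (A \<inter> ((shift_map ^^ 1) -` B \<inter> markov_shift t))) \<le> ennreal (K * measure \<mu> A * measure \<mu> B)"
      using K by (simp add: R[OF B] M_def emeasure_scale_measure emeasure_eq_measure ennreal_mult[symmetric])
    moreover have "0 \<le> K * measure \<mu> A * measure \<mu> B" using K by simp
    ultimately show ?thesis by (simp add: A_def fiber_prob_def)
  qed
  obtain b where b: "measure_entropy \<mu> shift_map \<le> ereal b"
    using h by (cases "measure_entropy \<mu> shift_map") auto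
  have coarse_le: "expectation (info (coarse_letter F)) \<le> b + ln K" if F: "finite F" for F
  proof -
    let ?X = "coarse_letter F"
    have X: "?X \<in> measurable \<mu> (count_space UNIV)" by (rule coarse_letter_measurable)
    have intX: "integrable \<mu> (info ?X)" using partition_entropy_fibers(1)[OF X coarse_letter_finite[OF F]] .
    \<comment> \<open>The fibre of an itinerary has at most \<open>K\<close> times the product of
      the masses of its first cell and of the remaining itinerary; the logarithm of this is
      integrated.\<close>
    have step: "block_entropy ?X n + expectation (info ?X) - ln K \<le> block_entropy ?X (Suc n)" for n
    proof -
      have le: "AE x in \<mu>. info ?X x + info (itinerary ?X n) ((shift_map ^^ 1) x) - ln K \<le> info (itinerary ?X (Suc n)) x"
        using AE_fiber_prob_pos[OF itinerary_measurable[OF X, of "Suc n"]] AE_space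
      proof eventually_elim
        fix x assume pos: "0 < fiber_prob (itinerary ?X (Suc n)) (itinerary ?X (Suc n) x)" and x: "x \<in> space \<mu>"
        let ?b = "?X x" and ?s = "itinerary ?X n ((shift_map ^^ 1) x)"
        let ?B = "{y \<in> space \<mu>. itinerary ?X n y = ?s}"
        have B: "?B \<in> sets (markov_borel t)" using fiber_sets[OF itinerary_measurable[OF X]] by simp
        have it: "itinerary ?X (Suc n) y = ?X y # itinerary ?X n ((shift_map ^^ 1) y)" for y
          using itinerary_add[of ?X 1 n y] by (simp add: itinerary_def)
        have "{y \<in> space \<mu>. itinerary ?X (Suc n) y = itinerary ?X (Suc n) x}
            = {y \<in> space \<mu>. ?X y = ?b} \<inter> ((shift_map ^^ 1) -` ?B \<inter> markov_shift t)"
          unfolding it using funpow_space[of _ 1] by auto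
        then have "fiber_prob (itinerary ?X (Suc n)) (itinerary ?X (Suc n) x) \<le> K * fiber_prob ?X ?b * fiber_prob (itinerary ?X n) ?s"
          using set_upper[OF B, of F ?b] by (simp only: fiber_prob_def)
        with pos have le: "ln (fiber_prob (itinerary ?X (Suc n)) (itinerary ?X (Suc n) x)) \<le> ln (K * fiber_prob ?X ?b * fiber_prob (itinerary ?X n) ?s)"
          and pp: "0 < K * fiber_prob ?X ?b * fiber_prob (itinerary ?X n) ?s" by auto
        then have "0 < fiber_prob ?X ?b" "0 < fiber_prob (itinerary ?X n) ?s"
          using K fiber_prob_nonneg[of ?X ?b] fiber_prob_nonneg[of "itinerary ?X n" ?s]
          by (auto simp: less_le)
        then have "ln (K * fiber_prob ?X ?b * fiber_prob (itinerary ?X n) ?s) = ln K + ln (fiber_prob ?X ?b) + ln (fiber_prob (itinerary ?X n) ?s)"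
          using K by (simp add: ln_mult)
        with le show "info ?X x + info (itinerary ?X n) ((shift_map ^^ 1) x) - ln K \<le> info (itinerary ?X (Suc n)) x"
          by (simp add: info_def)
      qed
      note In = info_itinerary_integrable[OF X intX]
      note sh = expectation_funpow[OF In[of n], of 1]
      have "expectation (\<lambda>x. info ?X x + info (itinerary ?X n) ((shift_map ^^ 1) x) - ln K) \<le> block_entropy ?X (Suc n)"
        unfolding block_entropy_def using intX sh(1) In le by (intro integral_mono_AE) auto
      also have "expectation (\<lambda>x. info ?X x + info (itinerary ?X n) ((shift_map ^^ 1) x) - ln K)
          = expectation (info ?X) + block_entropy ?X n - ln K"
        using intX sh prob_space by (simp add: block_entropy_def)
      finally show ?thesis by simp
    qed
    have ind: "real n * (expectation (info ?X) - ln K) \<le> block_entropy ?X n" for n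
    proof (induction n)
      case (Suc n)
      then show ?case using step[of n] by (simp add: algebra_simps)
    qed (simp add: block_entropy_nonneg)
    have "expectation (info ?X) - ln K \<le> entropy_rate ?X"
    proof (rule LIMSEQ_le_const[OF entropy_rate_limit(1)[OF X intX]], intro exI[of _ 1] allI impI)
      fix n :: nat assume "1 \<le> n"
      then show "expectation (info ?X) - ln K \<le> block_entropy ?X n / real n"
        using ind[of n] by (simp add: field_simps)
    qed
    moreover have "entropy_rate ?X \<le> b"
      using order_trans[OF entropy_rate_le_measure_entropy[OF X coarse_letter_finite[OF F]] b] by simp
    ultimately show ?thesis by simp
  qed
  define F where "F k = {a :: 's. to_nat a < k}" for k
  have F_fin: "finite (F k)" for k
    unfolding F_def using finite_vimageI[OF finite_lessThan[of k] inj_to_nat] by (simp add: vimage_def)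
  \<comment> \<open>Increasing truncations of \<open>info letter\<close>. On letters in
    \<open>F k\<close> coarse and full information coincide, so \<open>coarse_le\<close> bounds all
    the integrals at once.\<close>
  define u where "u k x = ennreal (info letter x) * indicator (F k) (x 0)" for k and x :: "nat \<Rightarrow> 's"
  have u_meas: "u k \<in> borel_measurable \<mu>" for k
  proof -
    have "u k = (\<lambda>x. (\<lambda>a. ennreal (- ln (fiber_prob letter a)) * indicator (F k) a) (x 0))"
      by (simp add: u_def[abs_def] info_def)
    then show ?thesis using measurable_compose[OF letter_measurable, of "\<lambda>a. ennreal (- ln (fiber_prob letter a)) * indicator (F k) a" borel] by simp
  qed
  have u_le: "(\<integral>\<^sup>+x. u k x \<partial>\<mu>) \<le> ennreal (b + ln K)" for k
  proof -
    let ?X = "coarse_letter (F k)"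
    have intX: "integrable \<mu> (info ?X)"
      using partition_entropy_fibers(1)[OF coarse_letter_measurable coarse_letter_finite[OF F_fin]] .
    have "u k x \<le> ennreal (info ?X x)" for x
    proof (cases "x 0 \<in> F k")
      case True
      have "{y \<in> space \<mu>. ?X y = ?X x} = {y \<in> space \<mu>. y 0 = x 0}"
        using True by (auto simp: coarse_letter_def)
      then have "info ?X x = info letter x" by (simp only: info_def fiber_prob_def)
      then show ?thesis using True by (simp add: u_def)
    qed (simp add: u_def)
    then have "(\<integral>\<^sup>+x. u k x \<partial>\<mu>) \<le> (\<integral>\<^sup>+x. ennreal (info ?X x) \<partial>\<mu>)" by (intro nn_integral_mono) auto
    also have "\<dots> = ennreal (expectation (info ?X))"
      using intX info_nonneg by (intro nn_integral_eq_integral) auto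
    also have "\<dots> \<le> ennreal (b + ln K)" using coarse_le[OF F_fin] by (intro ennreal_leI)
    finally show ?thesis .
  qed
  have sup: "(SUP k. u k x) = ennreal (info letter x)" for x
  proof (rule antisym)
    show "(SUP k. u k x) \<le> ennreal (info letter x)" by (intro SUP_least) (auto simp: u_def indicator_def)
    have "u (Suc (to_nat (x 0))) x = ennreal (info letter x)" by (simp add: u_def F_def)
    then show "ennreal (info letter x) \<le> (SUP k. u k x)" by (metis SUP_upper UNIV_I)
  qed
  have "(\<integral>\<^sup>+x. ennreal (info letter x) \<partial>\<mu>) = (SUP k. \<integral>\<^sup>+x. u k x \<partial>\<mu>)"
    unfolding sup[symmetric] using u_meas
    by (intro nn_integral_monotone_convergence_SUP) (auto simp: incseq_def le_fun_def u_def F_def indicator_def)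
  also have "\<dots> \<le> ennreal (b + ln K)" by (intro SUP_least u_le)
  finally have "(\<integral>\<^sup>+x. ennreal (info letter x) \<partial>\<mu>) < \<infinity>" by (simp add: le_less_trans)
  then show ?thesis using info_nonneg by (intro integrableI_nonneg info_measurable) auto
qed

text \<open>
  The reference weight that gives mass at most one half to \<open>E\<close> and to its complement, proportionally
  to \<open>\<mu>\<close> on each, turns the bound on relative entropies into \<open>- \<nu>(E) ln \<mu>(E) \<le> D + ln 2\<close>.
\<close>

lemma absolutely_continuous_of_info_bound:
  assumes \<nu>: "shift_measure t \<nu>" and pos: "\<And>w. admissible t w \<Longrightarrow> 0 < measure \<mu> (cylinder t w)"
    and int: "\<And>n. 0 < n \<Longrightarrow> integrable \<nu> (\<lambda>x. - ln (measure \<mu> (cylinder t (init_word n x))))"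
    and bound: "\<And>n. 0 < n \<Longrightarrow> (\<integral>x. - ln (measure \<mu> (cylinder t (init_word n x))) \<partial>\<nu>)
        \<le> (\<integral>x. prob_space.info \<nu> (init_word n) x \<partial>\<nu>) + D"
  shows "absolutely_continuous \<mu> \<nu>"
proof -
  interpret \<nu>: shift_measure t \<nu> by fact
  have key: "measure \<nu> (word_set t n E) * (- ln (measure \<mu> (word_set t n E))) \<le> D + ln 2"
    if n: "0 < n" and A_pos: "0 < measure \<mu> (word_set t n E)" for n E
  proof -
    let ?A = "word_set t n E"
    define c1 where "c1 = 1 / (2 * measure \<mu> ?A)"
    \<comment> \<open>Normalising exactly on the complement would divide by its measure, which may
      be 0; the factor one half already keeps its mass small enough.\<close>
    define c2 :: real where "c2 = 1 / 2"
    have c: "0 < c1" "0 < c2" using A_pos by (auto simp: c1_def c2_def)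
    define q where "q w = (if length w = n then (if w \<in> E then c1 else c2) * measure \<mu> (cylinder t w) else 0)" for w
    have q_nn: "0 \<le> q w" for w using c by (simp add: q_def)
    have decomp: "(\<integral>\<^sup>+w. emeasure \<mu> (cylinder t w) * indicator {w \<in> E. length w = n} w \<partial>count_space UNIV) = emeasure \<mu> (word_set t n E)" for E
    proof -
      have "emeasure \<mu> (markov_shift t \<inter> word_set t n E) = (\<integral>\<^sup>+w. emeasure \<mu> (markov_shift t \<inter> cylinder t w) \<partial>count_space {w \<in> E. length w = n})"
        using sets.top[of "markov_borel t"] by (intro emeasure_word_decomp) auto
      moreover have "markov_shift t \<inter> cylinder t w = cylinder t w" for w by (auto simp: cylinder_def)
      moreover have "markov_shift t \<inter> word_set t n E = word_set t n E" by (auto simp: word_set_def)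
      ultimately show ?thesis by (simp add: nn_integral_count_space_indicator)
    qed
    have q_sum: "(\<integral>\<^sup>+w. ennreal (q w) \<partial>count_space UNIV) \<le> 1"
    proof -
      have "(\<integral>\<^sup>+w. ennreal (q w) \<partial>count_space UNIV)
        = (\<integral>\<^sup>+w. ennreal c1 * (emeasure \<mu> (cylinder t w) * indicator {w \<in> E. length w = n} w)
            + ennreal c2 * (emeasure \<mu> (cylinder t w) * indicator {w \<in> - E. length w = n} w) \<partial>count_space UNIV)"
        using c by (intro nn_integral_cong) (auto simp: q_def emeasure_eq_measure ennreal_mult[symmetric] indicator_def)
      also have "\<dots> = (\<integral>\<^sup>+w. ennreal c1 * (emeasure \<mu> (cylinder t w) * indicator {w \<in> E. length w = n} w) \<partial>count_space UNIV)
            + (\<integral>\<^sup>+w. ennreal c2 * (emeasure \<mu> (cylinder t w) * indicator {w \<in> - E. length w = n} w) \<partial>count_space UNIV)"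
        by (rule nn_integral_add) auto
      also have "\<dots> = ennreal c1 * emeasure \<mu> ?A + ennreal c2 * emeasure \<mu> (word_set t n (- E))"
        by (subst (1 2) nn_integral_cmult) (simp_all only: decomp, auto)
      also have "\<dots> = ennreal (c1 * measure \<mu> ?A + c2 * measure \<mu> (word_set t n (- E)))"
        using c by (simp add: emeasure_eq_measure ennreal_mult[symmetric] ennreal_plus[symmetric] del: ennreal_plus)
      also have "\<dots> \<le> ennreal 1"
        using A_pos prob_le_1[of "word_set t n (- E)"] by (intro ennreal_leI) (simp add: c1_def c2_def field_simps)
      finally show ?thesis by simp
    qed
    have adm: "0 < measure \<mu> (cylinder t (init_word n x))" if "x \<in> markov_shift t" for x
      using pos admissible_init_word[OF that n] by blast
    have q_pos: "AE x in \<nu>. 0 < q (init_word n x)"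
      by (rule AE_I2) (use adm c in \<open>auto simp: q_def\<close>)
    have ln_q: "- ln (q (init_word n x)) = - ln (measure \<mu> (cylinder t (init_word n x))) + (ln 2 + ln (measure \<mu> ?A) * indicator ?A x)"
      if "x \<in> space \<nu>" for x
      using that adm[of x] A_pos c by (auto simp: q_def word_set_def ln_div ln_mult indicator_def c1_def c2_def)
    have A_int: "integrable \<nu> (\<lambda>x. ln (measure \<mu> ?A) * indicat_real ?A x)"
      by (intro integrable_mult_right integrable_real_indicator) (auto simp: \<nu>.emeasure_eq_measure)
    have I: "integrable \<nu> (\<lambda>x. - ln (measure \<mu> (cylinder t (init_word n x))) + (ln 2 + ln (measure \<mu> ?A) * indicator ?A x))"
      using int[OF n] A_int by (intro Bochner_Integration.integrable_add) auto
    have "integrable \<nu> (\<lambda>x. - ln (q (init_word n x))) \<longleftrightarrow> integrable \<nu> (\<lambda>x. - ln (measure \<mu> (cylinder t (init_word n x))) + (ln 2 + ln (measure \<mu> ?A) * indicator ?A x))"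
      by (rule Bochner_Integration.integrable_cong[OF refl ln_q])
    from iffD2[OF this I] have Iq: "integrable \<nu> (\<lambda>x. - ln (q (init_word n x)))" .
    have "(\<integral>x. - ln (q (init_word n x)) \<partial>\<nu>) = (\<integral>x. - ln (measure \<mu> (cylinder t (init_word n x))) + (ln 2 + ln (measure \<mu> ?A) * indicator ?A x) \<partial>\<nu>)"
      by (rule Bochner_Integration.integral_cong[OF refl ln_q])
    also have "\<dots> = (\<integral>x. - ln (measure \<mu> (cylinder t (init_word n x))) \<partial>\<nu>) + (\<integral>x. ln 2 + ln (measure \<mu> ?A) * indicat_real ?A x \<partial>\<nu>)"
      using int[OF n] A_int by (intro Bochner_Integration.integral_add) auto
    also have "(\<integral>x. ln 2 + ln (measure \<mu> ?A) * indicat_real ?A x \<partial>\<nu>) = ln 2 + ln (measure \<mu> ?A) * measure \<nu> ?A"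
    proof -
      have "?A \<inter> markov_shift t = ?A" by (auto simp: word_set_def)
      then show ?thesis using A_int \<nu>.prob_space by (subst Bochner_Integration.integral_add) simp_all
    qed
    finally have "(\<integral>x. prob_space.info \<nu> (init_word n) x \<partial>\<nu>) \<le> (\<integral>x. - ln (measure \<mu> (cylinder t (init_word n x))) \<partial>\<nu>) + (ln 2 + ln (measure \<mu> ?A) * measure \<nu> ?A)"
      using \<nu>.gibbs_inequality(2)[OF \<nu>.init_word_measurable q_nn q_sum q_pos Iq] by simp
    then show ?thesis using bound[OF n] by (simp add: mult.commute)
  qed
  \<comment> \<open>All admissible cylinders of positive length have positive \<mu>-measure, so a
    \<mu>-null word set is empty.\<close>
  have zero: "measure \<nu> (word_set t n E) = 0" if "0 < n" "measure \<mu> (word_set t n E) = 0" for n E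
  proof -
    have "word_set t n E = {}"
    proof (rule ccontr)
      assume "word_set t n E \<noteq> {}"
      then obtain x where x: "x \<in> markov_shift t" "init_word n x \<in> E" by (auto simp: word_set_def)
      have "0 < measure \<mu> (cylinder t (init_word n x))" using pos admissible_init_word[OF x(1) that(1)] by blast
      also have "\<dots> \<le> measure \<mu> (word_set t n E)"
      proof (rule finite_measure_mono)
        show "cylinder t (init_word n x) \<subseteq> word_set t n E"
          using x by (auto simp: word_set_def cylinder_init_word)
      qed simp
      finally show False using that by simp
    qed
    then show ?thesis by simp
  qed
  show ?thesis
    unfolding absolutely_continuous_def
  proof
    fix Nl assume Nl: "Nl \<in> null_sets \<mu>"
    then have NS: "Nl \<in> sets (markov_borel t)" and N0: "measure \<mu> Nl = 0" by (auto simp: null_sets_def measure_def)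
    have le: "measure \<nu> Nl \<le> 0 + e" if e: "0 < e" for e
    proof -
      define C where "C = \<bar>D\<bar> + ln 2"
      have C: "0 < C" by (simp add: C_def add_nonneg_pos)
      \<comment> \<open>Solves \<open>C / (- ln \<eta>) = e / 2\<close>, so that word sets of
        \<mu>-measure below \<eta> have \<nu>-measure at most \<open>e / 2\<close>.\<close>
      define \<eta> where "\<eta> = exp (- (2 * C / e))"
      have \<eta>: "0 < \<eta>" "- ln \<eta> = 2 * C / e" by (auto simp: \<eta>_def)
      obtain n0 E0 where nE: "measure \<mu> (sym_diff Nl (word_set t n0 E0)) + measure \<nu> (sym_diff Nl (word_set t n0 E0)) < min (e/2) \<eta>"
        using cylinder_approximation[OF finite_measure_axioms sets_eq \<nu>.finite_measure_axioms \<nu>.sets_eq NS, of "min (e/2) \<eta>"] e \<eta> by auto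
      \<comment> \<open>The entropy bounds concern positive lengths, and \<open>n0\<close> might be
        0.\<close>
      define n where "n = Suc n0"
      define A where "A = word_set t n {w. take n0 w \<in> E0}"
      have A: "word_set t n0 E0 = A" unfolding A_def n_def by (rule word_set_refine) simp
      have sA: "A \<in> sets (markov_borel t)" unfolding A_def by simp
      have nn: "0 \<le> measure \<mu> (sym_diff Nl A)" "0 \<le> measure \<nu> (sym_diff Nl A)" by auto
      have "measure \<mu> A \<le> measure \<mu> (Nl \<union> sym_diff Nl A)" using NS sA by (intro finite_measure_mono) auto
      also have "\<dots> \<le> measure \<mu> Nl + measure \<mu> (sym_diff Nl A)" using NS sA by (intro measure_Un_le) auto
      finally have A\<mu>: "measure \<mu> A < \<eta>" using nE N0 nn unfolding A by linarith
      have "measure \<nu> Nl \<le> measure \<nu> (A \<union> sym_diff Nl A)" using NS sA by (intro \<nu>.finite_measure_mono) auto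
      also have "\<dots> \<le> measure \<nu> A + measure \<nu> (sym_diff Nl A)" using NS sA by (intro measure_Un_le) auto
      finally have N\<nu>: "measure \<nu> Nl \<le> measure \<nu> A + e/2" using nE nn unfolding A by linarith
      have "measure \<nu> A \<le> e / 2"
      proof (cases "measure \<mu> A = 0")
        case True
        then show ?thesis using zero[of n] e unfolding A_def n_def by simp
      next
        case False
        then have Ap: "0 < measure \<mu> A" using measure_nonneg[of \<mu> A] by linarith
        then have "ln (measure \<mu> A) \<le> ln \<eta>" using A\<mu> \<eta>(1) by simp
        then have "2 * C / e \<le> - ln (measure \<mu> A)" using \<eta>(2) by linarith
        then have "measure \<nu> A * (2 * C / e) \<le> measure \<nu> A * (- ln (measure \<mu> A))" by (intro mult_left_mono) auto
        also have "\<dots> \<le> D + ln 2" using key[of n] Ap unfolding A_def n_def by blast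
        also have "\<dots> \<le> C" by (simp add: C_def)
        finally have "measure \<nu> A * 2 * C \<le> e * C" using e by (simp add: field_simps)
        then show ?thesis using C by simp
      qed
      then show ?thesis using N\<nu> by simp
    qed
    have "measure \<nu> Nl \<le> 0" using le by (rule field_le_epsilon)
    then have "measure \<nu> Nl = 0" using measure_nonneg[of \<nu> Nl] by linarith
    then show "Nl \<in> null_sets \<nu>" using NS by (simp add: null_sets_def \<nu>.emeasure_eq_measure)
  qed
qed

end

section \<open>Bowen potentials\<close>

text \<open>Word sums are integrals over counting measures, whereas the hypotheses and the partition
  function use \<open>infsum\<close>; finite truncations mediate between the two.\<close>

lemma nn_integral_le_infsum:
  fixes F :: "'a::countable \<Rightarrow> ennreal"
  shows "(\<integral>\<^sup>+x. F x * indicator A x \<partial>count_space UNIV) \<le> infsum F A"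
proof -
  define u where "u k x = F x * indicator {x \<in> A. to_nat x < k} x" for k :: nat and x
  have fin: "finite {x \<in> A. to_nat x < k}" for k
    by (rule finite_subset[OF _ finite_vimageI[OF finite_lessThan[of k] inj_to_nat]]) auto
  have sup: "(SUP k. u k x) = F x * indicator A x" for x
  proof (rule antisym)
    show "(SUP k. u k x) \<le> F x * indicator A x" by (intro SUP_least) (auto simp: u_def indicator_def)
    have "u (Suc (to_nat x)) x = F x * indicator A x" by (simp add: u_def indicator_def)
    then show "F x * indicator A x \<le> (SUP k. u k x)" by (metis SUP_upper UNIV_I)
  qed
  have "(\<integral>\<^sup>+x. F x * indicator A x \<partial>count_space UNIV) = (SUP k. \<integral>\<^sup>+x. u k x \<partial>count_space UNIV)"
    unfolding sup[symmetric]
    by (intro nn_integral_monotone_convergence_SUP) (auto simp: incseq_def le_fun_def u_def indicator_def)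
  also have "\<dots> \<le> infsum F A"
  proof (rule SUP_least)
    fix k
    have "(\<integral>\<^sup>+x. u k x \<partial>count_space UNIV) = (\<integral>\<^sup>+x. F x \<partial>count_space {x \<in> A. to_nat x < k})"
      unfolding u_def by (rule nn_integral_count_space_indicator[symmetric]) auto
    also have "\<dots> = sum F {x \<in> A. to_nat x < k}" by (rule nn_integral_count_space_finite[OF fin])
    also have "\<dots> = infsum F {x \<in> A. to_nat x < k}" using fin by simp
    also have "\<dots> \<le> infsum F A" by (rule infsum_mono_neutral) (auto intro: nonneg_summable_on_complete)
    finally show "(\<integral>\<^sup>+x. u k x \<partial>count_space UNIV) \<le> infsum F A" .
  qed
  finally show ?thesis .
qed

lemma infsum_le_word_sum:
  fixes h :: "'a \<Rightarrow> 's::countable list"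
  assumes inj: "inj_on h A" and len: "\<And>x. x \<in> A \<Longrightarrow> length (h x) = n"
    and le: "\<And>x. x \<in> A \<Longrightarrow> F x \<le> \<phi> (h x)"
  shows "infsum F A \<le> word_sum n \<phi>"
proof -
  have "infsum F A = (SUP B\<in>{B. finite B \<and> B \<subseteq> A}. sum F B)"
    by (rule nonneg_infsum_complete) simp
  also have "\<dots> \<le> word_sum n \<phi>"
  proof (rule SUP_least)
    fix B assume "B \<in> {B. finite B \<and> B \<subseteq> A}"
    then have B: "finite B" "B \<subseteq> A" by auto
    have "sum F B \<le> (\<Sum>x\<in>B. \<phi> (h x))" using B le by (intro sum_mono) auto
    also have "\<dots> = sum \<phi> (h ` B)" using inj_on_subset[OF inj B(2)] by (simp add: sum.reindex)
    also have "\<dots> = (\<integral>\<^sup>+w. \<phi> w \<partial>count_space (h ` B))" using B by (simp add: nn_integral_count_space_finite)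
    also have "\<dots> = (\<integral>\<^sup>+w. \<phi> w * indicator (h ` B) w \<partial>count_space UNIV)"
      by (rule nn_integral_count_space_indicator) auto
    also have "\<dots> \<le> word_sum n \<phi>"
      unfolding word_sum_UNIV using B len by (intro nn_integral_mono) (auto simp: indicator_def)
    finally show "sum F B \<le> word_sum n \<phi>" .
  qed
  finally show ?thesis .
qed

section \<open>Concatenating, prolonging, closing and connecting admissible words\<close>

lemma admissible_append:
  assumes "u \<noteq> []" "v \<noteq> []"
  shows "admissible t (u @ v) \<longleftrightarrow> admissible t u \<and> admissible t v \<and> t (last u) (hd v) = 1"
proof
  assume L: "admissible t (u @ v)"
  have *: "t ((u @ v) ! i) ((u @ v) ! Suc i) = 1" if "Suc i < length (u @ v)" for i
    using L that by (auto simp: admissible_def)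
  have "t (u ! i) (u ! Suc i) = 1" if "Suc i < length u" for i
    using *[of i] that by (simp add: nth_append)
  moreover have "t (v ! i) (v ! Suc i) = 1" if "Suc i < length v" for i
    using *[of "length u + i"] that by (simp add: nth_append)
  moreover have "t (last u) (hd v) = 1"
    using *[of "length u - 1"] assms by (simp add: nth_append last_conv_nth hd_conv_nth)
  ultimately show "admissible t u \<and> admissible t v \<and> t (last u) (hd v) = 1"
    using assms by (simp add: admissible_def)
next
  assume R: "admissible t u \<and> admissible t v \<and> t (last u) (hd v) = 1"
  show "admissible t (u @ v)"
    unfolding admissible_def
  proof (intro conjI allI impI)
    fix i assume i: "Suc i < length (u @ v)"
    consider "Suc i < length u" | "Suc i = length u" | "length u \<le> i" by linarith
    then show "t ((u @ v) ! i) ((u @ v) ! Suc i) = 1"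
    proof cases
      case 1
      then show ?thesis using R by (simp add: nth_append admissible_def)
    next
      case 2
      then have "u ! i = last u" using assms by (metis diff_Suc_1 last_conv_nth)
      then show ?thesis using R 2 assms by (simp add: nth_append hd_conv_nth)
    next
      case 3
      then have "Suc (i - length u) < length v" using i by simp
      then have "t (v ! (i - length u)) (v ! Suc (i - length u)) = 1" using R by (auto simp: admissible_def)
      then show ?thesis using 3 by (simp add: nth_append Suc_diff_le)
    qed
  qed (use assms in auto)
qed

lemma admissible_single [simp]: "admissible t [a]"
  by (simp add: admissible_def)

text \<open>No row of the matrix vanishes, so a word can be prolonged forever by a fixed choice of
  successors; for the empty word an arbitrary letter serves as start.\<close>

lemma cylinder_nonempty:
  assumes tm: "transition_matrix t" and w: "w = [] \<or> admissible t w"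
  shows "\<exists>x. x \<in> cylinder t w"
proof -
  define nxt where "nxt a = (SOME b. t a b = 1)" for a
  have nxt: "t a (nxt a) = 1" for a
  proof -
    obtain b where "t a b \<noteq> 0" using tm unfolding transition_matrix_def by blast
    moreover have "t a b \<in> {0, 1}" using tm unfolding transition_matrix_def by blast
    ultimately have "t a b = 1" by auto
    then show ?thesis unfolding nxt_def by (rule someI)
  qed
  define v where "v = (if w = [] then [undefined] else w)"
  have v: "admissible t v" "v \<noteq> []" using w by (auto simp: v_def)
  define l where "l = length v - 1"
  define x where "x i = (if i < length v then v ! i else (nxt ^^ (i - l)) (v ! l))" for i
  have x_ge: "x i = (nxt ^^ (i - l)) (v ! l)" if "l \<le> i" for i
    using that v(2) by (cases "i = l") (auto simp: x_def l_def)
  have "t (x i) (x (Suc i)) = 1" for i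
  proof (cases "Suc i < length v")
    case True
    then show ?thesis using v(1) by (simp add: x_def admissible_def)
  next
    case False
    then have "l \<le> i" by (simp add: l_def)
    then have "x (Suc i) = nxt (x i)" using x_ge by (simp add: Suc_diff_le)
    then show ?thesis using nxt by simp
  qed
  then have "x \<in> cylinder t w" by (auto simp: cylinder_def markov_shift_def x_def v_def)
  then show ?thesis by blast
qed

text \<open>Admissibility of \<open>w @ [hd w]\<close> says that the last letter may be followed by
  the first, so \<open>w\<close> can be repeated.\<close>

lemma periodic_point:
  assumes w: "admissible t (w @ [hd w])" "w \<noteq> []"
  shows "\<exists>x\<in>cylinder t w. (shift_map ^^ length w) x = x"
proof -
  define n where "n = length w"
  have n: "0 < n" using w by (simp add: n_def)
  define x where "x i = w ! (i mod n)" for i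
  have "t (x i) (x (Suc i)) = 1" for i
  proof -
    define j where "j = i mod n"
    have j: "j < n" using n by (simp add: j_def)
    have "t ((w @ [hd w]) ! j) ((w @ [hd w]) ! Suc j) = 1" using w(1) j by (simp add: admissible_def n_def)
    moreover have "(w @ [hd w]) ! j = x i" using j by (simp add: x_def nth_append n_def j_def)
    moreover have "(w @ [hd w]) ! Suc j = x (Suc i)"
    proof (cases "Suc j = n")
      case True
      then have "Suc i mod n = 0" by (simp add: j_def mod_Suc)
      then show ?thesis using True w(2) by (simp add: x_def nth_append n_def hd_conv_nth)
    next
      case False
      then have "Suc i mod n = Suc j" using j by (simp add: j_def mod_Suc)
      then show ?thesis using False j by (simp add: x_def nth_append n_def)
    qed
    ultimately show ?thesis by simp
  qed
  then have "x \<in> cylinder t w" by (auto simp: cylinder_def markov_shift_def x_def n_def)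
  moreover have "(shift_map ^^ length w) x = x"
    by (auto simp: shift_map_funpow x_def n_def)
  ultimately show ?thesis by blast
qed

text \<open>BIP supplies every letter with a predecessor and a successor in one finite set. Mixing
  then has to join only the finitely many pairs from this set, and these share one sufficiently
  large time.\<close>

lemma connecting_words:
  assumes tm: "transition_matrix t" and mix: "topologically_mixing t" and bip: "BIP t"
  shows "\<exists>N W. 0 < N \<and> finite W \<and> (\<forall>c\<in>W. length c = N \<and> admissible t c) \<and>
    (\<forall>u v. (u = [] \<or> admissible t u) \<longrightarrow> (v = [] \<or> admissible t v) \<longrightarrow> (\<exists>c\<in>W. admissible t (u @ c @ v)))"
proof -
  obtain B where B: "finite B" "\<And>a. \<exists>b\<in>B. \<exists>b'\<in>B. t b a * t a b' = 1" using bip unfolding BIP_def by blast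
  have pre: "\<exists>b\<in>B. t b a = 1" and suc: "\<exists>b\<in>B. t a b = 1" for a
    using B(2)[of a] by auto
  have "\<forall>p. \<exists>m. \<forall>n>m. cylinder t [fst p] \<inter> (shift_map ^^ n) -` cylinder t [snd p] \<noteq> {}"
    using mix unfolding topologically_mixing_def by blast
  then obtain m where m: "\<And>p n. m p < n \<Longrightarrow> cylinder t [fst p] \<inter> (shift_map ^^ n) -` cylinder t [snd p] \<noteq> {}" by metis
  define n where "n = Suc (Max (insert 0 (m ` (B \<times> B))))"
  have mn: "m p < n" if "p \<in> B \<times> B" for p
    unfolding n_def less_Suc_eq_le using that B(1) by (intro Max_ge) auto
  have "\<forall>p\<in>B \<times> B. \<exists>x. x \<in> markov_shift t \<and> x 0 = fst p \<and> x n = snd p"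
  proof
    fix p assume "p \<in> B \<times> B"
    from m[OF mn[OF this]] show "\<exists>x. x \<in> markov_shift t \<and> x 0 = fst p \<and> x n = snd p"
      by (auto simp: cylinder_def shift_map_funpow)
  qed
  then obtain X where X: "\<And>p. p \<in> B \<times> B \<Longrightarrow> X p \<in> markov_shift t \<and> X p 0 = fst p \<and> X p n = snd p" by metis
  \<comment> \<open>A path of \<open>n\<close> steps has \<open>Suc n\<close> letters, both
    endpoints included.\<close>
  define W where "W = (\<lambda>p. init_word (Suc n) (X p)) ` (B \<times> B)"
  have Wadm: "admissible t c" "length c = Suc n" if cW: "c \<in> W" for c
  proof -
    obtain p where p: "p \<in> B \<times> B" "c = init_word (Suc n) (X p)" using cW unfolding W_def by blast
    then show "admissible t c" "length c = Suc n" using X[OF p(1)] admissible_init_word[of "X p" t "Suc n"] by auto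
  qed
  have "\<exists>c\<in>W. admissible t (u @ c @ v)"
    if u: "u = [] \<or> admissible t u" and v: "v = [] \<or> admissible t v" for u v
  proof -
    obtain b where b: "b \<in> B" "u \<noteq> [] \<Longrightarrow> t (last u) b = 1" using suc[of "last u"] by blast
    obtain b' where b': "b' \<in> B" "v \<noteq> [] \<Longrightarrow> t b' (hd v) = 1" using pre[of "hd v"] by blast
    define c where "c = init_word (Suc n) (X (b, b'))"
    have cW: "c \<in> W" using b b' by (auto simp: W_def c_def)
    have c: "c \<noteq> []" "hd c = b" "last c = b'"
      using X[of "(b, b')"] b b' by (auto simp: c_def init_word_def hd_map last_map simp del: upt_Suc)
    have cv: "admissible t (c @ v)"
      using Wadm[OF cW] c b' v by (cases "v = []") (auto simp: admissible_append)
    then have "admissible t (u @ c @ v)"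
      using c b u by (cases "u = []") (auto simp: admissible_append)
    with cW show ?thesis by blast
  qed
  then show ?thesis using Wadm B(1) by (intro exI[of _ "Suc n"] exI[of _ W]) (auto simp: W_def)
qed

section \<open>Weights of words for an almost additive Bowen sequence\<close>

locale bowen_potential =
  fixes t :: "'s::countable \<Rightarrow> 's \<Rightarrow> nat" and f :: "nat \<Rightarrow> (nat \<Rightarrow> 's) \<Rightarrow> real" and C B :: real
  assumes tm: "transition_matrix t" and mix: "topologically_mixing t" and bip: "BIP t"
    and pc: "positive_continuous_seq t f"
    and C_nonneg: "0 \<le> C"
    and aa_lower: "\<And>n m x. 1 \<le> n \<Longrightarrow> 1 \<le> m \<Longrightarrow> x \<in> markov_shift t \<Longrightarrow> f n x * f m ((shift_map ^^ n) x) * exp (- C) \<le> f (n + m) x"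
    and aa_upper: "\<And>n m x. 1 \<le> n \<Longrightarrow> 1 \<le> m \<Longrightarrow> x \<in> markov_shift t \<Longrightarrow> f (n + m) x \<le> f n x * f m ((shift_map ^^ n) x) * exp C"
    and bowen: "\<And>n x y. 1 \<le> n \<Longrightarrow> x \<in> markov_shift t \<Longrightarrow> y \<in> markov_shift t \<Longrightarrow> init_word n x = init_word n y \<Longrightarrow> f n x \<le> B * f n y"
    and summ: "(\<Sum>\<^sub>\<infinity>a\<in>UNIV. SUP x\<in>cylinder t [a]. ennreal (f 1 x)) < \<infinity>"
begin

lemma f_pos: "1 \<le> n \<Longrightarrow> x \<in> markov_shift t \<Longrightarrow> 0 < f n x"
  using pc by (simp add: positive_continuous_seq_def)

lemma f_measurable: "1 \<le> n \<Longrightarrow> f n \<in> borel_measurable (markov_borel t)"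
  using pc by (intro continuous_imp_markov_borel_measurable) (simp add: positive_continuous_seq_def)

lemma B_ge_1: "1 \<le> B"
proof -
  obtain x where "x \<in> markov_shift t" using cylinder_nonempty[OF tm, of "[]"] by auto
  then show ?thesis using bowen[of 1 x x] f_pos[of 1 x] by simp
qed

definition rep :: "'s list \<Rightarrow> nat \<Rightarrow> 's" where
  "rep w = (SOME x. x \<in> cylinder t w)"

lemma rep_cylinder: "admissible t w \<Longrightarrow> rep w \<in> cylinder t w"
  unfolding rep_def using cylinder_nonempty[OF tm, of w] by (intro someI_ex[where P = "\<lambda>x. x \<in> cylinder t w"]) simp

text \<open>One number per cylinder: by the Bowen property the chosen point matters only up to the
  factor \<open>B\<close>. The value 0 encodes inadmissibility, and 1 on the empty word lets the
  concatenation inequalities include it.\<close>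

definition weight :: "'s list \<Rightarrow> real" where
  "weight w = (if w = [] then 1 else if admissible t w then f (length w) (rep w) else 0)"

lemma weight_pos: "admissible t w \<Longrightarrow> 0 < weight w"
  using rep_cylinder[of w] f_pos[of "length w" "rep w"]
  by (auto simp: weight_def cylinder_def admissible_def Suc_le_eq)

lemma weight_nonneg: "0 \<le> weight w"
  using weight_pos[of w] by (auto simp: weight_def)

lemma f_le_weight: "x \<in> cylinder t w \<Longrightarrow> admissible t w \<Longrightarrow> f (length w) x \<le> B * weight w"
  and weight_le_f: "x \<in> cylinder t w \<Longrightarrow> admissible t w \<Longrightarrow> weight w \<le> B * f (length w) x"
proof -
  assume x: "x \<in> cylinder t w" and w: "admissible t w"
  have "1 \<le> length w" using w by (cases w) (auto simp: admissible_def)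
  moreover have "w \<noteq> []" using w by (simp add: admissible_def)
  moreover have "x \<in> markov_shift t" "rep w \<in> markov_shift t" "init_word (length w) x = init_word (length w) (rep w)"
    using x rep_cylinder[OF w] by (auto simp: cylinder_init_word)
  ultimately show "f (length w) x \<le> B * weight w" "weight w \<le> B * f (length w) x"
    using bowen w by (auto simp: weight_def)
qed

lemma append_point:
  assumes "admissible t (u @ v)" "u \<noteq> []" "v \<noteq> []"
  obtains x where "x \<in> cylinder t (u @ v)" "x \<in> cylinder t u" "(shift_map ^^ length u) x \<in> cylinder t v" "admissible t u" "admissible t v"
proof -
  obtain x where x: "x \<in> cylinder t (u @ v)" using rep_cylinder[OF assms(1)] by blast
  have "init_word (length u) x @ init_word (length v) ((shift_map ^^ length u) x) = u @ v" "x \<in> markov_shift t"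
    using x by (auto simp: cylinder_init_word init_word_add)
  then have "x \<in> cylinder t u" "(shift_map ^^ length u) x \<in> cylinder t v"
    using shift_map_funpow_markov by (auto simp: cylinder_init_word)
  then show thesis using that x assms admissible_append by blast
qed

text \<open>\<open>B\<close> is paid three times, for \<open>u @ v\<close>, \<open>u\<close> and
  \<open>v\<close>, in passing between a common point and the representatives.\<close>

lemma weight_append_le: "weight (u @ v) \<le> exp C * B ^ 3 * weight u * weight v"
proof -
  have D: "1 \<le> exp C * B ^ 3" using B_ge_1 C_nonneg by (simp add: mult_ge1_I)
  consider "u = []" | "v = []" | "u \<noteq> []" "v \<noteq> []" "\<not> admissible t (u @ v)" | "u \<noteq> []" "v \<noteq> []" "admissible t (u @ v)" by blast
  then show ?thesis
  proof cases
    case 1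
    then show ?thesis using mult_right_mono[OF D weight_nonneg[of v]] by (simp add: weight_def)
  next
    case 2
    then show ?thesis using mult_right_mono[OF D weight_nonneg[of u]] by (simp add: weight_def)
  next
    case 3
    then show ?thesis using B_ge_1 weight_nonneg by (simp add: weight_def[of "u @ v"])
  next
    case 4
    obtain x where x: "x \<in> cylinder t (u @ v)" "x \<in> cylinder t u" "(shift_map ^^ length u) x \<in> cylinder t v"
      and a: "admissible t u" "admissible t v" by (rule append_point[OF 4(3,1,2)])
    have xS: "x \<in> markov_shift t" using x by (simp add: cylinder_def)
    have l: "1 \<le> length u" "1 \<le> length v" using 4 by (auto simp: Suc_le_eq)
    have "weight (u @ v) \<le> B * f (length u + length v) x" using weight_le_f[OF x(1) 4(3)] by simp
    also have "\<dots> \<le> B * (f (length u) x * f (length v) ((shift_map ^^ length u) x) * exp C)"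
      using B_ge_1 by (intro mult_left_mono aa_upper l xS) auto
    also have "\<dots> \<le> B * ((B * weight u) * (B * weight v) * exp C)"
      using B_ge_1 f_le_weight[OF x(2) a(1)] f_le_weight[OF x(3) a(2)] f_pos[OF l(1) xS] f_pos[OF l(2) shift_map_funpow_markov[OF xS]] weight_nonneg
      by (intro mult_left_mono mult_right_mono mult_mono) (auto simp: less_imp_le)
    finally show ?thesis by (simp add: power3_eq_cube mult_ac)
  qed
qed

lemma weight_append_ge:
  assumes "admissible t (u @ v)"
  shows "exp (- C) / B ^ 3 * weight u * weight v \<le> weight (u @ v)"
proof -
  have D: "exp (- C) / B ^ 3 \<le> 1"
  proof -
    have "exp (- C) \<le> 1" "1 \<le> B ^ 3" using C_nonneg B_ge_1 by auto
    then have "exp (- C) \<le> B ^ 3" by linarith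
    then show ?thesis using B_ge_1 by (simp add: divide_le_eq)
  qed
  show ?thesis
  proof (cases "u = [] \<or> v = []")
    case True
    then show ?thesis using mult_right_mono[OF D weight_nonneg[of u]] mult_right_mono[OF D weight_nonneg[of v]] by (auto simp: weight_def)
  next
    case False
    then have ne: "u \<noteq> []" "v \<noteq> []" by auto
    obtain x where x: "x \<in> cylinder t (u @ v)" "x \<in> cylinder t u" "(shift_map ^^ length u) x \<in> cylinder t v"
      and a: "admissible t u" "admissible t v" by (rule append_point[OF assms ne])
    have xS: "x \<in> markov_shift t" using x by (simp add: cylinder_def)
    have l: "1 \<le> length u" "1 \<le> length v" using False by (auto simp: Suc_le_eq)
    have "weight u * weight v * exp (- C) \<le> (B * f (length u) x) * (B * f (length v) ((shift_map ^^ length u) x)) * exp (- C)"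
      using weight_le_f[OF x(2) a(1)] weight_le_f[OF x(3) a(2)] weight_nonneg B_ge_1 f_pos[OF l(1) xS]
      by (intro mult_right_mono mult_mono) auto
    also have "\<dots> = B ^ 2 * (f (length u) x * f (length v) ((shift_map ^^ length u) x) * exp (- C))"
      by (simp add: power2_eq_square mult_ac)
    also have "\<dots> \<le> B ^ 2 * f (length u + length v) x" by (intro mult_left_mono aa_lower l xS) auto
    also have "\<dots> \<le> B ^ 2 * (B * weight (u @ v))" using f_le_weight[OF x(1) assms] by (intro mult_left_mono) auto
    finally show ?thesis using B_ge_1 by (simp add: field_simps power2_eq_square power3_eq_cube)
  qed
qed

lemma quasi_multiplicative_weight: "\<exists>\<kappa> N. quasi_multiplicative weight (exp C * B ^ 3) \<kappa> N"
proof -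
  obtain N W where N: "0 < N" and W: "finite W" "\<And>c. c \<in> W \<Longrightarrow> length c = N" "\<And>c. c \<in> W \<Longrightarrow> admissible t c"
    and conn: "\<And>u v. (u = [] \<or> admissible t u) \<Longrightarrow> (v = [] \<or> admissible t v) \<Longrightarrow> \<exists>c\<in>W. admissible t (u @ c @ v)"
    using connecting_words[OF tm mix bip] by metis
  define d where "d = exp (- C) / B ^ 3"
  have d: "0 < d" using B_ge_1 by (simp add: d_def)
  have Wne: "W \<noteq> {}" using conn[of "[]" "[]"] by auto
  define \<kappa>0 where "\<kappa>0 = Min (weight ` W)"
  have \<kappa>0: "0 < \<kappa>0" "\<And>c. c \<in> W \<Longrightarrow> \<kappa>0 \<le> weight c"
    using W Wne weight_pos by (auto simp: \<kappa>0_def)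
  \<comment> \<open>A factor \<open>d\<close> for each of the two joints of
    \<open>u @ c @ v\<close>, and the least weight of a connecting word, which is positive because
    \<open>W\<close> is finite.\<close>
  define \<kappa> where "\<kappa> = d ^ 2 * \<kappa>0"
  have "quasi_multiplicative weight (exp C * B ^ 3) \<kappa> N"
  proof
    show "weight [] = 1" by (simp add: weight_def)
    show "0 < \<kappa>" using d \<kappa>0 by (simp add: \<kappa>_def)
    show "\<exists>c. length c = N \<and> \<kappa> * weight u * weight v \<le> weight (u @ c @ v)" for u v
    proof (cases "(u = [] \<or> admissible t u) \<and> (v = [] \<or> admissible t v)")
      case True
      then obtain c where c: "c \<in> W" "admissible t (u @ c @ v)" using conn by blast
      have cne: "c \<noteq> []" using W(3)[OF c(1)] by (simp add: admissible_def)
      have cv: "admissible t (c @ v)" using c(2) cne by (cases "u = []") (auto simp: admissible_append)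
      have "\<kappa> * weight u * weight v = d * weight u * (d * \<kappa>0 * weight v)" by (simp add: \<kappa>_def power2_eq_square mult_ac)
      also have "\<dots> \<le> d * weight u * (d * weight c * weight v)"
        using d \<kappa>0(2)[OF c(1)] weight_nonneg by (intro mult_left_mono mult_right_mono mult_nonneg_nonneg) auto
      also have "\<dots> \<le> d * weight u * weight (c @ v)"
        using d weight_append_ge[OF cv] weight_nonneg by (intro mult_left_mono mult_nonneg_nonneg) (auto simp: d_def)
      also have "\<dots> \<le> weight (u @ c @ v)" using weight_append_ge[OF c(2)] by (simp add: d_def)
      finally show ?thesis using W(2)[OF c(1)] by blast
    next
      \<comment> \<open>One factor on the left is 0, so any word of the right length will
        do.\<close>
      case False
      then have "weight u = 0 \<or> weight v = 0" by (auto simp: weight_def)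
      moreover obtain c where "c \<in> W" using Wne by blast
      ultimately show ?thesis using W(2) weight_nonneg by (intro exI[of _ c]) auto
    qed
    have "(\<integral>\<^sup>+a. ennreal (weight [a]) \<partial>count_space UNIV) \<le> (\<integral>\<^sup>+a. (SUP x\<in>cylinder t [a]. ennreal (f 1 x)) * indicator UNIV a \<partial>count_space UNIV)"
      using rep_cylinder by (intro nn_integral_mono) (auto simp: weight_def intro: SUP_upper)
    also have "\<dots> \<le> (\<Sum>\<^sub>\<infinity>a\<in>UNIV. SUP x\<in>cylinder t [a]. ennreal (f 1 x))" by (rule nn_integral_le_infsum)
    finally show "(\<integral>\<^sup>+a. ennreal (weight [a]) \<partial>count_space UNIV) < \<infinity>" using summ by (rule le_less_trans)
  qed (use N weight_nonneg weight_append_le in auto)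
  then show ?thesis by blast
qed

end

lemma integral_ext_integrable:
  assumes "integrable M g" shows "integral_ext M g = ereal (\<integral>x. g x \<partial>M)"
proof -
  have "(\<integral>\<^sup>+x. ennreal (g x) \<partial>M) \<noteq> \<infinity>" "(\<integral>\<^sup>+x. ennreal (- g x) \<partial>M) \<noteq> \<infinity>"
    using assms by (auto simp: real_integrable_def)
  then obtain a b where "(\<integral>\<^sup>+x. ennreal (g x) \<partial>M) = ennreal a" "0 \<le> a" "(\<integral>\<^sup>+x. ennreal (- g x) \<partial>M) = ennreal b" "0 \<le> b"
    by (metis ennreal_cases infinity_ennreal_def)
  then show ?thesis unfolding integral_ext_def real_lebesgue_integral_def[OF assms] by simp
qed

text \<open>The constants \<kappa> and \<open>N\<close> come out of a lemma inside
  \<open>bowen_potential\<close>, so the two theories are joined in a separate locale.\<close>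

locale weighted_bowen_potential = bowen_potential t f C B +
  quasi_multiplicative "bowen_potential.weight t f" "exp C * B ^ 3" \<kappa> N
  for t :: "'s::countable \<Rightarrow> 's \<Rightarrow> nat" and f :: "nat \<Rightarrow> (nat \<Rightarrow> 's) \<Rightarrow> real" and C B \<kappa> :: real and N :: nat
begin

lemma weight_le_Z: "weight w \<le> Z (length w)"
proof -
  have "ennreal (weight w) \<le> S (length w)" unfolding S_def by (rule word_sum_ge) simp
  then show ?thesis by (simp add: S_Z Z_nonneg)
qed

lemma gibbs_weights_measure_exists:
  "\<exists>\<mu> K. 0 < K \<and> \<mu> \<in> invariant_measures t
     \<and> (\<forall>w. measure \<mu> (cylinder t w) \<le> K * (weight w * exp (- real (length w) * P)))
     \<and> (\<forall>w. weight w * exp (- real (length w) * P) \<le> K * measure \<mu> (cylinder t w))"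
proof -
  obtain p K where K: "0 < K" and p: "p [] = 1" "\<And>w. 0 \<le> p w"
    "\<And>w. (\<integral>\<^sup>+a. ennreal (p (w @ [a])) \<partial>count_space UNIV) = ennreal (p w)"
    "\<And>w. (\<integral>\<^sup>+a. ennreal (p (a # w)) \<partial>count_space UNIV) = ennreal (p w)"
    and upper: "\<And>w. p w \<le> K * (weight w * exp (- real (length w) * P))"
    and lower: "\<And>w. weight w * exp (- real (length w) * P) \<le> K * p w"
    using invariant_weights_exist by blast
  have "p w = 0" if "w \<noteq> []" "\<not> admissible t w" for w
    using upper[of w] p(2)[of w] that by (simp add: weight_def)
  from invariant_measure_exists[OF p(2,1,3,4) this]
  obtain \<mu> where \<mu>: "\<mu> \<in> invariant_measures t" "\<And>w. measure \<mu> (cylinder t w) = p w" by blast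
  show ?thesis by (rule exI[of _ \<mu>], rule exI[of _ K]) (simp only: \<mu> K upper lower simp_thms)
qed

section \<open>The Gurevich pressure is the growth rate of the word sums\<close>

lemma partition_function_upper:
  assumes n: "0 < n" shows "partition_function t f a n \<le> ennreal (B * Z n)"
proof -
  have "partition_function t f a n \<le> word_sum n (\<lambda>w. ennreal B * ennreal (weight w))"
    unfolding partition_function_def
  proof (rule infsum_le_word_sum[where h = "init_word n"])
    show "inj_on (init_word n) {x \<in> markov_shift t. (shift_map ^^ n) x = x}"
    proof (rule inj_onI, clarify)
      fix x y :: "nat \<Rightarrow> 's"
      assume x: "(shift_map ^^ n) x = x" and y: "(shift_map ^^ n) y = y" and eq: "init_word n x = init_word n y"
      have per: "z (i mod n) = z i" if "(shift_map ^^ n) z = z" for z :: "nat \<Rightarrow> 's" and i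
      proof -
        have z: "z (j + n) = z j" for j using fun_cong[OF that, of j] by (simp add: shift_map_funpow)
        have "z (j + k * n) = z j" for j k
        proof (induction k)
          case (Suc k)
          then show ?case using z[of "j + k * n"] by (simp add: add_ac)
        qed simp
        from this[of "i mod n" "i div n"] show ?thesis by simp
      qed
      show "x = y"
      proof
        fix i
        have "x (i mod n) = y (i mod n)" using eq n by (simp add: init_word_eq_iff)
        then show "x i = y i" using per[OF x, of i] per[OF y, of i] by simp
      qed
    qed
    fix x assume "x \<in> {x \<in> markov_shift t. (shift_map ^^ n) x = x}"
    then have x: "x \<in> markov_shift t" by simp
    have "f n x \<le> B * weight (init_word n x)"
      using f_le_weight[OF _ admissible_init_word[OF x n], of x] x by (simp add: cylinder_init_word)
    moreover have "0 \<le> B * weight (init_word n x)" using B_ge_1 weight_nonneg by simp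
    ultimately have "f n x * indicator (cylinder t [a]) x \<le> B * weight (init_word n x)" by (simp add: indicator_def)
    then show "ennreal (f n x * indicator (cylinder t [a]) x) \<le> ennreal B * ennreal (weight (init_word n x))"
      using B_ge_1 weight_nonneg by (simp add: ennreal_mult[symmetric] ennreal_leI)
  qed simp
  also have "\<dots> = ennreal (B * Z n)"
    using B_ge_1 Z_nonneg by (simp add: word_sum_cmult S_def[symmetric] S_Z ennreal_mult)
  finally show ?thesis .
qed

text \<open>Each \<open>v\<close> is closed up to a loop through \<open>a\<close>; \<open>v\<close>
  can be read off the resulting periodic point at a fixed position, so distinct words give distinct
  points.\<close>

lemma partition_function_lower:
  "\<exists>c>0. \<forall>m. ennreal (c * Z m) \<le> partition_function t f a (1 + N + m + N)"
proof -
  \<comment> \<open>\<open>\<kappa>^2 * weight [a]\<close> stems from the two connections; dividing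
    by the submultiplicativity constant detaches the closing letter, and dividing by
    \<open>B\<close> passes from the weight to \<open>f\<close>.\<close>
  define c where "c = \<kappa>^2 * weight [a] / (exp C * B ^ 3) / B"
  have c: "0 < c" using \<kappa>_pos weight_pos[of "[a]"] B_ge_1 by (simp add: c_def)
  have "ennreal (c * Z m) \<le> partition_function t f a (1 + N + m + N)" for m
  proof -
    define n where "n = 1 + N + m + N"
    define V where "V = {v. length v = m \<and> 0 < weight v}"
    define \<theta> where "\<theta> v x \<longleftrightarrow> x \<in> markov_shift t \<and> (shift_map ^^ n) x = x \<and> x 0 = a
        \<and> take m (drop (1 + N) (init_word n x)) = v \<and> c * weight v \<le> f n x" for v x
    have ex: "\<exists>x. \<theta> v x" if v: "v \<in> V" for v
    proof -
      have wa: "0 < weight [a]" by (rule weight_pos) simp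
      have vp: "length v = m" "0 < weight v" using v by (auto simp: V_def)
      obtain c1 where c1: "length c1 = N" "\<kappa> * weight [a] * weight v \<le> weight ([a] @ c1 @ v)" using g_connect by blast
      \<comment> \<open>Connecting back to \<open>[a]\<close> certifies that the last letter of
        \<open>c2\<close> may be followed by \<open>a\<close>, which closes the loop.\<close>
      obtain c2 where c2: "length c2 = N" "\<kappa> * weight ([a] @ c1 @ v) * weight [a] \<le> weight (([a] @ c1 @ v) @ c2 @ [a])" using g_connect by blast
      define w where "w = ([a] @ c1 @ v) @ c2"
      have lw: "length w = n" by (simp add: w_def n_def c1 c2 vp)
      have "\<kappa>^2 * weight [a] * weight v * weight [a] = \<kappa> * (\<kappa> * weight [a] * weight v) * weight [a]"
        by (simp add: power2_eq_square mult_ac)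
      also have "\<dots> \<le> \<kappa> * weight ([a] @ c1 @ v) * weight [a]"
        using c1(2) \<kappa>_pos wa by (intro mult_left_mono mult_right_mono) auto
      also have "\<dots> \<le> weight (w @ [a])" using c2(2) by (simp add: w_def)
      finally have 1: "\<kappa>^2 * weight [a] * weight v * weight [a] \<le> weight (w @ [a])" .
      have "0 < \<kappa>^2 * weight [a] * weight v * weight [a]" using \<kappa>_pos wa vp by simp
      then have adm: "admissible t (w @ [a])" using 1 by (auto simp: weight_def split: if_splits)
      have hd: "hd w = a" "w \<noteq> []" by (auto simp: w_def)
      obtain x where x: "x \<in> cylinder t w" "(shift_map ^^ length w) x = x"
        using periodic_point[of t w] adm hd by auto
      have admw: "admissible t w" using adm hd by (simp add: admissible_append)
      have "\<kappa>^2 * weight [a] * weight v * weight [a] \<le> (exp C * B ^ 3) * weight w * weight [a]"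
        using 1 g_append_le[of w "[a]"] by linarith
      then have "\<kappa>^2 * weight [a] * weight v \<le> (exp C * B ^ 3) * weight w" by (rule mult_right_le_imp_le[OF _ wa])
      also have "\<dots> \<le> (exp C * B ^ 3) * (B * f n x)"
        using weight_le_f[OF x(1) admw] B_ge_1 lw by (intro mult_left_mono) auto
      finally have "c * weight v \<le> f n x" using B_ge_1 by (simp add: c_def field_simps)
      moreover have iw: "init_word n x = w" "x \<in> markov_shift t" using x(1) lw by (auto simp: cylinder_init_word)
      moreover have "x 0 = a"
      proof -
        have "x 0 = init_word n x ! 0" by (simp add: n_def)
        then show ?thesis using iw hd by (simp add: hd_conv_nth)
      qed
      moreover have "take m (drop (1 + N) w) = v" by (simp add: w_def c1 vp)
      ultimately show ?thesis unfolding \<theta>_def using x(2) lw by (intro exI[of _ x]) auto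
    qed
    define X where "X v = (SOME x. \<theta> v x)" for v
    have X: "\<theta> v (X v)" if "v \<in> V" for v unfolding X_def using ex[OF that] by (rule someI_ex)
    have inj: "inj_on X V" by (rule inj_onI) (metis X \<theta>_def)
    have "ennreal (c * Z m) = word_sum m (\<lambda>v. ennreal c * ennreal (weight v))"
      using c by (simp add: word_sum_cmult S_def[symmetric] S_Z ennreal_mult Z_nonneg)
    also have "\<dots> = (\<integral>\<^sup>+v. ennreal (c * weight v) * indicator V v \<partial>count_space UNIV)"
      unfolding word_sum_UNIV using c weight_nonneg
      by (intro nn_integral_cong) (auto simp: V_def indicator_def ennreal_mult less_le)
    also have "\<dots> \<le> (\<integral>\<^sup>+v. ennreal (f n (X v) * indicator (cylinder t [a]) (X v)) * indicator V v \<partial>count_space UNIV)"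
    proof (rule nn_integral_mono)
      fix v
      show "ennreal (c * weight v) * indicator V v \<le> ennreal (f n (X v) * indicator (cylinder t [a]) (X v)) * indicator V v"
        using X[of v] by (auto simp: indicator_def \<theta>_def cylinder_def intro: ennreal_leI)
    qed
    also have "\<dots> \<le> (\<Sum>\<^sub>\<infinity>v\<in>V. ennreal (f n (X v) * indicator (cylinder t [a]) (X v)))"
      by (rule nn_integral_le_infsum)
    also have "\<dots> = (\<Sum>\<^sub>\<infinity>x\<in>X ` V. ennreal (f n x * indicator (cylinder t [a]) x))"
      using infsum_reindex[OF inj, of "\<lambda>x. ennreal (f n x * indicator (cylinder t [a]) x)"] by (simp add: o_def)
    also have "\<dots> \<le> partition_function t f a n"
      unfolding partition_function_def
      by (rule infsum_mono_neutral) (use X in \<open>auto simp: \<theta>_def intro: nonneg_summable_on_complete\<close>)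
    finally show ?thesis unfolding n_def .
  qed
  with c show ?thesis by blast
qed

text \<open>The partition function lies between constant multiples of
  \<open>exp (real n * P)\<close>, the lower bound holding from the length \<open>1 + N + N\<close>
  on that closing a loop takes up.\<close>

lemma gurevich_pressure_eq: "gurevich_pressure t f = ereal P"
proof -
  have lim: "(\<lambda>n. log_ext (partition_function t f a n) / ereal (real n)) \<longlonglongrightarrow> ereal P" for a
  proof -
    obtain c where c: "0 < c" "\<And>m. ennreal (c * Z m) \<le> partition_function t f a (1 + N + m + N)"
      using partition_function_lower by blast
    define z where "z n = enn2real (partition_function t f a n)" for n
    define k where "k = 1 + N + N"
    have pf_fin: "partition_function t f a n = ennreal (z n)" if "0 < n" for n
    proof -
      have "partition_function t f a n < \<top>" using partition_function_upper[OF that, of a] by (auto intro: le_less_trans)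
      then show ?thesis by (simp add: z_def)
    qed
    have z_le: "z n \<le> B * (E * exp (real n * P))" if "0 < n" for n
    proof -
      have "z n \<le> B * Z n" using partition_function_upper[OF that, of a] pf_fin[OF that] B_ge_1 Z_nonneg[of n] by simp
      also have "\<dots> \<le> B * (E * exp (real n * P))" using B_ge_1 by (intro mult_left_mono Z_le_exp) auto
      finally show ?thesis .
    qed
    have z_ge: "c / E * exp (- real k * P) * exp (real n * P) \<le> z n" if "k \<le> n" for n
    proof -
      define m where "m = n - k"
      have n: "n = 1 + N + m + N" "0 < n" using that by (auto simp: m_def k_def)
      have "exp (- real k * P) * exp (real n * P) = exp (real m * P)"
        by (simp add: n k_def exp_add[symmetric] algebra_simps)
      also have "\<dots> \<le> E * Z m" by (rule Z_ge_exp)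
      finally have "c / E * (exp (- real k * P) * exp (real n * P)) \<le> c / E * (E * Z m)"
        using c E_pos by (intro mult_left_mono) auto
      also have "\<dots> = c * Z m" using E_pos by simp
      also have "\<dots> \<le> z n"
      proof -
        have "ennreal (c * Z m) \<le> ennreal (z n)" using c(2)[of m] pf_fin[OF n(2)] n(1) by simp
        then show ?thesis by (simp add: z_def)
      qed
      finally show ?thesis by (simp add: mult_ac)
    qed
    define c1 where "c1 = c / E * exp (- real k * P)"
    define c2 where "c2 = B * E"
    have c12: "0 < c1" "0 < c2" using c E_pos B_ge_1 by (auto simp: c1_def c2_def)
    have z_pos: "0 < z n" if "k \<le> n" for n
    proof -
      have "0 < c1 * exp (real n * P)" using c12 by simp
      then show ?thesis using z_ge[OF that] unfolding c1_def by linarith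
    qed
    have ln_z: "ln c1 / real n + P \<le> ln (z n) / real n" "ln (z n) / real n \<le> ln c2 / real n + P" if n: "k \<le> n" for n
    proof -
      have n0: "0 < n" using n by (simp add: k_def)
      have "0 < c1 * exp (real n * P)" using c12 by simp
      moreover have "c1 * exp (real n * P) \<le> z n" using z_ge[OF n] unfolding c1_def .
      ultimately have "ln (c1 * exp (real n * P)) \<le> ln (z n)" using z_pos[OF n] by (subst ln_le_cancel_iff)
      then have "ln c1 + real n * P \<le> ln (z n)" using c12 by (simp add: ln_mult)
      then show "ln c1 / real n + P \<le> ln (z n) / real n"
        using n0 divide_right_mono[of "ln c1 + real n * P" "ln (z n)" "real n"] by (simp add: add_divide_distrib)
      have "0 < c2 * exp (real n * P)" using c12 by simp
      moreover have "z n \<le> c2 * exp (real n * P)" using z_le[OF n0] by (simp add: c2_def mult_ac)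
      ultimately have "ln (z n) \<le> ln (c2 * exp (real n * P))" using z_pos[OF n] by (subst ln_le_cancel_iff)
      then have "ln (z n) \<le> ln c2 + real n * P" using c12 by (simp add: ln_mult)
      then show "ln (z n) / real n \<le> ln c2 / real n + P" using n0 by (simp add: field_simps)
    qed
    have l1: "(\<lambda>n. ln c1 / real n + P) \<longlonglongrightarrow> P" and l2: "(\<lambda>n. ln c2 / real n + P) \<longlonglongrightarrow> P"
      using tendsto_add[OF lim_const_over_n tendsto_const[of P]] by (auto simp del: tendsto_const)
    have "(\<lambda>n. ln (z n) / real n) \<longlonglongrightarrow> P"
      by (rule tendsto_sandwich[OF _ _ l1 l2]) (use ln_z in \<open>auto simp: eventually_sequentially\<close>)
    then have "(\<lambda>n. ereal (ln (z n) / real n)) \<longlonglongrightarrow> ereal P" by (rule tendsto_ereal)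
    then show ?thesis
    proof (rule Lim_transform_eventually)
      show "\<forall>\<^sub>F n in sequentially. ereal (ln (z n) / real n) = log_ext (partition_function t f a n) / ereal (real n)"
        using eventually_ge_at_top[of k]
      proof eventually_elim
        fix n assume n: "k \<le> n"
        then have "0 < n" by (simp add: k_def)
        then show "ereal (ln (z n) / real n) = log_ext (partition_function t f a n) / ereal (real n)"
          using pf_fin[of n] z_pos[OF n] by (simp add: log_ext_def)
      qed
    qed
  qed
  show ?thesis
    unfolding gurevich_pressure_def
  proof (rule the_equality)
    show "\<forall>a. (\<lambda>n. log_ext (partition_function t f a n) / ereal (real n)) \<longlonglongrightarrow> ereal P" using lim by blast
    show "Q = ereal P" if "\<forall>a. (\<lambda>n. log_ext (partition_function t f a n) / ereal (real n)) \<longlonglongrightarrow> Q" for Q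
      using that lim LIMSEQ_unique by blast
  qed
qed

lemma ln_f_almost_additive:
  assumes "1 \<le> n" "1 \<le> m" "x \<in> markov_shift t"
  shows "\<bar>ln (f (n + m) x) - ln (f n x) - ln (f m ((shift_map ^^ n) x))\<bar> \<le> C"
proof -
  have pos: "0 < f n x" "0 < f m ((shift_map ^^ n) x)" "0 < f (n + m) x"
    using f_pos[OF assms(1,3)] f_pos[OF assms(2) shift_map_funpow_markov[OF assms(3)]] f_pos[OF _ assms(3), of "n + m"] assms by auto
  have "ln (f n x * f m ((shift_map ^^ n) x) * exp (- C)) \<le> ln (f (n + m) x)"
    using aa_lower[OF assms] pos by (subst ln_le_cancel_iff) auto
  moreover have "ln (f (n + m) x) \<le> ln (f n x * f m ((shift_map ^^ n) x) * exp C)"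
    using aa_upper[OF assms] pos by (subst ln_le_cancel_iff) auto
  ultimately show ?thesis using pos by (simp add: ln_mult abs_le_iff)
qed

end

section \<open>Gibbs and equilibrium measures\<close>

text \<open>\<open>coarse_letter {}\<close> is constant and thus provides one finite partition,
  whose rate is a limit of nonnegative numbers.\<close>

lemma (in shift_measure) measure_entropy_nonneg: "0 \<le> measure_entropy \<mu> shift_map"
proof -
  let ?X = "coarse_letter {}"
  have fin: "finite (?X ` space \<mu>)" by (rule coarse_letter_finite) simp
  have "0 \<le> entropy_rate ?X"
    by (rule LIMSEQ_le_const[OF entropy_rate_limit(1)[OF coarse_letter_measurable partition_entropy_fibers(1)[OF coarse_letter_measurable fin]]])
      (auto intro!: divide_nonneg_nonneg block_entropy_nonneg)
  then have "ereal 0 \<le> ereal (entropy_rate ?X)" by simp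
  also have "\<dots> \<le> measure_entropy \<mu> shift_map"
    by (rule entropy_rate_le_measure_entropy[OF coarse_letter_measurable fin])
  finally show ?thesis by (simp add: zero_ereal_def)
qed

context weighted_bowen_potential
begin

text \<open>Invariance of \<nu> lets almost additivity survive integration with the same constant,
  which keeps the integrals within \<open>C\<close> of a linear sequence.\<close>

lemma ln_f_expectation_almost_additive:
  assumes \<nu>: "shift_measure t \<nu>" and int: "\<And>n. 1 \<le> n \<Longrightarrow> integrable \<nu> (\<lambda>x. ln (f n x))"
    and n: "1 \<le> n" and m: "1 \<le> m"
  shows "\<bar>(\<integral>x. ln (f (n + m) x) \<partial>\<nu>) - (\<integral>x. ln (f n x) \<partial>\<nu>) - (\<integral>x. ln (f m x) \<partial>\<nu>)\<bar> \<le> C"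
proof -
  interpret \<nu>: shift_measure t \<nu> by fact
  note sh = \<nu>.expectation_funpow[OF int[OF m], of n]
  let ?d = "\<lambda>x. ln (f (n + m) x) - ln (f n x) - ln (f m ((shift_map ^^ n) x))"
  have I: "integrable \<nu> ?d"
    using int[of "n + m"] int[OF n] sh(1) n by (intro Bochner_Integration.integrable_diff) auto
  have "(\<integral>x. ln (f (n + m) x) \<partial>\<nu>) - (\<integral>x. ln (f n x) \<partial>\<nu>) - (\<integral>x. ln (f m x) \<partial>\<nu>) = (\<integral>x. ?d x \<partial>\<nu>)"
    using int[of "n + m"] int[OF n] sh n by simp
  moreover have "\<bar>\<integral>x. ?d x \<partial>\<nu>\<bar> \<le> (\<integral>x. \<bar>?d x\<bar> \<partial>\<nu>)" by (rule integral_abs_bound)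
  moreover have "(\<integral>x. \<bar>?d x\<bar> \<partial>\<nu>) \<le> (\<integral>x. C \<partial>\<nu>)"
    using I ln_f_almost_additive[OF n m] by (intro integral_mono) auto
  moreover have "(\<integral>x. C \<partial>\<nu>) = C" using \<nu>.prob_space by simp
  ultimately show ?thesis by linarith
qed

lemma ln_f_integrable:
  assumes \<nu>: "shift_measure t \<nu>" and int: "integrable \<nu> (\<lambda>x. ln (f 1 x))"
  shows "1 \<le> n \<Longrightarrow> integrable \<nu> (\<lambda>x. ln (f n x))"
proof (induction n rule: nat_induct_at_least)
  case base
  show ?case by (rule int)
next
  case (Suc n)
  interpret \<nu>: shift_measure t \<nu> by fact
  have meas: "(\<lambda>x. ln (f (Suc n) x)) \<in> borel_measurable \<nu>"
    using f_measurable[of "Suc n"] by (simp cong: measurable_cong_sets)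
  have I: "integrable \<nu> (\<lambda>x. \<bar>ln (f n x)\<bar> + \<bar>ln (f 1 ((shift_map ^^ n) x))\<bar> + C)"
    using Suc.IH \<nu>.expectation_funpow(1)[OF int, of n] by (intro Bochner_Integration.integrable_add integrable_abs) auto
  show ?case
  proof (rule Bochner_Integration.integrable_bound[OF I meas], rule AE_I2)
    fix x assume "x \<in> space \<nu>"
    then have "\<bar>ln (f (n + 1) x) - ln (f n x) - ln (f 1 ((shift_map ^^ n) x))\<bar> \<le> C"
      using Suc.hyps by (intro ln_f_almost_additive) auto
    then show "norm (ln (f (Suc n) x)) \<le> norm (\<bar>ln (f n x)\<bar> + \<bar>ln (f 1 ((shift_map ^^ n) x))\<bar> + C)"
      using C_nonneg unfolding real_norm_def by (simp del: funpow.simps)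
  qed
qed

definition f1_bound :: real where "f1_bound = max 0 (ln (B * Z 1))"

lemma ln_f1_le: "x \<in> markov_shift t \<Longrightarrow> ln (f 1 x) \<le> f1_bound"
proof -
  assume x: "x \<in> markov_shift t"
  have "f 1 x \<le> B * weight (init_word 1 x)"
    using f_le_weight[of x "init_word 1 x"] x admissible_init_word[OF x, of 1] by (simp add: cylinder_init_word)
  also have "\<dots> \<le> B * Z 1" using weight_le_Z[of "init_word 1 x"] B_ge_1 by (intro mult_left_mono) auto
  finally have "ln (f 1 x) \<le> ln (B * Z 1)" using f_pos[of 1 x] x B_ge_1 Z_pos[of 1] by (subst ln_le_cancel_iff) auto
  then show ?thesis by (simp add: f1_bound_def)
qed

text \<open>Controls every \<open>f n\<close> by \<open>f 1\<close> at the same point, so an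
  infinite negative part of \<open>ln (f 1)\<close> is inherited by all
  \<open>ln (f n)\<close>.\<close>

lemma ln_f_le:
  assumes x: "x \<in> markov_shift t" and "1 \<le> n"
  shows "ln (f n x) \<le> ln (f 1 x) + real n * (f1_bound + C)"
  using \<open>1 \<le> n\<close>
proof (induction n rule: nat_induct_at_least)
  case base
  show ?case using C_nonneg by (simp add: f1_bound_def)
next
  case (Suc n)
  have "ln (f (n + 1) x) \<le> ln (f n x) + ln (f 1 ((shift_map ^^ n) x)) + C"
    using ln_f_almost_additive[OF Suc.hyps _ x, of 1] by simp
  moreover have "ln (f 1 ((shift_map ^^ n) x)) \<le> f1_bound" using ln_f1_le[OF shift_map_funpow_markov[OF x]] .
  ultimately show ?case using Suc.IH by (simp add: algebra_simps)
qed

text \<open>Positive parts are bounded, so if \<open>ln (f 1)\<close> were not integrable, all the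
  integrals would be \<open>-\<infinity>\<close>, and the limit with them.\<close>

lemma integrable_of_finite_limit:
  assumes \<nu>: "shift_measure t \<nu>" and lim: "(\<lambda>n. integral_ext \<nu> (\<lambda>x. ln (f n x)) / ereal (real n)) \<longlonglongrightarrow> L" and L: "L \<noteq> -\<infinity>"
  shows "integrable \<nu> (\<lambda>x. ln (f 1 x))"
proof -
  interpret \<nu>: shift_measure t \<nu> by fact
  define b where "b = f1_bound + C"
  have b: "0 \<le> b" "f1_bound \<le> b" using C_nonneg by (auto simp: b_def f1_bound_def)
  have meas: "(\<lambda>x. ln (f n x)) \<in> borel_measurable \<nu>" if "1 \<le> n" for n
    using f_measurable[OF that] by (simp cong: measurable_cong_sets)
  have up: "(\<integral>\<^sup>+x. ennreal (ln (f n x)) \<partial>\<nu>) \<noteq> \<infinity>" if n: "1 \<le> n" for n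
  proof -
    have "(\<integral>\<^sup>+x. ennreal (ln (f n x)) \<partial>\<nu>) \<le> (\<integral>\<^sup>+x. ennreal (b + real n * b) \<partial>\<nu>)"
    proof (intro nn_integral_mono ennreal_leI)
      fix x assume "x \<in> space \<nu>"
      then show "ln (f n x) \<le> b + real n * b" using ln_f_le[of x n] ln_f1_le[of x] n b by (simp add: b_def)
    qed
    also have "\<dots> = ennreal (b + real n * b)" using \<nu>.emeasure_space_1 by simp
    finally show ?thesis by (auto simp: top_unique)
  qed
  have "(\<integral>\<^sup>+x. ennreal (- ln (f 1 x)) \<partial>\<nu>) \<noteq> \<infinity>"
  proof
    assume inf: "(\<integral>\<^sup>+x. ennreal (- ln (f 1 x)) \<partial>\<nu>) = \<infinity>"
    have "integral_ext \<nu> (\<lambda>x. ln (f n x)) / ereal (real n) = -\<infinity>" if n: "1 \<le> n" for n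
    proof -
      have "(\<integral>\<^sup>+x. ennreal (- ln (f 1 x)) \<partial>\<nu>) \<le> (\<integral>\<^sup>+x. ennreal (- ln (f n x)) + ennreal (real n * b) \<partial>\<nu>)"
      proof (rule nn_integral_mono)
        fix x assume x: "x \<in> space \<nu>"
        have "ennreal (- ln (f 1 x)) \<le> ennreal (max 0 (- ln (f n x)) + real n * b)"
          using ln_f_le[of x n] x n by (intro ennreal_leI) (simp add: b_def)
        also have "\<dots> = ennreal (- ln (f n x)) + ennreal (real n * b)"
          using b by (subst ennreal_plus) (auto simp: max_def ennreal_neg)
        finally show "ennreal (- ln (f 1 x)) \<le> ennreal (- ln (f n x)) + ennreal (real n * b)" .
      qed
      also have "\<dots> = (\<integral>\<^sup>+x. ennreal (- ln (f n x)) \<partial>\<nu>) + ennreal (real n * b)"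
        using meas[OF n] \<nu>.emeasure_space_1 by (subst nn_integral_add) auto
      finally have "(\<integral>\<^sup>+x. ennreal (- ln (f n x)) \<partial>\<nu>) = \<infinity>" using inf by (auto simp: top_unique)
      moreover obtain a where "(\<integral>\<^sup>+x. ennreal (ln (f n x)) \<partial>\<nu>) = ennreal a" "0 \<le> a"
        using up[OF n] by (metis ennreal_cases infinity_ennreal_def)
      ultimately have "integral_ext \<nu> (\<lambda>x. ln (f n x)) = -\<infinity>"
        by (simp add: integral_ext_def)
      then show ?thesis using n by simp
    qed
    then have "(\<lambda>n. integral_ext \<nu> (\<lambda>x. ln (f n x)) / ereal (real n)) \<longlonglongrightarrow> -\<infinity>"
      by (intro tendsto_eventually) (auto simp: eventually_sequentially)
    then show False using lim L LIMSEQ_unique by blast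
  qed
  then show ?thesis unfolding real_integrable_def using meas[of 1] up[of 1] by simp
qed

text \<open>Gibbs' inequality for the first letter, with reference weights proportional to
  \<open>weight [a]\<close>; their logarithms differ from \<open>ln (f 1)\<close> by a bounded
  amount.\<close>

lemma integrable_info_of_ln_f1:
  assumes \<nu>: "shift_measure t \<nu>" and int: "integrable \<nu> (\<lambda>x. ln (f 1 x))"
  shows "integrable \<nu> (prob_space.info \<nu> (\<lambda>x. x 0))"
proof -
  interpret \<nu>: shift_measure t \<nu> by fact
  define q where "q a = weight [a] / Z 1" for a
  have wp: "0 < weight [a]" for a by (rule weight_pos) simp
  show ?thesis
  proof (rule \<nu>.gibbs_inequality(1)[OF \<nu>.letter_measurable, where q = q])
    show "0 \<le> q a" for a using wp[of a] Z_pos[of 1] by (simp add: q_def)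
    have "(\<integral>\<^sup>+a. ennreal (q a) \<partial>count_space UNIV) = (\<integral>\<^sup>+a. ennreal (weight [a]) / ennreal (Z 1) \<partial>count_space UNIV)"
      using Z_pos[of 1] weight_nonneg by (intro nn_integral_cong) (simp add: q_def divide_ennreal)
    also have "\<dots> = ennreal (Z 1) / ennreal (Z 1)"
      by (simp add: nn_integral_divide S_Z[symmetric] S_def word_sum_1)
    also have "\<dots> = 1" using Z_pos[of 1] by (simp add: ennreal_divide_self)
    finally show "(\<integral>\<^sup>+a. ennreal (q a) \<partial>count_space UNIV) \<le> 1" by simp
    show "AE x in \<nu>. 0 < q (x 0)" using wp Z_pos[of 1] by (auto simp: q_def)
    have I: "integrable \<nu> (\<lambda>x. \<bar>ln (f 1 x)\<bar> + (\<bar>ln (Z 1)\<bar> + ln B))" using int by auto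
    have meas: "(\<lambda>x. - ln (q (x 0))) \<in> borel_measurable \<nu>"
      using \<nu>.countable_rv_function_measurable[OF \<nu>.letter_measurable, of "\<lambda>a. - ln (q a)"] .
    show "integrable \<nu> (\<lambda>x. - ln (q (x 0)))"
    proof (rule Bochner_Integration.integrable_bound[OF I meas], rule AE_I2)
      fix x assume "x \<in> space \<nu>"
      then have x: "x \<in> markov_shift t" "x \<in> cylinder t [x 0]" by (auto simp: cylinder_def)
      have fp: "0 < f 1 x" using f_pos x by simp
      have "f 1 x \<le> B * weight [x 0]" "weight [x 0] \<le> B * f 1 x"
        using f_le_weight[OF x(2)] weight_le_f[OF x(2)] by auto
      then have "ln (f 1 x) \<le> ln (B * weight [x 0])" "ln (weight [x 0]) \<le> ln (B * f 1 x)"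
        using fp wp[of "x 0"] B_ge_1 by (auto simp: ln_le_cancel_iff)
      then have "ln (f 1 x) \<le> ln B + ln (weight [x 0])" "ln (weight [x 0]) \<le> ln B + ln (f 1 x)"
        using fp wp[of "x 0"] B_ge_1 by (auto simp: ln_mult)
      moreover have "- ln (q (x 0)) = ln (Z 1) - ln (weight [x 0])"
        using wp[of "x 0"] Z_pos[of 1] by (simp add: q_def ln_div)
      moreover have "0 \<le> ln B" using B_ge_1 by simp
      ultimately show "norm (- ln (q (x 0))) \<le> norm (\<bar>ln (f 1 x)\<bar> + (\<bar>ln (Z 1)\<bar> + ln B))"
        unfolding real_norm_def by linarith
    qed
  qed
qed

end

section \<open>The Gibbs measure as unique equilibrium measure\<close>

locale bowen_gibbs = weighted_bowen_potential t f C B \<kappa> N + shift_measure t \<mu>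
  for t :: "'s::countable \<Rightarrow> 's \<Rightarrow> nat" and f :: "nat \<Rightarrow> (nat \<Rightarrow> 's) \<Rightarrow> real" and C B \<kappa> :: real and N :: nat and \<mu> +
  fixes K :: real
  assumes K_pos: "0 < K"
    and g_upper: "measure \<mu> (cylinder t w) \<le> K * (weight w * exp (- real (length w) * P))"
    and g_lower: "weight w * exp (- real (length w) * P) \<le> K * measure \<mu> (cylinder t w)"
begin

lemma cylinder_pos: "admissible t w \<Longrightarrow> 0 < measure \<mu> (cylinder t w)"
proof -
  assume "admissible t w"
  then have "0 < weight w * exp (- real (length w) * P)" using weight_pos by simp
  also have "\<dots> \<le> K * measure \<mu> (cylinder t w)" by (rule g_lower)
  finally show ?thesis using K_pos by (simp add: zero_less_mult_iff)
qed

text \<open>The cylinder of one connected word \<open>u @ c @ w\<close> lies in the intersection.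
  Upper bounds for \<open>u\<close> and \<open>w\<close> and the lower bound for the connected word
  give \<open>K ^ 3\<close>; the \<open>N\<close> letters of the gap give
  \<open>exp (- real N * P)\<close>.\<close>

sublocale quasi_bernoulli_measure t \<mu> "\<kappa> * exp (- real N * P) / K ^ 3" N
proof
  show "0 < \<kappa> * exp (- real N * P) / K ^ 3" using \<kappa>_pos K_pos by simp
  fix u w
  obtain c where c: "length c = N" "\<kappa> * weight u * weight w \<le> weight (u @ c @ w)" using g_connect by blast
  have "measure \<mu> (cylinder t u) * measure \<mu> (cylinder t w)
      \<le> (K * (weight u * exp (- real (length u) * P))) * (K * (weight w * exp (- real (length w) * P)))"
    by (intro mult_mono g_upper) (use K_pos weight_nonneg in auto)
  then have "\<kappa> * exp (- real N * P) * (measure \<mu> (cylinder t u) * measure \<mu> (cylinder t w))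
      \<le> \<kappa> * exp (- real N * P) * ((K * (weight u * exp (- real (length u) * P))) * (K * (weight w * exp (- real (length w) * P))))"
    using \<kappa>_pos by (intro mult_left_mono) auto
  also have "\<dots> = K ^ 2 * ((\<kappa> * weight u * weight w) * exp (- real (length (u @ c @ w)) * P))"
  proof -
    have "exp (- real (length (u @ c @ w)) * P) = exp (- real N * P) * (exp (- real (length u) * P) * exp (- real (length w) * P))"
      by (simp add: c(1) exp_add[symmetric] algebra_simps)
    then show ?thesis by (simp add: power2_eq_square mult_ac)
  qed
  also have "\<dots> \<le> K ^ 2 * (weight (u @ c @ w) * exp (- real (length (u @ c @ w)) * P))"
    using c(2) by (intro mult_left_mono mult_right_mono) auto
  also have "\<dots> \<le> K ^ 2 * (K * measure \<mu> (cylinder t (u @ c @ w)))" by (intro mult_left_mono g_lower) auto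
  also have "\<dots> \<le> K ^ 3 * measure \<mu> (cylinder t u \<inter> ((shift_map ^^ (length u + N)) -` cylinder t w \<inter> markov_shift t))"
  proof -
    have "cylinder t (u @ c @ w) \<subseteq> cylinder t u \<inter> ((shift_map ^^ (length u + N)) -` cylinder t w \<inter> markov_shift t)"
    proof
      fix x assume x: "x \<in> cylinder t (u @ c @ w)"
      then have xS: "x \<in> markov_shift t" by (simp add: cylinder_def)
      have "init_word (length u) x @ init_word N ((shift_map ^^ length u) x) @ init_word (length w) ((shift_map ^^ (length u + N)) x) = u @ c @ w"
        using x init_word_add[of "length u + N" "length w" x] init_word_add[of "length u" N x] by (simp add: cylinder_init_word c(1) add.assoc)
      then have "init_word (length u) x = u" "init_word (length w) ((shift_map ^^ (length u + N)) x) = w"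
        using c(1) by auto
      then show "x \<in> cylinder t u \<inter> ((shift_map ^^ (length u + N)) -` cylinder t w \<inter> markov_shift t)"
        using xS shift_map_funpow_markov[OF xS] by (simp add: cylinder_init_word)
    qed
    then have "measure \<mu> (cylinder t (u @ c @ w)) \<le> measure \<mu> (cylinder t u \<inter> ((shift_map ^^ (length u + N)) -` cylinder t w \<inter> markov_shift t))"
      by (rule finite_measure_mono) simp
    then show ?thesis using K_pos by (simp add: power2_eq_square power3_eq_cube mult_ac)
  qed
  finally show "\<kappa> * exp (- real N * P) / K ^ 3 * measure \<mu> (cylinder t u) * measure \<mu> (cylinder t w)
      \<le> measure \<mu> (cylinder t u \<inter> ((shift_map ^^ (length u + N)) -` cylinder t w \<inter> markov_shift t))"
    using K_pos by (simp add: field_simps)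
qed

lemma gibbs_bounds:
  assumes w: "admissible t w" and x: "x \<in> cylinder t w"
  shows "1 / (K * B) \<le> measure \<mu> (cylinder t w) / (exp (- real (length w) * P) * f (length w) x)"
    and "measure \<mu> (cylinder t w) / (exp (- real (length w) * P) * f (length w) x) \<le> K * B"
proof -
  define e where "e = exp (- real (length w) * P)"
  define m where "m = measure \<mu> (cylinder t w)"
  have l: "1 \<le> length w" using w by (cases w) (auto simp: admissible_def)
  have fp: "0 < f (length w) x" using f_pos[OF l] x by (simp add: cylinder_def)
  have e: "0 < e" by (simp add: e_def)
  have KB: "0 < K * B" using K_pos B_ge_1 by simp
  have "m \<le> K * (weight w * e)" using g_upper[of w] by (simp add: m_def e_def)
  also have "\<dots> \<le> K * (B * f (length w) x * e)"
    using weight_le_f[OF x w] K_pos e by (intro mult_left_mono mult_right_mono) auto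
  finally show "measure \<mu> (cylinder t w) / (exp (- real (length w) * P) * f (length w) x) \<le> K * B"
    using fp e unfolding m_def[symmetric] e_def[symmetric] by (simp add: divide_le_eq mult_ac)
  have "f (length w) x * e \<le> B * weight w * e" using f_le_weight[OF x w] e by (intro mult_right_mono) auto
  also have "\<dots> \<le> B * (K * m)" using mult_left_mono[OF g_lower[of w], of B] B_ge_1 by (simp add: m_def e_def mult_ac)
  finally show "1 / (K * B) \<le> measure \<mu> (cylinder t w) / (exp (- real (length w) * P) * f (length w) x)"
    using fp e KB unfolding m_def[symmetric] e_def[symmetric] by (simp add: divide_simps mult_ac)
qed

lemma gibbs: "gibbs_measure t f \<mu>"
  unfolding gibbs_measure_def
  using inv gibbs_bounds K_pos B_ge_1 by (intro conjI exI[of _ "K * B"] exI[of _ P]) auto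

text \<open>The Gibbs inequality on the logarithmic scale. Its error does not depend on
  \<open>n\<close>, so it disappears in rates and stays bounded in relative entropies.\<close>

lemma ln_f_info:
  assumes x: "x \<in> markov_shift t" and n: "1 \<le> n"
  shows "\<bar>ln (f n x) - ln (measure \<mu> (cylinder t (init_word n x))) - real n * P\<bar> \<le> ln (K * B)"
proof -
  define m where "m = measure \<mu> (cylinder t (init_word n x))"
  have w: "admissible t (init_word n x)" using admissible_init_word[OF x] n by simp
  have xc: "x \<in> cylinder t (init_word n x)" using x by (simp add: cylinder_init_word)
  have pos: "0 < m" "0 < f n x" "0 < K * B" using cylinder_pos[OF w] f_pos[OF n x] K_pos B_ge_1 by (auto simp: m_def)
  define r where "r = m / (exp (- real n * P) * f n x)"
  have r: "0 < r" "ln r = ln m + real n * P - ln (f n x)"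
    using pos by (auto simp: r_def ln_div ln_mult)
  have "1 / (K * B) \<le> r" "r \<le> K * B" using gibbs_bounds[OF w xc] by (simp_all add: r_def m_def)
  then have "ln (1 / (K * B)) \<le> ln r" "ln r \<le> ln (K * B)" using pos r(1) by (auto simp: ln_le_cancel_iff)
  moreover have "ln (1 / (K * B)) = - ln (K * B)" using K_pos B_ge_1 by (simp add: ln_div)
  ultimately show ?thesis using r(2) by (simp add: m_def abs_le_iff)
qed

lemma info_init_word: "info (init_word n) x = - ln (measure \<mu> (cylinder t (init_word n x)))"
  by (simp add: info_def fiber_prob_init_word)

lemma finite_entropy_integrable:
  assumes "measure_entropy \<mu> shift_map < \<infinity>"
  shows "integrable \<mu> (info letter)"
proof (rule integrable_info_letter[OF _ _ assms])
  define D where "D = exp C * B ^ 3"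
  have D: "0 < D" using B_ge_1 by (simp add: D_def)
  \<comment> \<open>\<open>K ^ 3\<close> collects the upper bound for the long word and the lower
    bounds for its two parts; \<open>D\<close> is the price of cutting off the first letter.\<close>
  show "0 < K ^ 3 * D" using K_pos D by simp
  fix a w
  have "measure \<mu> (cylinder t (a # w)) \<le> K * (weight ([a] @ w) * exp (- real (Suc (length w)) * P))"
    using g_upper[of "a # w"] by simp
  also have "\<dots> \<le> K * ((D * weight [a] * weight w) * exp (- real (Suc (length w)) * P))"
    using g_append_le[of "[a]" w] K_pos unfolding D_def by (intro mult_left_mono mult_right_mono) auto
  also have "\<dots> = K * D * ((weight [a] * exp (- real (length [a]) * P)) * (weight w * exp (- real (length w) * P)))"
  proof -
    have "exp (- real (Suc (length w)) * P) = exp (- real (length [a]) * P) * exp (- real (length w) * P)"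
      by (simp add: exp_add[symmetric] algebra_simps)
    then show ?thesis by (simp add: mult_ac)
  qed
  also have "\<dots> \<le> K * D * ((K * measure \<mu> (cylinder t [a])) * (K * measure \<mu> (cylinder t w)))"
    using K_pos D weight_nonneg by (intro mult_left_mono mult_mono g_lower) auto
  finally show "measure \<mu> (cylinder t (a # w)) \<le> K ^ 3 * D * measure \<mu> (cylinder t [a]) * measure \<mu> (cylinder t w)"
    by (simp add: power3_eq_cube mult_ac)
qed

lemma ln_f_integrable_of_info:
  assumes "integrable \<mu> (info letter)" and n: "1 \<le> n"
  shows "integrable \<mu> (\<lambda>x. ln (f n x))"
    and "\<bar>(\<integral>x. ln (f n x) \<partial>\<mu>) + block_entropy letter n - real n * P\<bar> \<le> ln (K * B)"
proof -
  have In: "integrable \<mu> (info (init_word n))"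
    using info_itinerary_integrable[OF letter_measurable assms(1), of n] by (simp add: itinerary_letter)
  have meas: "(\<lambda>x. ln (f n x)) \<in> borel_measurable \<mu>"
    using f_measurable[OF n] by (simp cong: measurable_cong_sets)
  let ?d = "\<lambda>x. ln (f n x) + info (init_word n) x - real n * P"
  have d: "\<bar>?d x\<bar> \<le> ln (K * B)" if "x \<in> space \<mu>" for x
    using ln_f_info[of x n] that n by (simp add: info_init_word)
  have I: "integrable \<mu> (\<lambda>x. info (init_word n) x + (\<bar>real n * P\<bar> + ln (K * B)))" using In by auto
  show int: "integrable \<mu> (\<lambda>x. ln (f n x))"
  proof (rule Bochner_Integration.integrable_bound[OF I meas], rule AE_I2)
    fix x assume "x \<in> space \<mu>"
    from d[OF this] show "norm (ln (f n x)) \<le> norm (info (init_word n) x + (\<bar>real n * P\<bar> + ln (K * B)))"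
      using info_nonneg[of "init_word n" x] unfolding real_norm_def by linarith
  qed
  have "(\<integral>x. ln (f n x) \<partial>\<mu>) + block_entropy letter n - real n * P = (\<integral>x. ?d x \<partial>\<mu>)"
    using int In prob_space by (simp add: block_entropy_def itinerary_letter)
  moreover have "\<bar>\<integral>x. ?d x \<partial>\<mu>\<bar> \<le> (\<integral>x. \<bar>?d x\<bar> \<partial>\<mu>)" by (rule integral_abs_bound)
  moreover have "(\<integral>x. \<bar>?d x\<bar> \<partial>\<mu>) \<le> (\<integral>x. ln (K * B) \<partial>\<mu>)"
    using int In d by (intro integral_mono) auto
  moreover have "(\<integral>x. ln (K * B) \<partial>\<mu>) = ln (K * B)" using prob_space by simp
  ultimately show "\<bar>(\<integral>x. ln (f n x) \<partial>\<mu>) + block_entropy letter n - real n * P\<bar> \<le> ln (K * B)" by linarith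
qed

text \<open>Integrating \<open>ln_f_info\<close> shows that the block entropy and the integral of
  \<open>ln (f n)\<close> add up to \<open>real n * P\<close> within a constant; division by
  \<open>n\<close> gives the identity.\<close>

lemma equilibrium:
  assumes "measure_entropy \<mu> shift_map < \<infinity>"
  shows "equilibrium_measure t f \<mu>"
proof -
  note int = finite_entropy_integrable[OF assms]
  note lf = ln_f_integrable_of_info[OF int]
  define r where "r = entropy_rate letter"
  have h: "measure_entropy \<mu> shift_map = ereal r" unfolding r_def by (rule measure_entropy_eq_rate[OF int])
  define a where "a n = (\<integral>x. ln (f n x) \<partial>\<mu>)" for n
  have a_lim: "(\<lambda>n. a n / real n) \<longlonglongrightarrow> P - r"
  proof -
    have l1: "(\<lambda>n. P - block_entropy letter n / real n) \<longlonglongrightarrow> P - r"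
      unfolding r_def by (intro tendsto_diff tendsto_const entropy_rate_limit(1)[OF letter_measurable int])
    have "(\<lambda>n. a n / real n - (P - block_entropy letter n / real n)) \<longlonglongrightarrow> 0"
    proof (rule Lim_null_comparison[OF _ lim_const_over_n[of "ln (K * B)"]])
      show "\<forall>\<^sub>F n in sequentially. norm (a n / real n - (P - block_entropy letter n / real n)) \<le> ln (K * B) / real n"
        using eventually_ge_at_top[of 1]
      proof eventually_elim
        fix n :: nat assume n: "1 \<le> n"
        then have "a n / real n - (P - block_entropy letter n / real n) = (a n + block_entropy letter n - real n * P) / real n"
          by (simp add: field_simps)
        then show "norm (a n / real n - (P - block_entropy letter n / real n)) \<le> ln (K * B) / real n"
          using lf(2)[OF n] n by (simp add: a_def abs_divide divide_right_mono)
      qed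
    qed
    from tendsto_add[OF this l1] show ?thesis by simp
  qed
  have "(\<lambda>n. integral_ext \<mu> (\<lambda>x. ln (f n x)) / ereal (real n)) \<longlonglongrightarrow> ereal (P - r)"
  proof (rule Lim_transform_eventually[OF tendsto_ereal[OF a_lim]])
    show "\<forall>\<^sub>F n in sequentially. ereal (a n / real n) = integral_ext \<mu> (\<lambda>x. ln (f n x)) / ereal (real n)"
      using eventually_ge_at_top[of 1]
      by eventually_elim (simp add: integral_ext_integrable[OF lf(1)] a_def)
  qed
  moreover have "gurevich_pressure t f = measure_entropy \<mu> shift_map + ereal (P - r)"
    by (simp add: gurevich_pressure_eq h)
  ultimately show ?thesis unfolding equilibrium_measure_def using inv by blast
qed

text \<open>With \<open>P = h + l\<close>, block entropies are at least \<open>real n * h\<close>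
  because the rate is an infimum, and the integral of \<open>ln (f n)\<close> is within
  \<open>C\<close> of \<open>real n * l\<close>. Hence the relative entropy on words stays below
  \<open>C + ln (K * B)\<close> for all lengths.\<close>

lemma equilibrium_unique:
  assumes "equilibrium_measure t f \<nu>" shows "\<nu> = \<mu>"
proof -
  obtain L where inv\<nu>: "\<nu> \<in> invariant_measures t"
    and lim: "(\<lambda>n. integral_ext \<nu> (\<lambda>x. ln (f n x)) / ereal (real n)) \<longlonglongrightarrow> L"
    and eq: "ereal P = measure_entropy \<nu> shift_map + L"
    using assms unfolding equilibrium_measure_def gurevich_pressure_eq by blast
  interpret \<nu>: shift_measure t \<nu> by unfold_locales (rule inv\<nu>)
  have \<nu>: "shift_measure t \<nu>" by (rule \<nu>.shift_measure_axioms)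
  \<comment> \<open>Infinite entropy would make the sum \<open>\<infinity>\<close> by the
    \<open>ereal\<close> convention, against the finite pressure.\<close>
  obtain h l where h: "measure_entropy \<nu> shift_map = ereal h" and L: "L = ereal l" and Pl: "P = h + l"
    using eq \<nu>.measure_entropy_nonneg by (cases "measure_entropy \<nu> shift_map"; cases L) auto
  have int1: "integrable \<nu> (\<lambda>x. ln (f 1 x))" by (rule integrable_of_finite_limit[OF \<nu> lim]) (simp add: L)
  note int = ln_f_integrable[OF \<nu> int1]
  note info_int = integrable_info_of_ln_f1[OF \<nu> int1]
  define a where "a n = (\<integral>x. ln (f n x) \<partial>\<nu>)" for n
  have "\<bar>a (n + m) - a n - a m\<bar> \<le> C" if "0 < n" "0 < m" for n m
    unfolding a_def using that by (intro ln_f_expectation_almost_additive[OF \<nu> int]) auto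
  from almost_additive_limit[of a C, OF this] obtain l' where l': "(\<lambda>n. a n / real n) \<longlonglongrightarrow> l'" "\<And>n. 0 < n \<Longrightarrow> \<bar>a n - real n * l'\<bar> \<le> C"
    by blast
  have "(\<lambda>n. integral_ext \<nu> (\<lambda>x. ln (f n x)) / ereal (real n)) \<longlonglongrightarrow> ereal l'"
  proof (rule Lim_transform_eventually[OF tendsto_ereal[OF l'(1)]])
    show "\<forall>\<^sub>F n in sequentially. ereal (a n / real n) = integral_ext \<nu> (\<lambda>x. ln (f n x)) / ereal (real n)"
      using eventually_ge_at_top[of 1]
      by eventually_elim (simp add: integral_ext_integrable[OF int] a_def)
  qed
  then have "l' = l" using lim L LIMSEQ_unique by fastforce
  have h_le: "real n * h \<le> \<nu>.block_entropy letter n" if "0 < n" for n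
    using \<nu>.entropy_rate_limit(2)[OF \<nu>.letter_measurable info_int that] \<nu>.measure_entropy_eq_rate[OF info_int] h that
    by (simp add: field_simps)
  have cmp: "\<bar>ln (f n x) - ln (measure \<mu> (cylinder t (init_word n x))) - real n * P\<bar> \<le> ln (K * B)" if "0 < n" "x \<in> space \<nu>" for n x
    using that by (intro ln_f_info) auto
  have int_ln: "integrable \<nu> (\<lambda>x. - ln (measure \<mu> (cylinder t (init_word n x))))" if n: "0 < n" for n
  proof -
    have I: "integrable \<nu> (\<lambda>x. \<bar>ln (f n x)\<bar> + (\<bar>real n * P\<bar> + ln (K * B)))" using int[of n] n by auto
    have meas: "(\<lambda>x. - ln (measure \<mu> (cylinder t (init_word n x)))) \<in> borel_measurable \<nu>"
      using \<nu>.countable_rv_function_measurable[OF \<nu>.init_word_measurable, of "\<lambda>w. - ln (measure \<mu> (cylinder t w))" n] .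
    show ?thesis
    proof (rule Bochner_Integration.integrable_bound[OF I meas], rule AE_I2)
      fix x assume "x \<in> space \<nu>"
      from cmp[OF n this] show "norm (- ln (measure \<mu> (cylinder t (init_word n x)))) \<le> norm (\<bar>ln (f n x)\<bar> + (\<bar>real n * P\<bar> + ln (K * B)))"
        unfolding real_norm_def by linarith
    qed
  qed
  have bound: "(\<integral>x. - ln (measure \<mu> (cylinder t (init_word n x))) \<partial>\<nu>) \<le> (\<integral>x. prob_space.info \<nu> (init_word n) x \<partial>\<nu>) + (C + ln (K * B))"
    if n: "0 < n" for n
  proof -
    have "(\<integral>x. - ln (measure \<mu> (cylinder t (init_word n x))) \<partial>\<nu>) \<le> (\<integral>x. real n * P - ln (f n x) + ln (K * B) \<partial>\<nu>)"
    proof (rule integral_mono[OF int_ln[OF n]])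
      show "integrable \<nu> (\<lambda>x. real n * P - ln (f n x) + ln (K * B))" using int[of n] n by auto
      fix x assume "x \<in> space \<nu>"
      from cmp[OF n this] show "- ln (measure \<mu> (cylinder t (init_word n x))) \<le> real n * P - ln (f n x) + ln (K * B)" by linarith
    qed
    also have "\<dots> = real n * P - a n + ln (K * B)" using int[of n] n \<nu>.prob_space by (simp add: a_def)
    also have "\<dots> \<le> \<nu>.block_entropy letter n + (C + ln (K * B))"
      using h_le[OF n] l'(2)[OF n] unfolding Pl \<open>l' = l\<close> by (simp add: algebra_simps abs_le_iff)
    finally show ?thesis by (simp add: \<nu>.block_entropy_def \<nu>.itinerary_letter)
  qed
  have "absolutely_continuous \<mu> \<nu>"
    by (rule absolutely_continuous_of_info_bound[OF \<nu> cylinder_pos int_ln bound])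
  then show ?thesis by (rule absolutely_continuous_unique[OF inv\<nu>])
qed

end

theorem theorem4p1:
  fixes t :: "'s::countable \<Rightarrow> 's \<Rightarrow> nat"
    and f :: "nat \<Rightarrow> (nat \<Rightarrow> 's) \<Rightarrow> real"
  assumes "transition_matrix t"
    and "topologically_mixing t"
    and "BIP t"
    and "positive_continuous_seq t f"
    and "almost_additive t f"
    and "bowen_seq t f"
    and "(\<Sum>\<^sub>\<infinity>a\<in>UNIV. SUP x\<in>cylinder t [a]. ennreal (f 1 x)) < \<infinity>"
  shows "\<exists>\<mu>. gibbs_measure t f \<mu> \<and> mixing_map \<mu> shift_map \<and>
           (measure_entropy \<mu> shift_map < \<infinity> \<longrightarrow>
              equilibrium_measure t f \<mu> \<and>
              (\<forall>\<nu>. equilibrium_measure t f \<nu> \<longrightarrow> \<nu> = \<mu>))"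
proof -
  obtain C where C: "0 \<le> C" "\<And>n m x. 1 \<le> n \<Longrightarrow> 1 \<le> m \<Longrightarrow> x \<in> markov_shift t \<Longrightarrow>
        f n x * f m ((shift_map ^^ n) x) * exp (- C) \<le> f (n + m) x \<and>
        f (n + m) x \<le> f n x * f m ((shift_map ^^ n) x) * exp C"
    using assms(5) unfolding almost_additive_def by blast
  obtain B where B: "(SUP n\<in>{1..}. bowen_variation t f n) \<le> ereal B"
    using assms(6) unfolding bowen_seq_def by blast
  have bowen: "f n x \<le> B * f n y"
    if n: "1 \<le> n" and x: "x \<in> markov_shift t" and y: "y \<in> markov_shift t" and eq: "init_word n x = init_word n y" for n x y
  proof -
    have "ereal (f n x / f n y) \<le> bowen_variation t f n"
      unfolding bowen_variation_def using x y eq by (intro Sup_upper) (auto simp: init_word_eq_iff)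
    also have "\<dots> \<le> (SUP n\<in>{1..}. bowen_variation t f n)" using n by (intro SUP_upper) auto
    also have "\<dots> \<le> ereal B" by (rule B)
    finally have "f n x / f n y \<le> B" by simp
    moreover have "0 < f n y" using assms(4) n y by (simp add: positive_continuous_seq_def)
    ultimately show ?thesis by (simp add: divide_le_eq)
  qed
  interpret bowen_potential t f C B
    using assms C bowen by unfold_locales auto
  obtain \<kappa> N where "quasi_multiplicative weight (exp C * B ^ 3) \<kappa> N" using quasi_multiplicative_weight by blast
  then interpret weighted_bowen_potential t f C B \<kappa> N
    by (intro weighted_bowen_potential.intro bowen_potential_axioms)
  obtain \<mu> K where "0 < K" "\<mu> \<in> invariant_measures t"
    "\<And>w. measure \<mu> (cylinder t w) \<le> K * (weight w * exp (- real (length w) * P))"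
    "\<And>w. weight w * exp (- real (length w) * P) \<le> K * measure \<mu> (cylinder t w)"
    using gibbs_weights_measure_exists by blast
  then interpret bowen_gibbs t f C B \<kappa> N \<mu> K
    by unfold_locales auto
  show ?thesis using gibbs mixing equilibrium equilibrium_unique by blast
qed

end
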